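(* Let $\alpha>0$ and let $A$ be a finite subset of $\mathbb Z^2$ with $0\in A$. Then $$\lim_{n\to\infty}\mathbb P\big[\Upsilon_nA\subset U^{(n)}_{t_\alpha}\ \big|\ 0\in U^{(n)}_{t_\alpha}\big]=\exp(-\pi\alpha\,\mathrm{cap}(A)).$$
   Context: Let $(S_k)$ be simple random walk on $\mathbb Z^2$, $P_x$ its law from $x$, $\tau_1(A)=\inf\{k\ge1:S_k\in A\}$. The potential kernel is $a(x)=\sum_{k\ge0}(P_0[S_k=0]-P_x[S_k=0])$. For finite nonempty $A$, $\mathrm{hm}_A(x)=\lim_{\|y\|\to\infty}P_y[S_{\tau_1(A)}=x]$, and for finite $A\ni0$, $\mathrm{cap}(A)=\sum_{x\in A}a(x)\mathrm{hm}_A(x)$. Let $\mathbb Z^2_n=\mathbb Z^2/n\mathbb Z^2$ be the discrete torus and $\Upsilon_n:\mathbb Z^2\to\mathbb Z^2_n$ the projection modulo $n$. Let $(X_k)_{k\ge0}$ be simple random walk on $\mathbb Z^2_n$ with $X_0$ uniformly distributed, $T_n(x)=\inf\{t\ge0:X_t=x\}$, and $U^{(n)}_t=\{x\in\mathbb Z^2_n:T_n(x)>t\}$ the uncovered set at time $t$. Set $t_\alpha=\frac{4\alpha}{\pi}n^2\ln^2n$. *)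

theory Defs
  imports "HOL-Analysis.Analysis"
begin

definition steps :: "(int \<times> int) set" where
  "steps = {(1,0), (-1,0), (0,1), (0,-1)}"

text \<open>srw_p k x y = P_x[S_k = y] for simple random walk on Z^2
  (first-step decomposition).\<close>

fun srw_p :: "nat \<Rightarrow> int \<times> int \<Rightarrow> int \<times> int \<Rightarrow> real" where
  "srw_p 0 x y = (if x = y then 1 else 0)"
| "srw_p (Suc k) x y = (\<Sum>e\<in>steps. srw_p k (x + e) y) / 4"

definition pot :: "int \<times> int \<Rightarrow> real" where
  "pot x = (\<Sum>k. srw_p k (0,0) (0,0) - srw_p k x (0,0))"

text \<open>avoid_p A k z x = P_z[S_k = x and S_j \<notin> A for all 0 \<le> j < k].\<close>

fun avoid_p :: "(int \<times> int) set \<Rightarrow> nat \<Rightarrow> int \<times> int \<Rightarrow> int \<times> int \<Rightarrow> real" where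
  "avoid_p A 0 z x = (if z = x then 1 else 0)"
| "avoid_p A (Suc k) z x =
     (if z \<in> A then 0 else (\<Sum>e\<in>steps. avoid_p A k (z + e) x) / 4)"

text \<open>hit_dist A y x = P_y[S_{tau_1(A)} = x], where tau_1(A) = inf{k \<ge> 1 : S_k \<in> A};
  the event {tau_1(A) = k+1, S_{k+1} = x} is decomposed by the first step.\<close>

definition hit_dist :: "(int \<times> int) set \<Rightarrow> int \<times> int \<Rightarrow> int \<times> int \<Rightarrow> real" where
  "hit_dist A y x =
     (if x \<in> A then (\<Sum>k. (\<Sum>e\<in>steps. avoid_p A k (y + e) x) / 4) else 0)"

text \<open>Harmonic measure: limit as |y| \<rightarrow> \<infinity>; on Z^2 this is the cofinite filter.\<close>

definition hm :: "(int \<times> int) set \<Rightarrow> int \<times> int \<Rightarrow> real" where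
  "hm A x = Lim cofinite (\<lambda>y. hit_dist A y x)"

definition cap :: "(int \<times> int) set \<Rightarrow> real" where
  "cap A = (\<Sum>x\<in>A. pot x * hm A x)"

definition torus :: "nat \<Rightarrow> (int \<times> int) set" where
  "torus n = {0..<int n} \<times> {0..<int n}"

definition proj :: "nat \<Rightarrow> int \<times> int \<Rightarrow> int \<times> int" where
  "proj n x = (fst x mod int n, snd x mod int n)"

text \<open>torus_avoid n B m x = P_x[X_j \<notin> B for all 0 \<le> j \<le> m] for SRW on Z^2_n.\<close>

fun torus_avoid :: "nat \<Rightarrow> (int \<times> int) set \<Rightarrow> nat \<Rightarrow> int \<times> int \<Rightarrow> real" where
  "torus_avoid n B 0 x = (if x \<in> B then 0 else 1)"
| "torus_avoid n B (Suc m) x =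
     (if x \<in> B then 0 else (\<Sum>e\<in>steps. torus_avoid n B m (proj n (x + e))) / 4)"

text \<open>P[B \<subseteq> U_t] with X_0 uniform: T(x) > t iff x not visited at times 0..floor t.\<close>

definition uncovered_prob :: "nat \<Rightarrow> (int \<times> int) set \<Rightarrow> real \<Rightarrow> real" where
  "uncovered_prob n B t =
     (\<Sum>x\<in>torus n. torus_avoid n B (nat \<lfloor>t\<rfloor>) x) / (real n)^2"

definition t_alpha :: "real \<Rightarrow> nat \<Rightarrow> real" where
  "t_alpha \<alpha> n = 4 * \<alpha> / pi * (real n)^2 * (ln (real n))^2"

text \<open>P[Upsilon_n A \<subseteq> U_t | 0 \<in> U_t] = P[Upsilon_n A \<union> {0} \<subseteq> U_t] / P[0 \<in> U_t].\<close>

definition cond_uncovered :: "nat \<Rightarrow> (int \<times> int) set \<Rightarrow> real \<Rightarrow> real" where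
  "cond_uncovered n A t =
     uncovered_prob n (proj n ` A \<union> {(0,0)}) t / uncovered_prob n {(0,0)} t"

end

theory Submission
  imports Defs "HOL-Real_Asymp.Real_Asymp"
begin

text \<open>
  Let \<open>B\<close> be the projection of \<open>A\<close> to the torus, \<open>N = n\<^sup>2\<close>, and let \<open>\<lambda>\<close> be the principal eigenvalue of
  the walk killed on \<open>B\<close>. Since the principal eigenfunction is almost constant, the probability that
  \<open>B\<close> is uncovered at time \<open>t\<close> is asymptotic to \<open>\<lambda>\<^sup>t\<close>, uniformly in \<open>t\<close>. Write \<open>g\<close> for the zero-mean
  Green function of the torus. Applying it to the eigenvalue equation, normalising the eigenfunction
  to mean one and evaluating on \<open>B\<close> gives
  \<open>1 / ((1 - \<lambda>) N) = g(0) - \<Sum>\<^sub>y (g(0) - g(x - y)) \<nu>(y) + o(1)\<close> for all \<open>x \<in> B\<close>, where \<open>\<nu>\<close> is a probability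
  vector on \<open>B\<close>. As \<open>g(0) - g\<close> converges to the potential kernel \<open>a\<close>, and \<open>\<Sum>\<^sub>x a(x - y) hm(x) = cap A\<close>
  for all \<open>y \<in> A\<close>, averaging over \<open>x\<close> with weights \<open>hm\<close> removes the unknown \<open>\<nu>\<close> and yields
  \<open>1 / ((1 - \<lambda>) N) = g(0) - cap A + o(1)\<close>. Comparing with \<open>A = {0}\<close>, and using \<open>g(0) \<sim> (2 / \<pi>) ln n\<close>, gives
  the ratio of the two powers at time \<open>t\<^sub>\<alpha>\<close>.
\<close>

section \<open>Fourier analysis on the discrete torus\<close>

text \<open>The limit turns on an additive constant. Write
  \<open>1 - \<lambda> = \<epsilon> / n^2\<close>. Since \<open>\<epsilon>\<close> is of order
  \<open>1 / ln n\<close>, the exponent at the given time grows like \<open>ln n\<close>, so a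
  finite ratio requires \<open>1 / \<epsilon>\<close> up to o(1). The term \<open>g(0)\<close> is
  controlled only up to a bounded error, but it is the same for \<open>A\<close> and for
  \<open>{0}\<close> and cancels; elsewhere its leading order suffices. The eigenfunction is almost
  constant because nonconstant modes have energy at least \<open>2 / n^2\<close> per unit of squared
  norm, while the eigenfunction has \<open>\<epsilon> / n^2\<close>; its relative variance is
  therefore O(\<epsilon>). This needs \<open>\<epsilon>\<close> to vanish beforehand, which a test
  function in the Rayleigh quotient supplies. Harmonic measure is defined through hitting
  probabilities, whereas the argument needs its potential to be constant on \<open>A\<close>. The
  bridge is algebraic: \<open>a\<close> is strictly negative definite on weights of total zero, so
  Dirichlet problems on \<open>A\<close> are solved by a constant plus a potential of such weights.
  These solutions are bounded, recurrence identifies them with hitting probabilities, and the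
  constant is their value at infinity.\<close>

definition step_avg :: "(int \<times> int \<Rightarrow> real) \<Rightarrow> int \<times> int \<Rightarrow> real" where
  "step_avg f x = (\<Sum>e\<in>steps. f (x + e)) / 4"

lemma sum_steps:
  "(\<Sum>e\<in>steps. f e) = f (1,0) + f (-1,0) + f (0,1) + (f (0,-1) :: 'a :: comm_monoid_add)"
  by (simp add: steps_def add.assoc)

lemma step_avg_eq:
  "step_avg f x = (f (x + (1,0)) + f (x + (-1,0)) + f (x + (0,1)) + f (x + (0,-1))) / 4"
  by (simp add: step_avg_def sum_steps)

definition ang :: "nat \<Rightarrow> int \<times> int \<Rightarrow> int \<times> int \<Rightarrow> real" where
  "ang n k x = 2 * pi * (of_int (fst k) * of_int (fst x) + of_int (snd k) * of_int (snd x)) / real n"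

text \<open>Eigenvalue of the one-step operator of the walk on the character of frequency
  \<open>k\<close>.\<close>

definition mu :: "nat \<Rightarrow> int \<times> int \<Rightarrow> real" where
  "mu n k = (cos (2 * pi * of_int (fst k) / real n) + cos (2 * pi * of_int (snd k) / real n)) / 2"

definition freq1 :: "nat \<Rightarrow> int set" where
  "freq1 n = {- ((int n - 1) div 2) ..< - ((int n - 1) div 2) + int n}"

text \<open>Frequencies are represented by residues of smallest absolute value, so that the angles
  \<open>\<pi> k / n\<close> lie in \<open>[-\<pi>/2, \<pi>/2]\<close>.\<close>

definition freq :: "nat \<Rightarrow> (int \<times> int) set" where
  "freq n = freq1 n \<times> freq1 n"

definition nzf :: "nat \<Rightarrow> (int \<times> int) set" where
  "nzf n = freq n - {(0,0)}"

lemma finite_freq1 [simp]: "finite (freq1 n)"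
  and finite_freq [simp]: "finite (freq n)"
  and finite_nzf [simp]: "finite (nzf n)"
  and finite_torus [simp]: "finite (torus n)"
  by (simp_all add: freq1_def freq_def nzf_def torus_def)

lemma zero_in_freq: "n > 0 \<Longrightarrow> (0,0) \<in> freq n"
  by (auto simp: freq_def freq1_def)

lemma freq_bounds:
  assumes "k \<in> freq n"
  shows "2 * \<bar>fst k\<bar> \<le> int n" "2 * \<bar>snd k\<bar> \<le> int n"
  using assms unfolding freq_def freq1_def by auto

lemma ang_commute: "ang n k x = ang n x k"
  by (simp add: ang_def mult.commute)

lemma ang_zero [simp]: "ang n (0,0) x = 0" "ang n k (0,0) = 0"
  by (simp_all add: ang_def)

lemma ang_add: "ang n k (x + y) = ang n k x + ang n k y"
  and ang_diff: "ang n k (x - y) = ang n k x - ang n k y"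
  and ang_minus: "ang n k (- x) = - ang n k x"
  by (simp_all add: ang_def algebra_simps add_divide_distrib diff_divide_distrib)

lemma mu_zero [simp]: "mu n (0,0) = 1"
  by (simp add: mu_def)

lemma mu_le_1: "mu n k \<le> 1" and mu_ge: "mu n k \<ge> -1"
proof -
  define a b where "a = 2 * pi * of_int (fst k) / real n" and "b = 2 * pi * of_int (snd k) / real n"
  have "2 * mu n k = cos a + cos b" by (simp add: mu_def a_def b_def)
  moreover have "cos a \<le> 1" "cos b \<le> 1" "cos a \<ge> -1" "cos b \<ge> -1" by auto
  ultimately have "mu n k \<le> 1 \<and> mu n k \<ge> -1" by linarith
  thus "mu n k \<le> 1" "mu n k \<ge> -1" by auto
qed

lemma abs_mu_le: "\<bar>mu n k\<bar> \<le> 1"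
  using mu_le_1[of n k] mu_ge[of n k] by linarith

lemma one_minus_mu:
  "1 - mu n k = (sin (pi * of_int (fst k) / real n))\<^sup>2 + (sin (pi * of_int (snd k) / real n))\<^sup>2"
proof -
  define a b where "a = pi * of_int (fst k) / real n" and "b = pi * of_int (snd k) / real n"
  have "2 * mu n k = cos (2 * a) + cos (2 * b)" by (simp add: mu_def a_def b_def mult.assoc)
  thus ?thesis
    unfolding a_def [symmetric] b_def [symmetric] cos_double_sin by linarith
qed

lemma step_avg_cos:
  "step_avg (\<lambda>x. cos (ang n k x)) x = mu n k * cos (ang n k x)"
proof -
  define a b where "a = 2 * pi * of_int (fst k) / real n" and "b = 2 * pi * of_int (snd k) / real n"
  have "ang n k (1,0) = a" "ang n k (-1,0) = - a" "ang n k (0,1) = b" "ang n k (0,-1) = - b"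
    by (simp_all add: ang_def a_def b_def)
  moreover have "mu n k = (cos a + cos b) / 2" by (simp add: mu_def a_def b_def)
  ultimately show ?thesis
    unfolding step_avg_eq ang_add
    by (simp only: cos_add sin_add cos_minus sin_minus) (simp add: field_simps)
qed

lemma sum_cis_interval:
  assumes n: "n > 0"
  shows "(\<Sum>j\<in>{s..<s + int n}. cis (2 * pi * of_int j * of_int a / real n))
           = (if int n dvd a then of_nat n else 0)"
proof -
  let ?w = "cis (2 * pi * of_int a / real n)"
  have "(\<Sum>j\<in>{s..<s + int n}. cis (2 * pi * of_int j * of_int a / real n))
      = (\<Sum>i<n. cis (2 * pi * of_int (s + int i) * of_int a / real n))"
    by (rule sum.reindex_bij_witness[of _ "\<lambda>i. s + int i" "\<lambda>j. nat (j - s)"]) auto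
  also have "\<dots> = (\<Sum>i<n. cis (2 * pi * of_int s * of_int a / real n) * ?w ^ i)"
  proof (rule sum.cong [OF refl])
    fix i
    have "2 * pi * of_int (s + int i) * of_int a / real n
        = 2 * pi * of_int s * of_int a / real n + real i * (2 * pi * of_int a / real n)"
      by (simp add: algebra_simps add_divide_distrib)
    thus "cis (2 * pi * of_int (s + int i) * of_int a / real n)
        = cis (2 * pi * of_int s * of_int a / real n) * ?w ^ i"
      by (simp only: Complex.DeMoivre cis_mult)
  qed
  also have "\<dots> = cis (2 * pi * of_int s * of_int a / real n) * (\<Sum>i<n. ?w ^ i)"
    by (simp add: sum_distrib_left)
  finally have eq: "(\<Sum>j\<in>{s..<s + int n}. cis (2 * pi * of_int j * of_int a / real n))
    = cis (2 * pi * of_int s * of_int a / real n) * (\<Sum>i<n. ?w ^ i)" .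
  show ?thesis
  proof (cases "int n dvd a")
    case True
    then obtain b where b: "a = int n * b" by auto
    have "cis (2 * pi * of_int j * of_int a / real n) = 1" for j :: int
    proof -
      have "2 * pi * of_int j * of_int a / real n = 2 * pi * of_int (j * b)"
        using n b by simp
      thus ?thesis by (metis cis_multiple_2pi Ints_of_int)
    qed
    thus ?thesis using True by simp
  next
    case False
    have "?w \<noteq> 1"
    proof
      assume "?w = 1"
      hence "cos (2 * pi * of_int a / real n) = 1" by (metis cis.sel(1) one_complex.sel(1))
      then obtain m :: int where "2 * pi * of_int a / real n = of_int m * 2 * pi"
        using cos_one_2pi_int by auto
      hence "real_of_int a = of_int (m * int n)" using n by (simp add: field_simps)
      hence "a = m * int n" using of_int_eq_iff by blast
      thus False using False by simp
    qed
    moreover have "?w ^ n = 1"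
    proof -
      have "?w ^ n = cis (2 * pi * of_int a)" using n by (simp add: Complex.DeMoivre)
      also have "\<dots> = 1" by (rule cis_multiple_2pi) simp
      finally show ?thesis .
    qed
    ultimately have "(\<Sum>i<n. ?w ^ i) = 0"
      using geometric_sum[of ?w n] by simp
    thus ?thesis using eq False by simp
  qed
qed

lemma sum_cos_square:
  assumes n: "n > 0"
  shows "(\<Sum>k\<in>{s..<s + int n} \<times> {s..<s + int n}. cos (ang n k x))
           = (if proj n x = (0,0) then (real n)\<^sup>2 else 0)"
proof -
  let ?I = "{s..<s + int n}"
  have "(\<Sum>k\<in>?I \<times> ?I. cos (ang n k x))
      = Re (\<Sum>k\<in>?I \<times> ?I. cis (2 * pi * of_int (fst k) * of_int (fst x) / real n)
                          * cis (2 * pi * of_int (snd k) * of_int (snd x) / real n))"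
    by (simp add: cis_mult ang_def add_divide_distrib [symmetric] algebra_simps)
  also have "(\<Sum>k\<in>?I \<times> ?I. cis (2 * pi * of_int (fst k) * of_int (fst x) / real n)
                          * cis (2 * pi * of_int (snd k) * of_int (snd x) / real n))
      = (\<Sum>i\<in>?I. cis (2 * pi * of_int i * of_int (fst x) / real n))
        * (\<Sum>j\<in>?I. cis (2 * pi * of_int j * of_int (snd x) / real n))"
    by (simp add: sum_product sum.cartesian_product case_prod_beta)
  also have "Re \<dots> = (if proj n x = (0,0) then (real n)\<^sup>2 else 0)"
    unfolding sum_cis_interval[OF n] by (auto simp: proj_def power2_eq_square dvd_eq_mod_eq_0)
  finally show ?thesis .
qed

lemma sum_cos_freq:
  "n > 0 \<Longrightarrow> (\<Sum>k\<in>freq n. cos (ang n k x)) = (if proj n x = (0,0) then (real n)\<^sup>2 else 0)"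
  unfolding freq_def freq1_def by (rule sum_cos_square)

lemma sum_cos_torus:
  assumes "n > 0"
  shows "(\<Sum>x\<in>torus n. cos (ang n k x)) = (if proj n k = (0,0) then (real n)\<^sup>2 else 0)"
  using sum_cos_square[OF assms, of k 0] by (simp add: torus_def ang_commute [of n k])

lemma card_freq: "card (freq n) = n\<^sup>2"
  by (simp add: freq_def freq1_def power2_eq_square card_cartesian_product)

lemma card_torus: "card (torus n) = n\<^sup>2"
  by (simp add: torus_def power2_eq_square card_cartesian_product)

lemma sum_freq_split:
  "n > 0 \<Longrightarrow> (\<Sum>k\<in>freq n. f k) = f (0,0) + (\<Sum>k\<in>nzf n. f k :: real)"
  unfolding nzf_def using zero_in_freq[of n] by (simp add: sum.remove)

lemma proj_nzf: "k \<in> nzf n \<Longrightarrow> proj n k \<noteq> (0,0)"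
proof
  assume k: "k \<in> nzf n" and "proj n k = (0,0)"
  hence d: "int n dvd fst k" "int n dvd snd k" by (auto simp: proj_def dvd_eq_mod_eq_0)
  have b: "2 * \<bar>fst k\<bar> \<le> int n" "2 * \<bar>snd k\<bar> \<le> int n" using freq_bounds k by (auto simp: nzf_def)
  have "n > 0" using k by (cases n) (auto simp: nzf_def freq_def freq1_def)
  hence "\<bar>fst k\<bar> < int n" "\<bar>snd k\<bar> < int n" using b by auto
  hence "fst k = 0" "snd k = 0" using d by (metis dvd_imp_le_int linorder_not_less abs_of_nat)+
  thus False using k by (cases k) (auto simp: nzf_def)
qed

section \<open>Torus Green function and potential kernel\<close>

text \<open>The zero frequency, where \<open>1 - mu\<close> vanishes, is left out; what remains
  inverts \<open>I - step_avg\<close> on functions of mean zero.\<close>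

definition green :: "nat \<Rightarrow> int \<times> int \<Rightarrow> real" where
  "green n x = (\<Sum>k\<in>nzf n. cos (ang n k x) / (1 - mu n k)) / (real n)\<^sup>2"

definition green_diff :: "nat \<Rightarrow> int \<times> int \<Rightarrow> real" where
  "green_diff n x = green n (0,0) - green n x"

lemma green_diff_alt:
  "green_diff n x = (\<Sum>k\<in>nzf n. (1 - cos (ang n k x)) / (1 - mu n k)) / (real n)\<^sup>2"
  by (simp add: green_diff_def green_def sum_subtractf diff_divide_distrib)

lemma green_diff_zero [simp]: "green_diff n (0,0) = 0"
  by (simp add: green_diff_def)

lemma green_minus: "green n (- x) = green n x"
  by (simp add: green_def ang_minus)

lemma green_diff_minus: "green_diff n (- x) = green_diff n x"
  by (simp add: green_diff_def green_minus)

section \<open>Bounds on the symbol \<open>1 - mu\<close>\<close>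

lemma half_le_sin:
  assumes "0 \<le> x" "x \<le> pi / 2"
  shows "x / 2 \<le> sin x" "x - x ^ 3 / 6 \<le> sin (x::real)"
proof -
  have "\<bar>sin x - (\<Sum>m<3. sin_coeff m * x ^ m)\<bar> \<le> inverse (fact 3) * \<bar>x\<bar> ^ 3"
    by (rule Maclaurin_sin_bound)
  moreover have "(\<Sum>m<3. sin_coeff m * x ^ m) = x"
    by (simp add: numeral_3_eq_3 sin_coeff_def)
  ultimately have "\<bar>sin x - x\<bar> \<le> x ^ 3 / 6" using assms by (simp add: fact_numeral)
  thus c: "x - x ^ 3 / 6 \<le> sin x" by linarith
  \<comment> \<open>Since \<open>(17/10)^2 = 2.89 < 3\<close>, this makes the Taylor error
    \<open>x^3 / 6\<close> at most \<open>x / 2\<close>.\<close>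
  have "pi / 2 \<le> 17 / 10" using pi_approx by simp
  hence "x * x \<le> 17/10 * (17/10)" using assms by (intro mult_mono) auto
  hence "x * (x * x) \<le> x * 3" using assms by (intro mult_left_mono) auto
  hence "x ^ 3 \<le> 3 * x" by (simp add: power3_eq_cube)
  thus "x / 2 \<le> sin x" using c by linarith
qed

lemma sin_squared_bounds:
  assumes "\<bar>x\<bar> \<le> pi / 2"
  shows "x\<^sup>2 / 4 \<le> (sin x)\<^sup>2" "x\<^sup>2 - (sin (x::real))\<^sup>2 \<le> x ^ 4 / 3"
proof -
  define y where "y = \<bar>x\<bar>"
  have y: "0 \<le> y" "y \<le> pi / 2" using assms by (auto simp: y_def)
  have e: "(sin x)\<^sup>2 = (sin y)\<^sup>2" "x\<^sup>2 = y\<^sup>2" "x ^ 4 = y ^ 4" by (auto simp: y_def abs_if)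
  have "(y / 2)\<^sup>2 \<le> (sin y)\<^sup>2" using half_le_sin(1)[OF y] y by (intro power_mono) auto
  thus "x\<^sup>2 / 4 \<le> (sin x)\<^sup>2" unfolding e by (simp add: power_divide)
  have s: "sin y \<ge> 0" "sin y \<le> y" using half_le_sin(1)[OF y] y sin_x_le_x[of y] by auto
  \<comment> \<open>Difference of two squares: the cubic Taylor bound controls the first factor and
    \<open>sin y <= y\<close> the second.\<close>
  have "(y - sin y) * (y + sin y) \<le> (y ^ 3 / 6) * (2 * y)"
    using half_le_sin(2)[OF y] s y by (intro mult_mono) auto
  thus "x\<^sup>2 - (sin x)\<^sup>2 \<le> x ^ 4 / 3" unfolding e
    by (simp add: power2_eq_square power3_eq_cube power4_eq_xxxx algebra_simps)
qed

lemma freq_angle_le: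
  assumes "k \<in> freq n" "n > 0"
  shows "\<bar>pi * of_int (fst k) / real n\<bar> \<le> pi / 2" "\<bar>pi * of_int (snd k) / real n\<bar> \<le> pi / 2"
proof -
  have "\<bar>pi * of_int j / real n\<bar> \<le> pi / 2" if "2 * \<bar>j\<bar> \<le> int n" for j
  proof -
    have "2 * \<bar>real_of_int j\<bar> \<le> real n" using that by linarith
    hence "pi * (2 * \<bar>real_of_int j\<bar>) \<le> pi * real n" by (intro mult_left_mono) auto
    thus ?thesis using assms(2) by (simp add: abs_mult field_simps)
  qed
  thus "\<bar>pi * of_int (fst k) / real n\<bar> \<le> pi / 2" "\<bar>pi * of_int (snd k) / real n\<bar> \<le> pi / 2"
    using freq_bounds[OF assms(1)] by auto
qed

definition nsq :: "int \<times> int \<Rightarrow> real" where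
  "nsq k = (of_int (fst k))\<^sup>2 + (of_int (snd k))\<^sup>2"

lemma nsq_ge_1: "k \<noteq> (0,0) \<Longrightarrow> nsq k \<ge> 1"
proof -
  assume "k \<noteq> (0,0)"
  hence "fst k \<noteq> 0 \<or> snd k \<noteq> 0" by (cases k) auto
  moreover have "i \<noteq> 0 \<Longrightarrow> (1::real) \<le> (of_int i)\<^sup>2" for i :: int
  proof -
    assume "i \<noteq> 0"
    hence "1 \<le> \<bar>real_of_int i\<bar>" by linarith
    hence "1\<^sup>2 \<le> \<bar>real_of_int i\<bar>\<^sup>2" by (intro power_mono) auto
    thus ?thesis by simp
  qed
  ultimately show ?thesis unfolding nsq_def by (smt (verit) zero_le_power2)
qed

text \<open>The bound \<open>sin^2 x >= x^2 / 4\<close> at the angles \<open>\<pi> k / n\<close>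
  gives the factor \<open>\<pi>^2 / 4 >= 9/4\<close>, rounded down to 2. At
  \<open>nsq k >= 1\<close> this is the spectral gap \<open>2 / n^2\<close>.\<close>

lemma nsq_le_one_minus_mu:
  assumes "k \<in> freq n" "n > 0"
  shows "2 * nsq k / (real n)\<^sup>2 \<le> 1 - mu n k"
proof -
  let ?a = "pi * of_int (fst k) / real n" and ?b = "pi * of_int (snd k) / real n"
  have "?a\<^sup>2 / 4 + ?b\<^sup>2 / 4 \<le> 1 - mu n k"
    unfolding one_minus_mu
    using sin_squared_bounds(1) freq_angle_le[OF assms] by (intro add_mono) auto
  moreover have "?a\<^sup>2 / 4 + ?b\<^sup>2 / 4 = (pi\<^sup>2 / 4) * (nsq k / (real n)\<^sup>2)"
    by (simp add: nsq_def power_divide power_mult_distrib add_divide_distrib distrib_left)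
  moreover have "3 * 3 \<le> pi * pi" using pi_gt3 by (intro mult_mono) auto
  hence "2 * (nsq k / (real n)\<^sup>2) \<le> (pi\<^sup>2 / 4) * (nsq k / (real n)\<^sup>2)"
    by (intro mult_right_mono) (auto simp: power2_eq_square nsq_def)
  ultimately show ?thesis by simp
qed

lemma one_minus_mu_pos: "k \<in> nzf n \<Longrightarrow> 0 < 1 - mu n k"
proof -
  assume k: "k \<in> nzf n"
  hence n: "n > 0" by (cases n) (auto simp: nzf_def freq_def freq1_def)
  have "0 < 2 * nsq k / (real n)\<^sup>2" using k nsq_ge_1[of k] n by (auto simp: nzf_def)
  also have "\<dots> \<le> 1 - mu n k" using nsq_le_one_minus_mu[of k n] k n by (auto simp: nzf_def)
  finally show ?thesis .
qed

lemma abs_sin_mult_le: "\<bar>sin (real m * x)\<bar> \<le> real m * \<bar>sin x\<bar>"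
proof (induction m)
  case (Suc m)
  have "\<bar>sin (real (Suc m) * x)\<bar> = \<bar>sin (real m * x) * cos x + cos (real m * x) * sin x\<bar>"
    by (simp add: sin_add algebra_simps)
  also have "\<dots> \<le> \<bar>sin (real m * x)\<bar> * \<bar>cos x\<bar> + \<bar>cos (real m * x)\<bar> * \<bar>sin x\<bar>"
    by (metis abs_mult abs_triangle_ineq)
  also have "\<dots> \<le> \<bar>sin (real m * x)\<bar> * 1 + 1 * \<bar>sin x\<bar>"
    by (intro add_mono mult_mono) auto
  finally show ?case using Suc by (simp add: algebra_simps)
qed simp

lemma one_minus_cos_mult_le: "1 - cos (of_int a * t :: real) \<le> (of_int a)\<^sup>2 * (2 * (sin (t / 2))\<^sup>2)"
proof -
  have "1 - cos (of_int a * t) = 2 * (sin (of_int a * (t / 2)))\<^sup>2"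
    using cos_double_sin[of "of_int a * (t / 2)"] by simp
  moreover have "\<bar>sin (of_int a * (t / 2))\<bar> = \<bar>sin (real (nat \<bar>a\<bar>) * (t / 2))\<bar>"
    by (cases "a \<ge> 0") auto
  moreover have "\<dots> \<le> real (nat \<bar>a\<bar>) * \<bar>sin (t / 2)\<bar>" by (rule abs_sin_mult_le)
  ultimately have "1 - cos (of_int a * t) \<le> 2 * (real (nat \<bar>a\<bar>) * \<bar>sin (t / 2)\<bar>)\<^sup>2"
    by (metis abs_ge_zero mult_left_mono power2_abs power_mono zero_le_numeral)
  thus ?thesis by (simp add: power_mult_distrib algebra_simps)
qed

lemma one_minus_cos_add_le: "1 - cos (s + t) \<le> 2 * (1 - cos s) + 2 * (1 - cos (t::real))"
proof -
  define a b where "a = s / 2" and "b = t / 2"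
  have eq: "1 - cos (2 * u) = 2 * (sin u)\<^sup>2" for u :: real
    using cos_double_sin[of u] by simp
  have "(sin (a + b))\<^sup>2 \<le> 2 * (sin a * cos b)\<^sup>2 + 2 * (cos a * sin b)\<^sup>2"
    unfolding sin_add by (smt (verit) power2_sum power2_diff zero_le_power2)
  also have "\<dots> \<le> 2 * (sin a)\<^sup>2 + 2 * (sin b)\<^sup>2"
  proof -
    have "(cos u)\<^sup>2 \<le> 1" for u :: real by (simp add: abs_square_le_1)
    hence "(sin a)\<^sup>2 * (cos b)\<^sup>2 \<le> (sin a)\<^sup>2 * 1" "(cos a)\<^sup>2 * (sin b)\<^sup>2 \<le> 1 * (sin b)\<^sup>2"
      by (intro mult_left_mono mult_right_mono; simp)+
    thus ?thesis unfolding power_mult_distrib by linarith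
  qed
  finally have "1 - cos (2 * (a + b)) \<le> 2 * (1 - cos (2 * a)) + 2 * (1 - cos (2 * b))"
    unfolding eq by linarith
  thus ?thesis by (simp add: a_def b_def add_divide_distrib)
qed

text \<open>The numerator vanishes at small frequencies as fast as \<open>1 - mu\<close>. The
  quotient of the two is thus bounded uniformly in \<open>n\<close> and \<open>k\<close>, which
  removes the singularity from the series for \<open>green_diff\<close>.\<close>

lemma one_minus_cos_le: "1 - cos (ang n k x) \<le> 4 * nsq x * (1 - mu n k)"
proof -
  let ?s = "2 * pi * of_int (fst k) / real n" and ?t = "2 * pi * of_int (snd k) / real n"
  let ?a = "real_of_int (fst x)" and ?b = "real_of_int (snd x)"
  let ?u = "(sin (pi * of_int (fst k) / real n))\<^sup>2" and ?v = "(sin (pi * of_int (snd k) / real n))\<^sup>2"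
  have "ang n k x = ?a * ?s + ?b * ?t"
    by (simp add: ang_def field_simps add_divide_distrib)
  hence "1 - cos (ang n k x) \<le> 2 * (1 - cos (?a * ?s)) + 2 * (1 - cos (?b * ?t))"
    by (simp only: one_minus_cos_add_le)
  also have "\<dots> \<le> 2 * (?a\<^sup>2 * (2 * ?u)) + 2 * (?b\<^sup>2 * (2 * ?v))"
    using one_minus_cos_mult_le[of "fst x" ?s] one_minus_cos_mult_le[of "snd x" ?t]
    by (intro add_mono mult_left_mono) (auto simp: mult.assoc)
  also have "\<dots> \<le> 2 * (nsq x * (2 * ?u)) + 2 * (nsq x * (2 * ?v))"
    by (intro add_mono mult_left_mono mult_right_mono) (auto simp: nsq_def)
  also have "\<dots> = 4 * nsq x * (1 - mu n k)"
    unfolding one_minus_mu by (simp add: algebra_simps)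
  finally show ?thesis .
qed

section \<open>Torus representation of planar transition probabilities\<close>

text \<open>Under the size condition the walk cannot wrap around the torus within \<open>m\<close>
  steps, so planar and torus transition probabilities agree. In the base case, the origin is the
  only point of the box that projects to the origin.\<close>

lemma srw_p_fourier:
  assumes "\<bar>fst x\<bar> + int m < int n" "\<bar>snd x\<bar> + int m < int n"
  shows "srw_p m x (0,0) = (\<Sum>k\<in>freq n. mu n k ^ m * cos (ang n k x)) / (real n)\<^sup>2"
  using assms
proof (induction m arbitrary: x)
  case 0
  have n: "n > 0" using 0 by auto
  have "proj n x = (0,0) \<longleftrightarrow> x = (0,0)"
  proof
    assume "proj n x = (0,0)"
    hence "int n dvd fst x" "int n dvd snd x" by (auto simp: proj_def dvd_eq_mod_eq_0)
    hence "fst x = 0" "snd x = 0" using 0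
      by (metis add_0_right dvd_imp_le_int linorder_not_less abs_of_nat of_nat_0)+
    thus "x = (0,0)" by (cases x) auto
  qed (auto simp: proj_def)
  thus ?case using n by (simp add: sum_cos_freq)
next
  case (Suc m)
  have IH: "srw_p m (x + e) (0,0) = (\<Sum>k\<in>freq n. mu n k ^ m * cos (ang n k (x + e))) / (real n)\<^sup>2"
    if "e \<in> steps" for e
    using that Suc.prems by (intro Suc.IH) (auto simp: steps_def)
  have "srw_p (Suc m) x (0,0)
      = (\<Sum>e\<in>steps. (\<Sum>k\<in>freq n. mu n k ^ m * cos (ang n k (x + e))) / (real n)\<^sup>2) / 4"
    using IH by simp
  also have "\<dots> = (\<Sum>k\<in>freq n. mu n k ^ m * step_avg (\<lambda>x. cos (ang n k x)) x) / (real n)\<^sup>2"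
    unfolding step_avg_def
    by (simp add: sum_divide_distrib [symmetric] sum_distrib_left sum.swap[of _ steps])
  also have "\<dots> = (\<Sum>k\<in>freq n. mu n k ^ Suc m * cos (ang n k x)) / (real n)\<^sup>2"
    unfolding step_avg_cos by (simp add: mult.commute mult.left_commute)
  finally show ?case .
qed

definition pot_sum :: "nat \<Rightarrow> int \<times> int \<Rightarrow> real" where
  "pot_sum M x = (\<Sum>m<M. srw_p m (0,0) (0,0) - srw_p m x (0,0))"

text \<open>At each nonzero frequency \<open>pot_sum\<close> is a finite geometric series in
  \<open>mu\<close>, and \<open>green_diff\<close> is the full one; the difference is the geometric
  tail. The zero frequency drops out because \<open>1 - cos\<close> vanishes there.\<close>

lemma green_diff_minus_pot_sum:
  assumes "\<bar>fst x\<bar> + int M < int n" "\<bar>snd x\<bar> + int M < int n"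
  shows "green_diff n x - pot_sum M x
    = (\<Sum>k\<in>nzf n. (1 - cos (ang n k x)) * mu n k ^ M / (1 - mu n k)) / (real n)\<^sup>2"
proof -
  have n: "n > 0" using assms by auto
  have "pot_sum M x = (\<Sum>m<M. (\<Sum>k\<in>freq n. (1 - cos (ang n k x)) * mu n k ^ m) / (real n)\<^sup>2)"
    unfolding pot_sum_def
  proof (rule sum.cong [OF refl])
    fix m assume "m \<in> {..<M}"
    hence "srw_p m (0,0) (0,0) = (\<Sum>k\<in>freq n. mu n k ^ m * cos (ang n k (0,0))) / (real n)\<^sup>2"
      "srw_p m x (0,0) = (\<Sum>k\<in>freq n. mu n k ^ m * cos (ang n k x)) / (real n)\<^sup>2"
      using assms by (intro srw_p_fourier; auto)+
    thus "srw_p m (0,0) (0,0) - srw_p m x (0,0)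
        = (\<Sum>k\<in>freq n. (1 - cos (ang n k x)) * mu n k ^ m) / (real n)\<^sup>2"
      by (simp add: diff_divide_distrib [symmetric] sum_subtractf [symmetric] algebra_simps)
  qed
  also have "\<dots> = (\<Sum>k\<in>freq n. (1 - cos (ang n k x)) * (\<Sum>m<M. mu n k ^ m)) / (real n)\<^sup>2"
    unfolding sum_divide_distrib [symmetric] by (subst sum.swap) (simp add: sum_distrib_left)
  also have "\<dots> = (\<Sum>k\<in>nzf n. (1 - cos (ang n k x)) * (\<Sum>m<M. mu n k ^ m)) / (real n)\<^sup>2"
    by (simp add: sum_freq_split[OF n])
  also have "\<dots> = (\<Sum>k\<in>nzf n. (1 - cos (ang n k x)) * ((1 - mu n k ^ M) / (1 - mu n k))) / (real n)\<^sup>2"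
    using one_minus_mu_pos
    by (intro arg_cong2[where f = "(/)"] sum.cong refl) (force simp: sum_gp_strict)
  finally show ?thesis unfolding green_diff_alt
    by (simp add: diff_divide_distrib [symmetric] sum_subtractf [symmetric] algebra_simps)
qed

section \<open>Return probabilities\<close>

fun walk1 :: "nat \<Rightarrow> int \<Rightarrow> real" where
  "walk1 0 u = (if u = 0 then 1 else 0)"
| "walk1 (Suc k) u = (walk1 k (u + 1) + walk1 k (u - 1)) / 2"

text \<open>The coordinates \<open>x + y\<close> and \<open>x - y\<close> of planar simple random walk are independent
  one-dimensional simple random walks.\<close>

lemma srw_p_walk1: "srw_p k x (0,0) = walk1 k (fst x + snd x) * walk1 k (fst x - snd x)"
proof (induction k arbitrary: x)
  case 0
  have "x = (0,0) \<longleftrightarrow> fst x + snd x = 0 \<and> fst x - snd x = 0"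
    by (cases x) auto
  thus ?case by auto
next
  case (Suc k)
  show ?case
    by (simp add: Suc.IH sum_steps) (simp add: algebra_simps)
qed

lemma walk1_nonneg: "walk1 k u \<ge> 0"
  by (induction k arbitrary: u) (auto simp: add_nonneg_nonneg)

lemma walk1_zero: "\<bar>u\<bar> > int k \<Longrightarrow> walk1 k u = 0"
  by (induction k arbitrary: u) auto

lemma walk1_binomial: "walk1 k (2 * int i - int k) = real (k choose i) / 2 ^ k"
proof (induction k arbitrary: i)
  case 0
  thus ?case by (cases i) auto
next
  case (Suc k)
  have e: "2 * int i - int (Suc k) + 1 = 2 * int i - int k" by simp
  show ?case
  proof (cases i)
    case 0
    have "walk1 k (2 * int i - int (Suc k) - 1) = 0" using 0 by (intro walk1_zero) auto
    thus ?thesis using Suc.IH[of i] 0 unfolding walk1.simps e by simp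
  next
    case (Suc j)
    have "2 * int i - int (Suc k) - 1 = 2 * int j - int k" using Suc by simp
    thus ?thesis using Suc.IH[of i] Suc.IH[of j] Suc unfolding walk1.simps e
      by (simp add: add_divide_distrib)
  qed
qed

lemma walk1_even_0: "walk1 (2 * j) 0 = real ((2 * j) choose j) / 4 ^ j"
  using walk1_binomial[of "2 * j" j] by (simp add: power_mult)

lemma srw_p_nonneg: "srw_p k x (0,0) \<ge> 0"
  by (simp add: srw_p_walk1 walk1_nonneg)

lemma srw_p_zero:
  assumes "\<bar>fst x\<bar> > int k \<or> \<bar>snd x\<bar> > int k"
  shows "srw_p k x (0,0) = 0"
proof -
  have "\<bar>fst x + snd x\<bar> > int k \<or> \<bar>fst x - snd x\<bar> > int k" using assms by arith
  thus ?thesis using walk1_zero by (auto simp: srw_p_walk1)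
qed

definition ret :: "nat \<Rightarrow> real" where
  "ret j = srw_p (2 * j) (0,0) (0,0)"

lemma ret_eq: "ret j = (real ((2 * j) choose j) / 4 ^ j)\<^sup>2"
  unfolding ret_def srw_p_walk1 by (simp add: walk1_even_0 power2_eq_square del: walk1.simps)

text \<open>Squared ratio of consecutive central binomial coefficients, normalised by
  \<open>4^j\<close>.\<close>

lemma ret_Suc: "ret (Suc j) = ret j * ((2 * real j + 1) / (2 * real j + 2))\<^sup>2"
proof -
  have "Suc j * ((2 * Suc j) choose Suc j) = 2 * (2 * j + 1) * ((2 * j) choose j)"
  proof -
    have a: "Suc j * ((2 * j + 1) choose Suc j) = (2 * j + 1) * ((2 * j) choose j)"
      using Suc_times_binomial_eq[of "2 * j" j] by simp
    have "(2 * Suc j) choose Suc j = ((2 * j + 1) choose j) + ((2 * j + 1) choose Suc j)"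
      by simp
    also have "(2 * j + 1) choose j = (2 * j + 1) choose Suc j"
      using binomial_symmetric[of j "2 * j + 1"] by simp
    finally show ?thesis using a by (simp add: algebra_simps)
  qed
  hence "real (Suc j * ((2 * Suc j) choose Suc j)) = real (2 * (2 * j + 1) * ((2 * j) choose j))"
    by (simp only:)
  hence "(real j + 1) * real ((2 * Suc j) choose Suc j) = 2 * (2 * real j + 1) * real ((2 * j) choose j)"
    unfolding of_nat_mult by (simp add: add.commute del: binomial_Suc_Suc mult_Suc_right)
  hence "real ((2 * Suc j) choose Suc j) = 4 * real ((2 * j) choose j) * ((2 * real j + 1) / (2 * real j + 2))"
    by (simp add: field_simps)
  thus ?thesis unfolding ret_eq power_mult_distrib [symmetric] by simp
qed

text \<open>The induction closes because \<open>(2j+1)(2j+3) <= (2j+2)^2\<close>. The decay to zero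
  is what controls all truncation errors.\<close>

lemma ret_upper: "ret j \<le> 1 / (2 * real j + 1)"
proof (induction j)
  case 0
  show ?case by (simp add: ret_def)
next
  case (Suc j)
  have "ret (Suc j) \<le> 1 / (2 * real j + 1) * ((2 * real j + 1) / (2 * real j + 2))\<^sup>2"
    unfolding ret_Suc using Suc by (intro mult_right_mono) auto
  also have "\<dots> = (2 * real j + 1) / (2 * real j + 2)\<^sup>2"
    by (simp add: power2_eq_square)
  also have "\<dots> \<le> 1 / (2 * real j + 3)"
    by (simp add: divide_simps power2_eq_square) (simp add: algebra_simps)
  finally show ?case by (simp add: algebra_simps)
qed

text \<open>Equality holds at the first index, and the step amounts to
  \<open>(2j+3)^2 >= 4(j+1)(j+2)\<close>. The bound makes the sum of return probabilities diverge
  like the harmonic series.\<close>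

lemma ret_lower: "1 / (4 * real (Suc j)) \<le> ret (Suc j)"
proof (induction j)
  case 0
  show ?case by (simp add: ret_Suc) (simp add: ret_def power2_eq_square)
next
  case (Suc j)
  have "1 / (4 * real (Suc (Suc j))) \<le> 1 / (4 * (real j + 1)) * ((2 * real j + 3) / (2 * real j + 4))\<^sup>2"
    by (simp add: divide_simps power2_eq_square) (simp add: algebra_simps)
  also have "\<dots> \<le> ret (Suc j) * ((2 * real j + 3) / (2 * real j + 4))\<^sup>2"
    using Suc by (intro mult_right_mono) (auto simp: add.commute)
  also have "\<dots> = ret (Suc (Suc j))"
    using ret_Suc[of "Suc j"] by (simp add: algebra_simps)
  finally show ?case .
qed

lemma ret_tendsto: "ret \<longlonglongrightarrow> 0"
proof (rule tendsto_sandwich [of "\<lambda>_. 0" ret _ "\<lambda>j. 1 / (2 * real j + 1)"])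
  show "(\<lambda>j. 1 / (2 * real j + 1)) \<longlonglongrightarrow> 0" by real_asymp
  show "\<forall>\<^sub>F j in sequentially. ret j \<le> 1 / (2 * real j + 1)" using ret_upper by simp
  show "\<forall>\<^sub>F j in sequentially. 0 \<le> ret j" by (simp add: ret_def srw_p_nonneg)
qed (rule tendsto_const)

lemma ret_div2_tendsto: "(\<lambda>M. ret (M div 2)) \<longlonglongrightarrow> 0"
proof (rule filterlim_compose [OF ret_tendsto])
  show "filterlim (\<lambda>M::nat. M div 2) at_top sequentially"
    unfolding filterlim_at_top eventually_sequentially
  proof
    fix Z :: nat
    show "\<exists>N. \<forall>n\<ge>N. Z \<le> n div 2" by (rule exI[of _ "2 * Z"]) auto
  qed
qed

lemma abs_mu_power_le: "\<bar>mu n k\<bar> ^ M \<le> mu n k ^ (2 * (M div 2))"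
proof -
  have "\<bar>mu n k\<bar> ^ M \<le> \<bar>mu n k\<bar> ^ (2 * (M div 2))"
    using abs_mu_le[of n k] by (intro power_decreasing) auto
  thus ?thesis by (simp add: power_even_abs)
qed

text \<open>Rounding \<open>M\<close> down to an even number removes the signs of \<open>mu\<close>
  and only enlarges the summands; the mean over all frequencies is then a return probability, since
  \<open>M < n\<close> rules out wrapping.\<close>

lemma sum_mu_power_le:
  assumes "M < n"
  shows "(\<Sum>k\<in>freq n. \<bar>mu n k\<bar> ^ M) / (real n)\<^sup>2 \<le> ret (M div 2)"
proof -
  have "ret (M div 2) = (\<Sum>k\<in>freq n. mu n k ^ (2 * (M div 2)) * cos (ang n k (0,0))) / (real n)\<^sup>2"
    unfolding ret_def using assms by (intro srw_p_fourier) auto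
  also have "\<dots> \<ge> (\<Sum>k\<in>freq n. \<bar>mu n k\<bar> ^ M) / (real n)\<^sup>2"
    by (intro divide_right_mono sum_mono) (auto simp: abs_mu_power_le)
  finally show ?thesis .
qed

text \<open>The left side does not involve a torus, so one wide enough for the Fourier formula may
  be chosen. Bounding the cosines by 1 leaves the mean of the powers of \<open>mu\<close> in
  absolute value.\<close>

lemma srw_p_le_ret: "srw_p M x (0,0) \<le> ret (M div 2)"
proof -
  define n where "n = nat \<bar>fst x\<bar> + nat \<bar>snd x\<bar> + M + 1"
  have "srw_p M x (0,0) = (\<Sum>k\<in>freq n. mu n k ^ M * cos (ang n k x)) / (real n)\<^sup>2"
    by (intro srw_p_fourier) (auto simp: n_def)
  also have "\<dots> \<le> (\<Sum>k\<in>freq n. \<bar>mu n k\<bar> ^ M) / (real n)\<^sup>2"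
  proof (intro divide_right_mono sum_mono)
    fix k
    have "mu n k ^ M * cos (ang n k x) \<le> \<bar>mu n k ^ M\<bar> * \<bar>cos (ang n k x)\<bar>"
      by (metis abs_ge_self abs_mult)
    also have "\<dots> \<le> \<bar>mu n k ^ M\<bar> * 1" by (intro mult_left_mono) auto
    finally show "mu n k ^ M * cos (ang n k x) \<le> \<bar>mu n k\<bar> ^ M" by (simp add: power_abs)
  qed simp
  also have "\<dots> \<le> ret (M div 2)" by (rule sum_mu_power_le) (simp add: n_def)
  finally show ?thesis .
qed

section \<open>Convergence to the potential kernel and its growth\<close>

text \<open>The error does not depend on \<open>n\<close>. This uniformity yields both the
  convergence of the series defining \<open>pot\<close> and the convergence of
  \<open>green_diff\<close> to it.\<close>

lemma green_diff_pot_sum_bound: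
  assumes "\<bar>fst x\<bar> + int M < int n" "\<bar>snd x\<bar> + int M < int n"
  shows "\<bar>green_diff n x - pot_sum M x\<bar> \<le> 4 * nsq x * ret (M div 2)"
proof -
  have "\<bar>green_diff n x - pot_sum M x\<bar>
      \<le> (\<Sum>k\<in>nzf n. \<bar>(1 - cos (ang n k x)) * mu n k ^ M / (1 - mu n k)\<bar>) / (real n)\<^sup>2"
    unfolding green_diff_minus_pot_sum[OF assms] abs_divide[of _ "(real n)\<^sup>2"]
    by (simp only: abs_power2 abs_of_nat power_abs) (intro divide_right_mono sum_abs, simp)
  also have "\<dots> \<le> (\<Sum>k\<in>nzf n. 4 * nsq x * \<bar>mu n k\<bar> ^ M) / (real n)\<^sup>2"
  proof (intro divide_right_mono sum_mono)
    fix k assume "k \<in> nzf n"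
    hence p: "1 - mu n k > 0" by (rule one_minus_mu_pos)
    have "(1 - cos (ang n k x)) / (1 - mu n k) \<le> 4 * nsq x"
      using one_minus_cos_le[of n k x] p by (simp add: field_simps)
    hence "(1 - cos (ang n k x)) / (1 - mu n k) * \<bar>mu n k\<bar> ^ M \<le> 4 * nsq x * \<bar>mu n k\<bar> ^ M"
      by (intro mult_right_mono) auto
    thus "\<bar>(1 - cos (ang n k x)) * mu n k ^ M / (1 - mu n k)\<bar> \<le> 4 * nsq x * \<bar>mu n k\<bar> ^ M"
      using p by (simp add: abs_mult power_abs)
  qed simp
  also have "\<dots> \<le> (\<Sum>k\<in>freq n. 4 * nsq x * \<bar>mu n k\<bar> ^ M) / (real n)\<^sup>2"
    by (intro divide_right_mono sum_mono2) (auto simp: nzf_def nsq_def)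
  also have "\<dots> = 4 * nsq x * ((\<Sum>k\<in>freq n. \<bar>mu n k\<bar> ^ M) / (real n)\<^sup>2)"
    by (simp add: sum_distrib_left)
  also have "\<dots> \<le> 4 * nsq x * ret (M div 2)"
    using assms by (intro mult_left_mono sum_mu_power_le) (auto simp: nsq_def)
  finally show ?thesis .
qed

lemma eventually_large_torus: "\<forall>\<^sub>F n in sequentially. \<bar>fst x\<bar> + int M < int n \<and> \<bar>snd x\<bar> + int M < int n"
  by (rule eventually_sequentiallyI[of "nat \<bar>fst x\<bar> + nat \<bar>snd x\<bar> + M + 1"]) auto

text \<open>Two partial sums are both close to the same \<open>green_diff n x\<close> once
  \<open>n\<close> is large, so they form a Cauchy sequence.\<close>

lemma pot_sum_tendsto: "(\<lambda>M. pot_sum M x) \<longlonglongrightarrow> pot x"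
proof -
  have "Cauchy (\<lambda>M. pot_sum M x)"
  proof (rule CauchyI)
    fix e :: real assume "e > 0"
    have "(\<lambda>M. 4 * nsq x * ret (M div 2)) \<longlonglongrightarrow> 4 * nsq x * 0"
      by (intro tendsto_intros ret_div2_tendsto)
    hence "\<forall>\<^sub>F M in sequentially. 4 * nsq x * ret (M div 2) < e / 2"
      using \<open>e > 0\<close> by (intro order_tendstoD) auto
    then obtain M0 where M0: "\<And>M. M \<ge> M0 \<Longrightarrow> 4 * nsq x * ret (M div 2) < e / 2"
      by (auto simp: eventually_sequentially)
    have "norm (pot_sum M x - pot_sum M' x) < e" if "M \<ge> M0" "M' \<ge> M0" for M M'
    proof -
      define n where "n = nat \<bar>fst x\<bar> + nat \<bar>snd x\<bar> + M + M' + 1"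
      have "\<bar>green_diff n x - pot_sum M x\<bar> \<le> 4 * nsq x * ret (M div 2)"
        "\<bar>green_diff n x - pot_sum M' x\<bar> \<le> 4 * nsq x * ret (M' div 2)"
        by (intro green_diff_pot_sum_bound; simp add: n_def)+
      thus ?thesis using M0[OF that(1)] M0[OF that(2)] unfolding real_norm_def by linarith
    qed
    thus "\<exists>M0. \<forall>m\<ge>M0. \<forall>n\<ge>M0. norm (pot_sum m x - pot_sum n x) < e" by blast
  qed
  hence "convergent (\<lambda>M. pot_sum M x)" by (rule Cauchy_convergent)
  hence "summable (\<lambda>m. srw_p m (0,0) (0,0) - srw_p m x (0,0))"
    unfolding pot_sum_def summable_iff_convergent .
  thus ?thesis unfolding pot_sum_def pot_def by (rule summable_LIMSEQ)
qed

lemma green_diff_tendsto: "(\<lambda>n. green_diff n x) \<longlonglongrightarrow> pot x"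
proof (rule LIMSEQ_I)
  fix e :: real assume "e > 0"
  have "(\<lambda>M. 4 * nsq x * ret (M div 2)) \<longlonglongrightarrow> 4 * nsq x * 0"
    by (intro tendsto_intros ret_div2_tendsto)
  hence "\<forall>\<^sub>F M in sequentially. 4 * nsq x * ret (M div 2) < e / 2"
    using \<open>e > 0\<close> by (intro order_tendstoD) auto
  moreover have "\<forall>\<^sub>F M in sequentially. dist (pot_sum M x) (pot x) < e / 2"
    using \<open>e > 0\<close> by (intro tendstoD[OF pot_sum_tendsto]) auto
  ultimately have "\<forall>\<^sub>F M in sequentially. 4 * nsq x * ret (M div 2) < e / 2
      \<and> dist (pot_sum M x) (pot x) < e / 2"
    by (rule eventually_conj)
  then obtain M where M: "4 * nsq x * ret (M div 2) < e / 2" "\<bar>pot_sum M x - pot x\<bar> < e / 2"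
    unfolding eventually_sequentially dist_real_def by blast
  have "\<forall>\<^sub>F n in sequentially. norm (green_diff n x - pot x) < e"
    using eventually_large_torus[of x M]
  proof eventually_elim
    case (elim n)
    have "\<bar>green_diff n x - pot_sum M x\<bar> \<le> 4 * nsq x * ret (M div 2)"
      using elim by (intro green_diff_pot_sum_bound) auto
    thus ?case using M unfolding real_norm_def by linarith
  qed
  thus "\<exists>no. \<forall>n\<ge>no. norm (green_diff n x - pot x) < e"
    by (simp add: eventually_sequentially)
qed

lemma pot_zero [simp]: "pot (0,0) = 0"
  by (simp add: pot_def)

lemma pot_minus: "pot (- x) = pot x"
  using green_diff_tendsto[of "- x"] green_diff_tendsto[of x]
  unfolding green_diff_minus by (rule LIMSEQ_unique)

text \<open>At an even truncation the geometric tail carries an even power of \<open>mu\<close> and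
  is nonnegative.\<close>

lemma pot_sum_le_pot: "pot_sum (2 * j) x \<le> pot x"
proof (rule LIMSEQ_le_const [OF green_diff_tendsto])
  have "\<forall>\<^sub>F n in sequentially. pot_sum (2 * j) x \<le> green_diff n x"
    using eventually_large_torus[of x "2 * j"]
  proof eventually_elim
    case (elim n)
    have "green_diff n x - pot_sum (2 * j) x \<ge> 0"
    proof (subst green_diff_minus_pot_sum)
      show "0 \<le> (\<Sum>k\<in>nzf n. (1 - cos (ang n k x)) * mu n k ^ (2 * j) / (1 - mu n k)) / (real n)\<^sup>2"
      proof (intro divide_nonneg_nonneg sum_nonneg mult_nonneg_nonneg)
        fix k assume "k \<in> nzf n"
        thus "0 \<le> 1 - mu n k" using one_minus_mu_pos by (simp add: less_imp_le)
      qed auto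
    qed (use elim in auto)
    thus ?case by simp
  qed
  thus "\<exists>N. \<forall>n\<ge>N. pot_sum (2 * j) x \<le> green_diff n x"
    by (simp add: eventually_sequentially)
qed

lemma pot_nonneg: "pot x \<ge> 0"
  using pot_sum_le_pot[of 0 x] by (simp add: pot_sum_def)

lemma finite_box: "finite {x :: int \<times> int. \<bar>fst x\<bar> \<le> r \<and> \<bar>snd x\<bar> \<le> r}"
  by (rule finite_subset[of _ "{-r..r} \<times> {-r..r}"]) auto

text \<open>The walk cannot travel from a far point to the origin in the first \<open>2j + 1\<close>
  steps, so the partial sum there consists of return probabilities alone. Those at the times 2, 4,
  ..., 2j already add up to a quarter of the harmonic number.\<close>

lemma pot_at_top: "filterlim pot at_top cofinite"
  unfolding filterlim_at_top
proof
  fix R :: real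
  have "\<forall>\<^sub>F j in sequentially. 4 * R \<le> (harm j :: real)"
    using harm_at_top unfolding filterlim_at_top by blast
  then obtain j where j: "harm j / 4 \<ge> R"
    unfolding eventually_sequentially by (metis le_refl le_divide_eq_numeral1(1) mult.commute)
  have "pot x \<ge> R" if "\<bar>fst x\<bar> > int (2 * j + 2) \<or> \<bar>snd x\<bar> > int (2 * j + 2)" for x
  proof -
    have "pot_sum (2 * (j + 1)) x = (\<Sum>m<2 * (j + 1). srw_p m (0,0) (0,0))"
      unfolding pot_sum_def using that by (intro sum.cong) (auto intro!: srw_p_zero)
    also have "\<dots> \<ge> (\<Sum>m\<in>(\<lambda>i. 2 * Suc i) ` {..<j}. srw_p m (0,0) (0,0))"
      by (intro sum_mono2) (auto simp: srw_p_nonneg)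
    also have "(\<Sum>m\<in>(\<lambda>i. 2 * Suc i) ` {..<j}. srw_p m (0,0) (0,0)) = (\<Sum>i<j. ret (Suc i))"
      by (subst sum.reindex) (auto simp: inj_on_def ret_def)
    also have "(\<Sum>i<j. ret (Suc i)) \<ge> (\<Sum>i<j. 1 / (4 * real (Suc i)))"
      by (intro sum_mono ret_lower)
    also have "(\<Sum>i<j. 1 / (4 * real (Suc i))) = harm j / 4"
      by (simp add: harm_altdef sum_divide_distrib field_simps)
    finally show ?thesis using j pot_sum_le_pot[of "j + 1" x] by simp
  qed
  hence "{x. \<not> R \<le> pot x} \<subseteq> {x. \<bar>fst x\<bar> \<le> int (2 * j + 2) \<and> \<bar>snd x\<bar> \<le> int (2 * j + 2)}"
    by force
  thus "\<forall>\<^sub>F x in cofinite. R \<le> pot x"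
    unfolding eventually_cofinite using finite_box finite_subset by blast
qed

section \<open>Lattice sums with exponent 3/4 and increments of the potential kernel\<close>

lemma freq1_subset: "freq1 n \<subseteq> {- int n..int n}"
  and freq1_supset: "n > 0 \<Longrightarrow> {- int ((n - 1) div 2)..int ((n - 1) div 2)} \<subseteq> freq1 n"
  by (auto simp: freq1_def)

lemma sum_symmetric_interval:
  fixes f :: "int \<Rightarrow> real"
  assumes "\<And>i. f (- i) = f i"
  shows "(\<Sum>i\<in>{- int R..int R}. f i) = f 0 + 2 * (\<Sum>j=1..R. f (int j))"
proof (induction R)
  case (Suc R)
  have "{- int (Suc R)..int (Suc R)} = insert (- int (Suc R)) (insert (int (Suc R)) {- int R..int R})"
    by auto
  hence "(\<Sum>i\<in>{- int (Suc R)..int (Suc R)}. f i)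
      = f (- int (Suc R)) + (f (int (Suc R)) + (\<Sum>i\<in>{- int R..int R}. f i))"
    by (simp del: of_nat_Suc)
  thus ?case using Suc assms[of "int (Suc R)"] by (simp del: of_nat_Suc)
qed simp

lemma sum_freq1_le:
  fixes f :: "int \<Rightarrow> real"
  assumes "\<And>i. f (- i) = f i" "\<And>i. f i \<ge> 0"
  shows "(\<Sum>i\<in>freq1 n. f i) \<le> f 0 + 2 * (\<Sum>j=1..n. f (int j))"
proof -
  have "(\<Sum>i\<in>freq1 n. f i) \<le> (\<Sum>i\<in>{- int n..int n}. f i)"
    using freq1_subset assms by (intro sum_mono2) auto
  thus ?thesis using sum_symmetric_interval[of f n] assms by simp
qed

text \<open>The fourth root, so that fractional exponents are handled by integer powers.\<close>

definition quart :: "real \<Rightarrow> real" where "quart x = sqrt (sqrt x)"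

lemma quart_pow4: "x \<ge> 0 \<Longrightarrow> quart x ^ 4 = x"
proof -
  assume "x \<ge> 0"
  have "quart x ^ 4 = ((sqrt (sqrt x))\<^sup>2)\<^sup>2" by (simp add: quart_def flip: power_mult)
  thus ?thesis using \<open>x \<ge> 0\<close> by simp
qed

lemma quart_sq: "x \<ge> 0 \<Longrightarrow> (quart x)\<^sup>2 = sqrt x"
  by (simp add: quart_def)

lemma quart_pos: "x > 0 \<Longrightarrow> quart x > 0"
  and quart_nonneg: "x \<ge> 0 \<Longrightarrow> quart x \<ge> 0"
  and quart_mono: "x \<le> y \<Longrightarrow> quart x \<le> quart y"
  and quart_mult: "quart (x * y) = quart x * quart y"
  and quart_divide: "quart (x / y) = quart x / quart y"
  by (simp_all add: quart_def real_sqrt_mult real_sqrt_divide)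

text \<open>Telescoping: if \<open>a\<close> and \<open>b\<close> are consecutive fourth roots, then
  \<open>1 = b^4 - a^4 <= 4 b^3 (b - a)\<close>.\<close>

lemma sum_quart_le: "(\<Sum>j=1..n. 1 / quart (real j) ^ 3) \<le> 4 * quart (real n)"
proof (induction n)
  case (Suc n)
  define a b where "a = quart (real n)" and "b = quart (real (Suc n))"
  have ab: "0 \<le> a" "a \<le> b" "b > 0"
    unfolding a_def b_def by (auto intro: quart_nonneg quart_mono quart_pos)
  have "b ^ 4 - a ^ 4 = 1" unfolding a_def b_def by (simp add: quart_pow4)
  moreover have "b ^ 4 - a ^ 4 = (b - a) * (b ^ 3 + b\<^sup>2 * a + b * a\<^sup>2 + a ^ 3)"
    by (simp add: algebra_simps power2_eq_square power3_eq_cube power4_eq_xxxx)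
  moreover have "b\<^sup>2 * a \<le> b\<^sup>2 * b" "b * a\<^sup>2 \<le> b * b\<^sup>2" "a ^ 3 \<le> b ^ 3"
    using ab by (auto intro!: mult_left_mono power_mono)
  hence "b ^ 3 + b\<^sup>2 * a + b * a\<^sup>2 + a ^ 3 \<le> 4 * b ^ 3"
    by (simp add: power2_eq_square power3_eq_cube)
  hence "(b - a) * (b ^ 3 + b\<^sup>2 * a + b * a\<^sup>2 + a ^ 3) \<le> (b - a) * (4 * b ^ 3)"
    using ab by (intro mult_left_mono) auto
  ultimately have "1 \<le> (4 * b - 4 * a) * b ^ 3" by (simp add: algebra_simps)
  hence "1 / b ^ 3 \<le> 4 * b - 4 * a" using ab by (simp add: divide_le_eq)
  thus ?case using Suc unfolding a_def b_def by simp
qed (simp add: quart_def)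

text \<open>The maximum keeps the factor positive on the coordinate axes.\<close>

definition pos1 :: "int \<Rightarrow> real" where "pos1 i = max 1 \<bar>of_int i\<bar>"

text \<open>A product lower bound, by the inequality of the means off the axes, which lets lattice
  sums over two coordinates factor into one-dimensional sums.\<close>

lemma nsq_ge_pos1: "k \<noteq> (0,0) \<Longrightarrow> pos1 (fst k) * pos1 (snd k) \<le> nsq k"
proof -
  have *: "t \<noteq> 0 \<Longrightarrow> 1 \<le> \<bar>real_of_int t\<bar>" for t :: int by linarith
  have **: "t \<noteq> 0 \<Longrightarrow> \<bar>real_of_int t\<bar> \<le> (real_of_int t)\<^sup>2" for t :: int
    using mult_mono[OF *[of t] order_refl[of "\<bar>real_of_int t\<bar>"]] by (simp add: power2_eq_square)
  assume "k \<noteq> (0,0)"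
  then consider "fst k = 0" "snd k \<noteq> 0" | "fst k \<noteq> 0" "snd k = 0" | "fst k \<noteq> 0" "snd k \<noteq> 0"
    by (cases k) auto
  thus ?thesis
  proof cases
    case 3
    have "2 * (\<bar>real_of_int (fst k)\<bar> * \<bar>real_of_int (snd k)\<bar>) \<le> nsq k"
      unfolding nsq_def using sum_squares_bound[of "\<bar>real_of_int (fst k)\<bar>" "\<bar>real_of_int (snd k)\<bar>"]
      by (simp add: mult.assoc)
    moreover have "0 \<le> \<bar>real_of_int (fst k)\<bar> * \<bar>real_of_int (snd k)\<bar>" by simp
    ultimately have "\<bar>real_of_int (fst k)\<bar> * \<bar>real_of_int (snd k)\<bar> \<le> nsq k" by linarith
    moreover have "pos1 (fst k) = \<bar>real_of_int (fst k)\<bar>" "pos1 (snd k) = \<bar>real_of_int (snd k)\<bar>"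
      using *[of "fst k"] *[of "snd k"] 3 by (auto simp: pos1_def)
    ultimately show ?thesis by (simp only:)
  qed (use * ** in \<open>auto simp: pos1_def nsq_def max_def\<close>)
qed

text \<open>After factoring, each coordinate contributes at most \<open>9 n^(1/4)\<close> and the
  scaling contributes \<open>n^(3/2)\<close>, hence \<open>81 n^2\<close> in total.\<close>

lemma sum_three_quarter_le:
  assumes n: "n > 0"
  shows "(\<Sum>k\<in>nzf n. 1 / quart (1 - mu n k) ^ 3) / (real n)\<^sup>2 \<le> 81"
proof -
  let ?q = "\<lambda>i. 1 / quart (pos1 i) ^ 3"
  have p1: "pos1 i \<ge> 1" for i by (simp add: pos1_def)
  have qn: "quart (real n) \<ge> 1" using n by (simp add: quart_def)
  have "(\<Sum>i\<in>freq1 n. ?q i) \<le> ?q 0 + 2 * (\<Sum>j=1..n. ?q (int j))"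
    by (rule sum_freq1_le) (auto simp: pos1_def quart_def)
  also have "(\<Sum>j=1..n. ?q (int j)) = (\<Sum>j=1..n. 1 / quart (real j) ^ 3)"
    by (intro sum.cong) (auto simp: pos1_def)
  also have "?q 0 + 2 * (\<Sum>j=1..n. 1 / quart (real j) ^ 3) \<le> 1 + 2 * (4 * quart (real n))"
    using sum_quart_le[of n] by (simp add: pos1_def quart_def)
  also have "\<dots> \<le> 9 * quart (real n)" using qn by simp
  finally have S: "(\<Sum>i\<in>freq1 n. ?q i) \<le> 9 * quart (real n)" .
  have "(\<Sum>k\<in>nzf n. 1 / quart (1 - mu n k) ^ 3)
      \<le> (\<Sum>k\<in>nzf n. quart (real n) ^ 6 * (?q (fst k) * ?q (snd k)))"
  proof (rule sum_mono)
    fix k assume k: "k \<in> nzf n"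
    have "pos1 (fst k) * pos1 (snd k) / (real n)\<^sup>2 \<le> nsq k / (real n)\<^sup>2"
      using k by (intro divide_right_mono nsq_ge_pos1) (auto simp: nzf_def)
    also have "\<dots> \<le> 2 * nsq k / (real n)\<^sup>2" by (intro divide_right_mono) (auto simp: nsq_def)
    also have "\<dots> \<le> 1 - mu n k" using k n by (intro nsq_le_one_minus_mu) (auto simp: nzf_def)
    finally have "quart (pos1 (fst k) * pos1 (snd k) / (real n)\<^sup>2) \<le> quart (1 - mu n k)"
      by (rule quart_mono)
    hence "quart (pos1 (fst k)) * quart (pos1 (snd k)) / (quart (real n))\<^sup>2 \<le> quart (1 - mu n k)"
      by (simp add: quart_mult quart_divide power2_eq_square)
    moreover have pp: "0 < quart (pos1 (fst k)) * quart (pos1 (snd k)) / (quart (real n))\<^sup>2"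
      using p1[of "fst k"] p1[of "snd k"] qn quart_pos by (intro divide_pos_pos mult_pos_pos) auto
    ultimately have "1 / quart (1 - mu n k) ^ 3
        \<le> 1 / (quart (pos1 (fst k)) * quart (pos1 (snd k)) / (quart (real n))\<^sup>2) ^ 3"
      by (intro divide_left_mono power_mono zero_less_power mult_pos_pos) auto
    thus "1 / quart (1 - mu n k) ^ 3 \<le> quart (real n) ^ 6 * (?q (fst k) * ?q (snd k))"
      by (simp add: power_divide power_mult_distrib flip: power_mult)
  qed
  also have "\<dots> \<le> (\<Sum>k\<in>freq n. quart (real n) ^ 6 * (?q (fst k) * ?q (snd k)))"
    by (intro sum_mono2) (auto simp: nzf_def quart_def pos1_def)
  also have "\<dots> = quart (real n) ^ 6 * ((\<Sum>i\<in>freq1 n. ?q i) * (\<Sum>i\<in>freq1 n. ?q i))"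
    unfolding freq_def sum_product sum.cartesian_product
    by (simp only: sum_distrib_left case_prod_beta)
  also have "\<dots> \<le> quart (real n) ^ 6 * ((9 * quart (real n)) * (9 * quart (real n)))"
    using qn S by (intro mult_left_mono mult_mono sum_nonneg) (auto simp: quart_def pos1_def)
  also have "\<dots> = 81 * (quart (real n) ^ 4)\<^sup>2"
    by (simp add: power_mult [symmetric] eval_nat_numeral algebra_simps)
  also have "\<dots> = 81 * (real n)\<^sup>2" by (simp add: quart_pow4)
  finally show ?thesis using n by (simp add: divide_le_eq)
qed

text \<open>Each summand is split according to whether \<open>1 - mu n k\<close> is below or above \<open>\<eta> ^ 4\<close>; the exponent
  \<open>3/4\<close> on the first part is one for which the lattice sum stays bounded (exponent \<open>1\<close> would
  diverge logarithmically).\<close>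

lemma sum_half_le:
  assumes "M < n" "\<eta> > 0"
  shows "(\<Sum>k\<in>nzf n. \<bar>mu n k\<bar> ^ M / sqrt (1 - mu n k)) / (real n)\<^sup>2
    \<le> 81 * \<eta> + ret (M div 2) / \<eta>\<^sup>2"
proof -
  have n: "n > 0" using assms by simp
  have "(\<Sum>k\<in>nzf n. \<bar>mu n k\<bar> ^ M / sqrt (1 - mu n k))
      \<le> (\<Sum>k\<in>nzf n. \<eta> * (1 / quart (1 - mu n k) ^ 3) + \<bar>mu n k\<bar> ^ M / \<eta>\<^sup>2)"
  proof (rule sum_mono)
    fix k assume "k \<in> nzf n"
    hence p: "0 < 1 - mu n k" by (rule one_minus_mu_pos)
    define q where "q = quart (1 - mu n k)"
    have q: "q > 0" unfolding q_def using p by (rule quart_pos)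
    have m: "0 \<le> \<bar>mu n k\<bar> ^ M" "\<bar>mu n k\<bar> ^ M \<le> 1" using abs_mu_le[of n k] by (auto intro: power_le_one)
    have s: "sqrt (1 - mu n k) = q\<^sup>2" using quart_sq[of "1 - mu n k"] p by (simp add: q_def)
    have "\<bar>mu n k\<bar> ^ M / q\<^sup>2 \<le> \<eta> * (1 / q ^ 3) + \<bar>mu n k\<bar> ^ M / \<eta>\<^sup>2"
    proof (cases "q \<le> \<eta>")
      case True
      have "\<bar>mu n k\<bar> ^ M / q\<^sup>2 \<le> 1 / q\<^sup>2" using m q by (intro divide_right_mono) auto
      also have "\<dots> = q * (1 / q ^ 3)" using q by (simp add: power2_eq_square power3_eq_cube)
      also have "\<dots> \<le> \<eta> * (1 / q ^ 3)" using True q by (intro mult_right_mono) auto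
      finally show ?thesis using m by (smt (verit) zero_le_divide_iff zero_le_power2)
    next
      case False
      hence "\<bar>mu n k\<bar> ^ M / q\<^sup>2 \<le> \<bar>mu n k\<bar> ^ M / \<eta>\<^sup>2"
        using m assms by (intro divide_left_mono power_mono) auto
      moreover have "\<eta> * (1 / q ^ 3) \<ge> 0" using q assms by simp
      ultimately show ?thesis by linarith
    qed
    thus "\<bar>mu n k\<bar> ^ M / sqrt (1 - mu n k) \<le> \<eta> * (1 / quart (1 - mu n k) ^ 3) + \<bar>mu n k\<bar> ^ M / \<eta>\<^sup>2"
      unfolding s by (simp add: q_def)
  qed
  also have "\<dots> = \<eta> * (\<Sum>k\<in>nzf n. 1 / quart (1 - mu n k) ^ 3) + (\<Sum>k\<in>nzf n. \<bar>mu n k\<bar> ^ M) / \<eta>\<^sup>2"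
    by (simp add: sum.distrib sum_distrib_left sum_divide_distrib)
  finally have "(\<Sum>k\<in>nzf n. \<bar>mu n k\<bar> ^ M / sqrt (1 - mu n k)) / (real n)\<^sup>2
    \<le> \<eta> * ((\<Sum>k\<in>nzf n. 1 / quart (1 - mu n k) ^ 3) / (real n)\<^sup>2)
      + ((\<Sum>k\<in>nzf n. \<bar>mu n k\<bar> ^ M) / (real n)\<^sup>2) / \<eta>\<^sup>2"
    using n by (simp add: field_simps)
  also have "\<dots> \<le> \<eta> * 81 + ((\<Sum>k\<in>freq n. \<bar>mu n k\<bar> ^ M) / (real n)\<^sup>2) / \<eta>\<^sup>2"
    using sum_three_quarter_le[OF n] assms
    by (intro add_mono mult_left_mono divide_right_mono sum_mono2) (auto simp: nzf_def)
  also have "\<dots> \<le> \<eta> * 81 + ret (M div 2) / \<eta>\<^sup>2"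
    using sum_mu_power_le[OF assms(1)] by (intro add_mono divide_right_mono) auto
  finally show ?thesis by (simp add: mult.commute)
qed

text \<open>A unit step changes a character by the square root of \<open>1 - mu\<close> at most.
  This weakens the singularity of the Green function from exponent 1 to exponent 1/2.\<close>

lemma abs_cos_add_step_le:
  assumes "e \<in> steps"
  shows "\<bar>cos (ang n k (x + e)) - cos (ang n k x)\<bar> \<le> 2 * sqrt (1 - mu n k)"
proof -
  let ?a = "pi * of_int (fst k) / real n" and ?b = "pi * of_int (snd k) / real n"
  have le: "\<bar>sin (ang n k e / 2)\<bar> \<le> sqrt (1 - mu n k)"
  proof (rule real_le_rsqrt)
    have "ang n k e / 2 = ?a \<or> ang n k e / 2 = - ?a \<or> ang n k e / 2 = ?b \<or> ang n k e / 2 = - ?b"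
      using assms by (auto simp: steps_def ang_def)
    hence "(sin (ang n k e / 2))\<^sup>2 = (sin ?a)\<^sup>2 \<or> (sin (ang n k e / 2))\<^sup>2 = (sin ?b)\<^sup>2"
      by (elim disjE) (simp_all only: sin_minus power2_minus simp_thms)
    thus "\<bar>sin (ang n k e / 2)\<bar>\<^sup>2 \<le> 1 - mu n k"
      unfolding one_minus_mu power2_abs using zero_le_power2[of "sin ?a"] zero_le_power2[of "sin ?b"]
      by linarith
  qed
  have "\<bar>cos (ang n k (x + e)) - cos (ang n k x)\<bar>
      = 2 * \<bar>sin ((ang n k (x + e) + ang n k x) / 2)\<bar> * \<bar>sin (ang n k e / 2)\<bar>"
  proof -
    have "(ang n k x - ang n k (x + e)) / 2 = - (ang n k e / 2)" by (simp add: ang_add)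
    hence "cos (ang n k (x + e)) - cos (ang n k x)
        = 2 * sin ((ang n k (x + e) + ang n k x) / 2) * - sin (ang n k e / 2)"
      by (simp only: cos_diff_cos sin_minus)
    thus ?thesis by (simp only: abs_mult abs_minus abs_numeral)
  qed
  also have "\<dots> \<le> 2 * 1 * sqrt (1 - mu n k)"
    using le by (intro mult_mono) auto
  finally show ?thesis by simp
qed

text \<open>Neither \<open>x\<close> nor \<open>x + e\<close> can reach the origin in fewer than
  \<open>M\<close> steps, so their partial sums coincide and only the difference of the geometric
  tails remains. The constant 162 is twice 81.\<close>

lemma pot_step_bound:
  assumes e: "e \<in> steps" and x: "\<bar>fst x\<bar> > int M + 1 \<or> \<bar>snd x\<bar> > int M + 1" and \<eta>: "\<eta> > 0"
  shows "\<bar>pot (x + e) - pot x\<bar> \<le> 162 * \<eta> + 2 * ret (M div 2) / \<eta>\<^sup>2"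
proof (rule LIMSEQ_le_const2)
  show "(\<lambda>n. \<bar>green_diff n (x + e) - green_diff n x\<bar>) \<longlonglongrightarrow> \<bar>pot (x + e) - pot x\<bar>"
    by (intro tendsto_intros green_diff_tendsto)
  have "\<forall>\<^sub>F n in sequentially. \<bar>green_diff n (x + e) - green_diff n x\<bar> \<le> 162 * \<eta> + 2 * ret (M div 2) / \<eta>\<^sup>2"
    using eventually_large_torus[of x M] eventually_large_torus[of "x + e" M] eventually_gt_at_top[of M]
  proof eventually_elim
    case (elim n)
    have z: "srw_p m x (0,0) = 0" "srw_p m (x + e) (0,0) = 0" if "m < M" for m
      using x e that by (auto intro!: srw_p_zero simp: steps_def)
    have "pot_sum M (x + e) = pot_sum M x"
      unfolding pot_sum_def using z by (intro sum.cong) auto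
    hence "green_diff n (x + e) - green_diff n x
       = (green_diff n (x + e) - pot_sum M (x + e)) - (green_diff n x - pot_sum M x)" by simp
    also have "\<dots> = (\<Sum>k\<in>nzf n. (cos (ang n k x) - cos (ang n k (x + e))) * mu n k ^ M / (1 - mu n k)) / (real n)\<^sup>2"
      using elim by (subst (1 2) green_diff_minus_pot_sum)
        (auto simp: diff_divide_distrib [symmetric] sum_subtractf [symmetric] algebra_simps)
    finally have "\<bar>green_diff n (x + e) - green_diff n x\<bar>
      \<le> (\<Sum>k\<in>nzf n. \<bar>(cos (ang n k x) - cos (ang n k (x + e))) * mu n k ^ M / (1 - mu n k)\<bar>) / (real n)\<^sup>2"
      by (simp only: abs_divide[of _ "(real n)\<^sup>2"] abs_power2 abs_of_nat power_abs)
         (intro divide_right_mono sum_abs, simp)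
    also have "\<dots> \<le> (\<Sum>k\<in>nzf n. 2 * (\<bar>mu n k\<bar> ^ M / sqrt (1 - mu n k))) / (real n)\<^sup>2"
    proof (intro divide_right_mono sum_mono)
      fix k assume "k \<in> nzf n"
      hence p: "1 - mu n k > 0" by (rule one_minus_mu_pos)
      define r where "r = sqrt (1 - mu n k)"
      have r: "r > 0" "1 - mu n k = r * r" using p by (auto simp: r_def)
      have "\<bar>(cos (ang n k x) - cos (ang n k (x + e))) * mu n k ^ M / (1 - mu n k)\<bar>
          = \<bar>cos (ang n k (x + e)) - cos (ang n k x)\<bar> * (\<bar>mu n k\<bar> ^ M / (1 - mu n k))"
        using p by (simp add: abs_mult power_abs abs_minus_commute)
      also have "\<dots> \<le> 2 * sqrt (1 - mu n k) * (\<bar>mu n k\<bar> ^ M / (1 - mu n k))"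
        using p abs_cos_add_step_le[OF e] by (intro mult_right_mono) auto
      also have "\<dots> = 2 * (\<bar>mu n k\<bar> ^ M / sqrt (1 - mu n k))"
        unfolding r_def [symmetric] r(2) using r(1) by simp
      finally show "\<bar>(cos (ang n k x) - cos (ang n k (x + e))) * mu n k ^ M / (1 - mu n k)\<bar>
        \<le> 2 * (\<bar>mu n k\<bar> ^ M / sqrt (1 - mu n k))" .
    qed simp
    also have "\<dots> = 2 * ((\<Sum>k\<in>nzf n. \<bar>mu n k\<bar> ^ M / sqrt (1 - mu n k)) / (real n)\<^sup>2)"
      by (simp add: sum_distrib_left)
    also have "\<dots> \<le> 2 * (81 * \<eta> + ret (M div 2) / \<eta>\<^sup>2)"
      using elim \<eta> by (intro mult_left_mono sum_half_le) auto
    finally show ?case by simp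
  qed
  thus "\<exists>N. \<forall>n\<ge>N. \<bar>green_diff n (x + e) - green_diff n x\<bar> \<le> 162 * \<eta> + 2 * ret (M div 2) / \<eta>\<^sup>2"
    by (simp add: eventually_sequentially)
qed

lemma pot_step_tendsto:
  assumes "e \<in> steps"
  shows "((\<lambda>x. pot (x + e) - pot x) \<longlongrightarrow> 0) cofinite"
proof (rule tendstoI)
  fix d :: real assume d: "d > 0"
  \<comment> \<open>Chosen before \<open>M\<close>, so that \<open>162 * \<eta>\<close> stays below
    \<open>d / 2\<close>; \<open>M\<close> then makes the second term small for this fixed
    \<open>\<eta>\<close>.\<close>
  define \<eta> where "\<eta> = d / 400"
  have \<eta>: "\<eta> > 0" using d by (simp add: \<eta>_def)
  have "(\<lambda>M. 2 * ret (M div 2) / \<eta>\<^sup>2) \<longlonglongrightarrow> 2 * 0 / \<eta>\<^sup>2"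
    using \<eta> by (intro tendsto_intros ret_div2_tendsto) auto
  hence "\<forall>\<^sub>F M in sequentially. 2 * ret (M div 2) / \<eta>\<^sup>2 < d / 2"
    using d by (intro order_tendstoD) auto
  then obtain M where M: "2 * ret (M div 2) / \<eta>\<^sup>2 < d / 2"
    unfolding eventually_sequentially by blast
  have "dist (pot (x + e) - pot x) 0 < d" if "\<bar>fst x\<bar> > int M + 1 \<or> \<bar>snd x\<bar> > int M + 1" for x
  proof -
    have "\<bar>pot (x + e) - pot x\<bar> \<le> 162 * \<eta> + 2 * ret (M div 2) / \<eta>\<^sup>2"
      by (rule pot_step_bound[OF assms that \<eta>])
    also have "\<dots> < 162 * \<eta> + d / 2" using M by simp
    also have "\<dots> \<le> d" using d by (simp add: \<eta>_def)
    finally show ?thesis by simp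
  qed
  hence "{x. \<not> dist (pot (x + e) - pot x) 0 < d} \<subseteq> {x. \<bar>fst x\<bar> \<le> int M + 1 \<and> \<bar>snd x\<bar> \<le> int M + 1}"
    by force
  thus "\<forall>\<^sub>F x in cofinite. dist (pot (x + e) - pot x) 0 < d"
    unfolding eventually_cofinite using finite_box finite_subset by blast
qed

section \<open>Potential theory in the plane\<close>

lemma step_avg_const [simp]: "step_avg (\<lambda>_. c) x = c"
  by (simp add: step_avg_eq)

lemma step_avg_diff: "step_avg (\<lambda>x. f x - g x) x = step_avg f x - step_avg g x"
  and step_avg_add: "step_avg (\<lambda>x. f x + g x) x = step_avg f x + step_avg g x"
  and step_avg_cmult: "step_avg (\<lambda>x. c * f x) x = c * step_avg f x"
  by (simp_all add: step_avg_eq field_simps)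

lemma step_avg_sum: "step_avg (\<lambda>x. \<Sum>i\<in>I. f i x) x = (\<Sum>i\<in>I. step_avg (f i) x)"
  unfolding step_avg_def by (simp add: sum_divide_distrib [symmetric] sum.swap[of _ steps])

lemma step_avg_shift: "step_avg (\<lambda>x. f (x - w)) x = step_avg f (x - w)"
proof -
  have "x + e - w = x - w + e" for e by (simp add: algebra_simps)
  thus ?thesis by (simp only: step_avg_def)
qed

lemma step_avg_mono: "(\<And>e. e \<in> steps \<Longrightarrow> f (x + e) \<le> g (x + e)) \<Longrightarrow> step_avg f x \<le> step_avg g x"
  unfolding step_avg_def by (intro divide_right_mono sum_mono) auto

text \<open>The Fourier series of the point mass at the origin, without its zero mode; the missing
  mode is the constant \<open>1 / n^2\<close>.\<close>

lemma green_step: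
  assumes n: "n > 0"
  shows "green n x - step_avg (green n) x = (if proj n x = (0,0) then 1 else 0) - 1 / (real n)\<^sup>2"
proof -
  have "step_avg (green n) x
      = step_avg (\<lambda>x. \<Sum>k\<in>nzf n. 1 / ((1 - mu n k) * (real n)\<^sup>2) * cos (ang n k x)) x"
    by (rule arg_cong[where f = "\<lambda>f. step_avg f x"]) (simp add: green_def sum_divide_distrib fun_eq_iff)
  also have "\<dots> = (\<Sum>k\<in>nzf n. mu n k * cos (ang n k x) / (1 - mu n k)) / (real n)\<^sup>2"
    by (simp only: step_avg_sum step_avg_cmult step_avg_cos) (simp add: sum_divide_distrib)
  finally have "green n x - step_avg (green n) x
      = (\<Sum>k\<in>nzf n. cos (ang n k x) / (1 - mu n k) - mu n k * cos (ang n k x) / (1 - mu n k)) / (real n)\<^sup>2"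
    by (simp add: green_def diff_divide_distrib sum_subtractf)
  also have "(\<Sum>k\<in>nzf n. cos (ang n k x) / (1 - mu n k) - mu n k * cos (ang n k x) / (1 - mu n k))
      = (\<Sum>k\<in>nzf n. cos (ang n k x))"
  proof (rule sum.cong [OF refl])
    fix k assume "k \<in> nzf n"
    hence "1 - mu n k \<noteq> 0" using one_minus_mu_pos[of k n] by simp
    moreover have "cos (ang n k x) - mu n k * cos (ang n k x) = cos (ang n k x) * (1 - mu n k)"
      by (simp add: algebra_simps)
    ultimately show "cos (ang n k x) / (1 - mu n k) - mu n k * cos (ang n k x) / (1 - mu n k) = cos (ang n k x)"
      by (simp add: diff_divide_distrib [symmetric])
  qed
  also have "\<dots> = (if proj n x = (0,0) then (real n)\<^sup>2 else 0) - 1"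
    using sum_cos_freq[OF n, of x] sum_freq_split[OF n, of "\<lambda>k. cos (ang n k x)"] by simp
  finally show ?thesis using n by (simp add: diff_divide_distrib)
qed

text \<open>Limit of the torus identity, in which the constant \<open>1 / n^2\<close> disappears.
  For large \<open>n\<close> the only point near the origin that projects to it is the origin
  itself.\<close>

lemma step_avg_pot: "step_avg pot x = pot x + (if x = (0,0) then 1 else 0)"
proof (rule LIMSEQ_unique)
  show "(\<lambda>n. step_avg (green_diff n) x) \<longlonglongrightarrow> step_avg pot x"
    unfolding step_avg_eq by (intro tendsto_intros green_diff_tendsto) simp
  have "\<forall>\<^sub>F n in sequentially. green_diff n x + ((if x = (0,0) then 1 else 0) - 1 / (real n)\<^sup>2)
      = step_avg (green_diff n) x"
    using eventually_gt_at_top[of "nat \<bar>fst x\<bar> + nat \<bar>snd x\<bar>"]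
  proof eventually_elim
    case (elim n)
    have "proj n x = (0,0) \<longleftrightarrow> x = (0,0)"
    proof
      assume "proj n x = (0,0)"
      hence "int n dvd fst x" "int n dvd snd x" by (auto simp: proj_def dvd_eq_mod_eq_0)
      moreover have "\<bar>fst x\<bar> < int n" "\<bar>snd x\<bar> < int n" using elim by auto
      ultimately show "x = (0,0)"
        by (metis dvd_imp_le_int linorder_not_less abs_of_nat prod.collapse)
    qed (auto simp: proj_def)
    thus ?case using green_step[of n x] elim
      by (simp add: green_diff_def [abs_def] step_avg_diff)
  qed
  moreover have "(\<lambda>n. green_diff n x + ((if x = (0,0) then 1 else 0) - 1 / (real n)\<^sup>2))
      \<longlonglongrightarrow> pot x + ((if x = (0,0) then 1 else 0) - 0)"
    by (intro tendsto_intros green_diff_tendsto) real_asymp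
  ultimately show "(\<lambda>n. step_avg (green_diff n) x) \<longlonglongrightarrow> pot x + (if x = (0,0) then 1 else 0)"
    by (simp add: filterlim_cong)
qed

lemma filterlim_shift_cofinite: "filterlim (\<lambda>x. x + (z :: 'a :: group_add)) cofinite cofinite"
  unfolding filterlim_def le_filter_def eventually_filtermap eventually_cofinite
proof (intro allI impI)
  fix P :: "'a \<Rightarrow> bool" assume "finite {x. \<not> P x}"
  hence "finite ((\<lambda>x. x + z) -` {x. \<not> P x})"
    by (rule finite_vimageI) (auto simp: inj_on_def)
  thus "finite {x. \<not> P (x + z)}" by (simp add: vimage_def)
qed

text \<open>A translation is a chain of unit steps, first along one axis and then along the other.
  As a consequence, potentials of weights with total zero tend to zero at infinity.\<close>

lemma pot_shift_tendsto: "((\<lambda>x. pot (x + z) - pot x) \<longlongrightarrow> 0) cofinite"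
proof -
  let ?P = "\<lambda>z. ((\<lambda>x. pot (x + z) - pot x) \<longlongrightarrow> 0) cofinite"
  have add: "?P (z + e)" if "?P z" "e \<in> steps" for z e
  proof -
    have "((\<lambda>x. pot (x + z + e) - pot (x + z)) \<longlongrightarrow> 0) cofinite"
      by (rule filterlim_compose [OF pot_step_tendsto filterlim_shift_cofinite]) fact
    hence "((\<lambda>x. (pot (x + z + e) - pot (x + z)) + (pot (x + z) - pot x)) \<longlongrightarrow> 0 + 0) cofinite"
      by (intro tendsto_add that)
    thus ?thesis by (simp add: add.assoc)
  qed
  have row: "?P (a, 0)" for a
  proof (induction a rule: int_induct[where k = 0])
    case base
    show ?case by (simp add: zero_prod_def [symmetric])
  next
    case (step1 i) thus ?case using add[of "(i,0)" "(1,0)"] by (simp add: steps_def)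
  next
    case (step2 i) thus ?case using add[of "(i,0)" "(-1,0)"] by (simp add: steps_def)
  qed
  have "?P (a, b)" for a b
  proof (induction b rule: int_induct[where k = 0])
    case base
    show ?case by (rule row)
  next
    case (step1 i) thus ?case using add[of "(a,i)" "(0,1)"] by (simp add: steps_def)
  next
    case (step2 i) thus ?case using add[of "(a,i)" "(0,-1)"] by (simp add: steps_def)
  qed
  thus ?thesis by (cases z) simp
qed

section \<open>Negative definiteness and solvability of Dirichlet problems\<close>

text \<open>The squared modulus of the Fourier transform of \<open>v\<close> at frequency
  \<open>k\<close>; this is the source of all the positivity used below.\<close>

lemma quadratic_form_cos:
  "(\<Sum>x\<in>A. \<Sum>y\<in>A. v x * v y * cos (ang n k (x - y)))
    = (\<Sum>x\<in>A. v x * cos (ang n k x))\<^sup>2 + (\<Sum>x\<in>A. v x * sin (ang n k x))\<^sup>2"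
  unfolding ang_diff cos_diff power2_eq_square sum_product sum.distrib [symmetric]
  by (intro sum.cong refl) (simp add: algebra_simps)

lemma proj_diff_zero:
  assumes "\<bar>fst x - fst y\<bar> < int n" "\<bar>snd x - snd y\<bar> < int n"
  shows "proj n (x - y) = (0,0) \<longleftrightarrow> x = y"
proof
  assume "proj n (x - y) = (0,0)"
  hence "int n dvd fst x - fst y" "int n dvd snd x - snd y" by (auto simp: proj_def dvd_eq_mod_eq_0)
  hence "fst x - fst y = 0" "snd x - snd y = 0" using assms
    by (metis dvd_imp_le_int linorder_not_less abs_of_nat)+
  thus "x = y" by (simp add: prod_eq_iff)
qed (auto simp: proj_def)

text \<open>Total weight zero cancels the constant \<open>green n (0,0)\<close> and the zero
  frequency. Then \<open>1 - mu <= 2\<close> bounds the remaining form from below by half of a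
  Parseval sum, in which the size condition keeps the points of \<open>A\<close> distinct modulo
  \<open>n\<close>. The bound does not involve \<open>n\<close>, so strictness survives the
  limit.\<close>

lemma green_diff_conditionally_negative:
  assumes A: "finite A" and n: "n > 0" and v: "(\<Sum>x\<in>A. v x) = 0"
    and small: "\<And>x y. x \<in> A \<Longrightarrow> y \<in> A \<Longrightarrow> \<bar>fst x - fst y\<bar> < int n \<and> \<bar>snd x - snd y\<bar> < int n"
  shows "(\<Sum>x\<in>A. \<Sum>y\<in>A. v x * v y * green_diff n (x - y)) \<le> - (\<Sum>x\<in>A. (v x)\<^sup>2) / 2"
proof -
  define q where "q k = (\<Sum>x\<in>A. \<Sum>y\<in>A. v x * v y * cos (ang n k (x - y)))" for k
  have q0: "q k \<ge> 0" for k unfolding q_def quadratic_form_cos by simp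
  have qz: "q (0,0) = 0" unfolding q_def quadratic_form_cos by (simp add: v)
  have "(\<Sum>x\<in>A. \<Sum>y\<in>A. v x * v y) = 0"
    using v by (simp add: sum_distrib_left [symmetric])
  hence "(\<Sum>x\<in>A. \<Sum>y\<in>A. v x * v y * green_diff n (x - y))
      = - (\<Sum>x\<in>A. \<Sum>y\<in>A. v x * v y * green n (x - y))"
    unfolding green_diff_def right_diff_distrib sum_subtractf sum_distrib_right [symmetric] by simp
  also have "(\<Sum>x\<in>A. \<Sum>y\<in>A. v x * v y * green n (x - y)) = (\<Sum>k\<in>nzf n. q k / (1 - mu n k)) / (real n)\<^sup>2"
  proof -
    have "(\<Sum>x\<in>A. \<Sum>y\<in>A. v x * v y * green n (x - y))
      = (\<Sum>x\<in>A. \<Sum>y\<in>A. \<Sum>k\<in>nzf n. v x * v y * cos (ang n k (x - y)) / (1 - mu n k) / (real n)\<^sup>2)"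
      unfolding green_def by (simp add: sum_distrib_left sum_divide_distrib)
    also have "\<dots> = (\<Sum>x\<in>A. \<Sum>k\<in>nzf n. \<Sum>y\<in>A. v x * v y * cos (ang n k (x - y)) / (1 - mu n k) / (real n)\<^sup>2)"
      by (intro sum.cong refl sum.swap)
    also have "\<dots> = (\<Sum>k\<in>nzf n. \<Sum>x\<in>A. \<Sum>y\<in>A. v x * v y * cos (ang n k (x - y)) / (1 - mu n k) / (real n)\<^sup>2)"
      by (rule sum.swap)
    finally show ?thesis unfolding q_def by (simp add: sum_divide_distrib)
  qed
  finally have eq: "(\<Sum>x\<in>A. \<Sum>y\<in>A. v x * v y * green_diff n (x - y))
      = - ((\<Sum>k\<in>nzf n. q k / (1 - mu n k)) / (real n)\<^sup>2)" .
  have ge: "(\<Sum>k\<in>nzf n. q k / 2) / (real n)\<^sup>2 \<le> (\<Sum>k\<in>nzf n. q k / (1 - mu n k)) / (real n)\<^sup>2"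
  proof (intro divide_right_mono sum_mono)
    fix k assume "k \<in> nzf n"
    thus "q k / 2 \<le> q k / (1 - mu n k)"
      using q0[of k] one_minus_mu_pos[of k n] mu_ge[of n k] by (intro divide_left_mono) auto
  qed simp
  have "(\<Sum>k\<in>nzf n. q k / 2) / (real n)\<^sup>2 = (\<Sum>k\<in>freq n. q k) / (real n)\<^sup>2 / 2"
    by (simp add: sum_freq_split[OF n] qz sum_divide_distrib [symmetric] mult.commute)
  also have "(\<Sum>k\<in>freq n. q k) = (\<Sum>x\<in>A. \<Sum>y\<in>A. v x * v y * (\<Sum>k\<in>freq n. cos (ang n k (x - y))))"
  proof -
    have "(\<Sum>k\<in>freq n. q k) = (\<Sum>x\<in>A. \<Sum>k\<in>freq n. \<Sum>y\<in>A. v x * v y * cos (ang n k (x - y)))"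
      unfolding q_def by (rule sum.swap)
    also have "\<dots> = (\<Sum>x\<in>A. \<Sum>y\<in>A. \<Sum>k\<in>freq n. v x * v y * cos (ang n k (x - y)))"
      by (intro sum.cong refl sum.swap)
    finally show ?thesis by (simp add: sum_distrib_left)
  qed
  also have "\<dots> = (\<Sum>x\<in>A. \<Sum>y\<in>A. if y = x then v x * v y * (real n)\<^sup>2 else 0)"
  proof (intro sum.cong refl)
    fix x y assume "x \<in> A" "y \<in> A"
    hence "proj n (x - y) = (0,0) \<longleftrightarrow> x = y" using small by (intro proj_diff_zero) auto
    thus "v x * v y * (\<Sum>k\<in>freq n. cos (ang n k (x - y))) = (if y = x then v x * v y * (real n)\<^sup>2 else 0)"
      by (auto simp only: sum_cos_freq[OF n] split: if_split)
  qed
  also have "\<dots> / (real n)\<^sup>2 / 2 = (\<Sum>x\<in>A. (v x)\<^sup>2) / 2"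
    using A n by (simp add: sum_distrib_right [symmetric] power2_eq_square)
  finally show ?thesis using eq ge by linarith
qed

lemma pot_conditionally_negative:
  assumes A: "finite A" and v: "(\<Sum>x\<in>A. v x) = 0"
  shows "(\<Sum>x\<in>A. \<Sum>y\<in>A. v x * v y * pot (x - y)) \<le> - (\<Sum>x\<in>A. (v x)\<^sup>2) / 2"
proof (rule LIMSEQ_le_const2)
  show "(\<lambda>n. \<Sum>x\<in>A. \<Sum>y\<in>A. v x * v y * green_diff n (x - y))
      \<longlonglongrightarrow> (\<Sum>x\<in>A. \<Sum>y\<in>A. v x * v y * pot (x - y))"
    by (intro tendsto_intros green_diff_tendsto)
  have "\<forall>\<^sub>F n in sequentially. \<forall>p\<in>A \<times> A. \<bar>fst (fst p - snd p)\<bar> + int 0 < int n \<and> \<bar>snd (fst p - snd p)\<bar> + int 0 < int n"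
    using A by (intro eventually_ball_finite ballI eventually_large_torus) auto
  hence "\<forall>\<^sub>F n in sequentially. (\<Sum>x\<in>A. \<Sum>y\<in>A. v x * v y * green_diff n (x - y)) \<le> - (\<Sum>x\<in>A. (v x)\<^sup>2) / 2"
    using eventually_gt_at_top[of 0]
    by eventually_elim (intro green_diff_conditionally_negative A v, auto)
  thus "\<exists>N. \<forall>n\<ge>N. (\<Sum>x\<in>A. \<Sum>y\<in>A. v x * v y * green_diff n (x - y)) \<le> - (\<Sum>x\<in>A. (v x)\<^sup>2) / 2"
    by (simp add: eventually_sequentially)
qed

text \<open>Elimination of one variable: if \<open>w\<close> solves the system for the column of the
  new index \<open>p\<close>, the form evaluated at the vector equal to 1 at \<open>p\<close> and to
  \<open>- w\<close> on \<open>A\<close> is the Schur complement \<open>t\<close>. Its positivity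
  permits division by it.\<close>

lemma posdef_solvable:
  fixes K :: "'a \<Rightarrow> 'a \<Rightarrow> real"
  assumes "finite A"
    and "\<And>v. \<exists>x\<in>A. v x \<noteq> 0 \<Longrightarrow> 0 < (\<Sum>x\<in>A. \<Sum>y\<in>A. v x * v y * K x y)"
  shows "\<exists>v. \<forall>x\<in>A. (\<Sum>y\<in>A. K x y * v y) = f x"
  using assms
proof (induction A arbitrary: f rule: finite_induct)
  case (insert p A)
  have pd: "0 < (\<Sum>x\<in>A. \<Sum>y\<in>A. v x * v y * K x y)" if "\<exists>x\<in>A. v x \<noteq> 0" for v
  proof -
    let ?v = "\<lambda>x. if x = p then 0 else v x"
    have "\<exists>x\<in>insert p A. ?v x \<noteq> 0" using that insert.hyps by auto
    hence "0 < (\<Sum>x\<in>insert p A. \<Sum>y\<in>insert p A. ?v x * ?v y * K x y)" by (rule insert.prems)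
    also have "\<dots> = (\<Sum>x\<in>A. \<Sum>y\<in>A. ?v x * ?v y * K x y)"
      using insert.hyps by simp
    also have "\<dots> = (\<Sum>x\<in>A. \<Sum>y\<in>A. v x * v y * K x y)"
      using insert.hyps by (intro sum.cong) auto
    finally show ?thesis .
  qed
  obtain w where w: "\<And>x. x \<in> A \<Longrightarrow> (\<Sum>y\<in>A. K x y * w y) = K x p"
    using insert.IH[of "\<lambda>x. K x p"] pd by blast
  obtain u where u: "\<And>x. x \<in> A \<Longrightarrow> (\<Sum>y\<in>A. K x y * u y) = f x"
    using insert.IH[of f] pd by blast
  let ?d = "\<lambda>x. if x = p then 1 else - w x"
  define t where "t = K p p - (\<Sum>y\<in>A. K p y * w y)"
  have Kd: "(\<Sum>y\<in>insert p A. ?d y * K x y) = K x p - (\<Sum>y\<in>A. K x y * w y)" for x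
  proof -
    have "(\<Sum>y\<in>A. ?d y * K x y) = (\<Sum>y\<in>A. - (K x y * w y))"
      using insert.hyps by (intro sum.cong) auto
    thus ?thesis using insert.hyps by (simp add: sum_negf)
  qed
  have "0 < (\<Sum>x\<in>insert p A. \<Sum>y\<in>insert p A. ?d x * ?d y * K x y)"
    by (rule insert.prems) auto
  also have "\<dots> = (\<Sum>x\<in>insert p A. ?d x * (K x p - (\<Sum>y\<in>A. K x y * w y)))"
    unfolding Kd [symmetric] by (simp only: sum_distrib_left mult.assoc)
  also have "\<dots> = t" using insert.hyps w by (simp add: t_def)
  finally have t: "t > 0" .
  define s where "s = (f p - (\<Sum>y\<in>A. K p y * u y)) / t"
  let ?v = "\<lambda>y. if y = p then s else u y - s * w y"
  have Kv: "(\<Sum>y\<in>insert p A. K x y * ?v y) = s * (K x p - (\<Sum>y\<in>A. K x y * w y)) + (\<Sum>y\<in>A. K x y * u y)" for x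
  proof -
    have "(\<Sum>y\<in>A. K x y * ?v y) = (\<Sum>y\<in>A. K x y * u y - s * (K x y * w y))"
      using insert.hyps by (intro sum.cong) (auto simp: algebra_simps)
    thus ?thesis using insert.hyps by (simp add: sum_subtractf sum_distrib_left [symmetric] algebra_simps)
  qed
  have "(\<Sum>y\<in>insert p A. K x y * ?v y) = f x" if "x \<in> insert p A" for x
  proof (cases "x = p")
    case True
    have "s * t = f p - (\<Sum>y\<in>A. K p y * u y)" using t by (simp add: s_def)
    thus ?thesis unfolding Kv True t_def by simp
  next
    case False
    thus ?thesis unfolding Kv using that w u by simp
  qed
  thus ?case by (intro exI[of _ ?v]) blast
qed simp

text \<open>Eliminating the coefficient at the origin turns the conditionally negative kernel \<open>pot (x - y)\<close>
  into the positive definite kernel \<open>pot x + pot y - pot (x - y)\<close> on \<open>A - {0}\<close>.\<close>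

lemma pot_dirichlet_solvable:
  assumes A: "finite A" "(0,0) \<in> A"
  shows "\<exists>c v. (\<Sum>x\<in>A. v x) = 0 \<and> (\<forall>y\<in>A. c - (\<Sum>z\<in>A. pot (y - z) * v z) = f y)"
proof -
  define A' where "A' = A - {(0,0)}"
  have A': "finite A'" "A = insert (0,0) A'" "(0,0) \<notin> A'" using A by (auto simp: A'_def)
  let ?K = "\<lambda>x y. pot x + pot y - pot (x - y)"
  have shift: "x - (0,0) = x" "(0,0) - x = - x" for x :: "int \<times> int"
    by (simp_all add: prod_eq_iff)
  have pd: "0 < (\<Sum>x\<in>A'. \<Sum>y\<in>A'. v x * v y * ?K x y)" if ne: "\<exists>x\<in>A'. v x \<noteq> 0" for v
  proof -
    define s where "s = (\<Sum>x\<in>A'. v x)"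
    define r where "r = (\<Sum>x\<in>A'. v x * pot x)"
    let ?v = "\<lambda>x. if x = (0,0) then - s else v x"
    have v': "\<And>g. (\<Sum>x\<in>A'. ?v x * g x) = (\<Sum>x\<in>A'. v x * g x)"
      using A' by (intro sum.cong) auto
    have "(\<Sum>x\<in>A. ?v x) = 0" using A' v'[of "\<lambda>_. 1"] by (simp add: s_def)
    hence "(\<Sum>x\<in>A. \<Sum>y\<in>A. ?v x * ?v y * pot (x - y)) \<le> - (\<Sum>x\<in>A. (?v x)\<^sup>2) / 2"
      by (rule pot_conditionally_negative[OF A(1)])
    also have "(\<Sum>x\<in>A. \<Sum>y\<in>A. ?v x * ?v y * pot (x - y))
        = (\<Sum>x\<in>A. ?v x * (\<Sum>y\<in>A. ?v y * pot (x - y)))"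
      by (simp add: sum_distrib_left mult.assoc)
    also have "\<dots> = - s * r + (\<Sum>x\<in>A'. v x * (- s * pot x + (\<Sum>y\<in>A'. v y * pot (x - y))))"
      using A' by (simp add: shift pot_minus v' r_def)
    also have "\<dots> = - (\<Sum>x\<in>A'. \<Sum>y\<in>A'. v x * v y * ?K x y)"
    proof -
      have "(\<Sum>x\<in>A'. \<Sum>y\<in>A'. v x * v y * ?K x y)
          = (\<Sum>x\<in>A'. \<Sum>y\<in>A'. (v x * pot x) * v y) + (\<Sum>x\<in>A'. \<Sum>y\<in>A'. v x * (v y * pot y))
            - (\<Sum>x\<in>A'. v x * (\<Sum>y\<in>A'. v y * pot (x - y)))"
        by (simp add: sum_distrib_left sum.distrib sum_subtractf algebra_simps)
      also have "\<dots> = r * s + s * r - (\<Sum>x\<in>A'. v x * (\<Sum>y\<in>A'. v y * pot (x - y)))"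
        unfolding r_def s_def sum_product ..
      moreover have "(\<Sum>x\<in>A'. v x * (- s * pot x + (\<Sum>y\<in>A'. v y * pot (x - y))))
          = - s * r + (\<Sum>x\<in>A'. v x * (\<Sum>y\<in>A'. v y * pot (x - y)))"
        by (simp only: distrib_left sum.distrib r_def sum_distrib_left mult.left_commute)
      ultimately show ?thesis by simp
    qed
    finally have "(\<Sum>x\<in>A. (?v x)\<^sup>2) / 2 \<le> (\<Sum>x\<in>A'. \<Sum>y\<in>A'. v x * v y * ?K x y)" by linarith
    moreover have "0 < (\<Sum>x\<in>A. (?v x)\<^sup>2)"
    proof -
      from ne obtain x where "x \<in> A'" "v x \<noteq> 0" by blast
      thus ?thesis using A' by (intro sum_pos2[of _ x]) auto
    qed
    ultimately show ?thesis by linarith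
  qed
  obtain u where u: "\<And>x. x \<in> A' \<Longrightarrow> (\<Sum>y\<in>A'. ?K x y * u y) = f x - f (0,0)"
    using posdef_solvable[OF A'(1), of ?K "\<lambda>x. f x - f (0,0)"] pd by blast
  define s where "s = (\<Sum>x\<in>A'. u x)"
  define r where "r = (\<Sum>x\<in>A'. pot x * u x)"
  let ?v = "\<lambda>x. if x = (0,0) then - s else u x"
  have v': "\<And>g. (\<Sum>x\<in>A'. g x * ?v x) = (\<Sum>x\<in>A'. g x * u x)"
    using A' by (intro sum.cong) auto
  have "(\<Sum>x\<in>A. ?v x) = 0" using A' v'[of "\<lambda>_. 1"] by (simp add: s_def)
  \<comment> \<open>The constant is dictated by the equation at the origin, where the potential of
    the weights equals \<open>r\<close>.\<close>
  moreover have "f (0,0) + r - (\<Sum>z\<in>A. pot (y - z) * ?v z) = f y" if "y \<in> A" for y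
  proof -
    have sp: "(\<Sum>z\<in>A. pot (y - z) * ?v z) = - pot y * s + (\<Sum>z\<in>A'. pot (y - z) * u z)"
      using A' by (simp add: shift v')
    show ?thesis
    proof (cases "y = (0,0)")
      case True
      thus ?thesis unfolding sp by (simp add: shift pot_minus r_def)
    next
      case False
      hence "f y - f (0,0) = (\<Sum>z\<in>A'. ?K y z * u z)" using u[of y] that A' by simp
      also have "\<dots> = pot y * s + r - (\<Sum>z\<in>A'. pot (y - z) * u z)"
        by (simp add: s_def r_def algebra_simps sum.distrib sum_subtractf sum_distrib_left)
      finally show ?thesis unfolding sp by simp
    qed
  qed
  ultimately show ?thesis by blast
qed

section \<open>The killed planar walk and harmonic measure\<close>

definition killed :: "(int \<times> int) set \<Rightarrow> (int \<times> int \<Rightarrow> real) \<Rightarrow> int \<times> int \<Rightarrow> real" where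
  "killed A f z = (if z \<in> A then 0 else step_avg f z)"

lemma avoid_p_killed: "avoid_p A k z x = (killed A ^^ k) (\<lambda>z. if z = x then 1 else 0) z"
proof (induction k arbitrary: z)
  case (Suc k)
  show ?case by (simp add: killed_def step_avg_def Suc.IH)
qed simp

lemma killed_mono: "(\<And>z. f z \<le> g z) \<Longrightarrow> killed A f z \<le> killed A g z"
  unfolding killed_def by (simp add: step_avg_mono del: split_paired_All)

lemma killed_pow_mono: "(\<And>z. f z \<le> g z) \<Longrightarrow> (killed A ^^ k) f z \<le> (killed A ^^ k) g z"
  by (induction k arbitrary: z) (auto intro: killed_mono)

lemma killed_cmult: "killed A (\<lambda>z. c * f z) = (\<lambda>z. c * killed A f z)"
  and killed_add: "killed A (\<lambda>z. f z + g z) = (\<lambda>z. killed A f z + killed A g z)"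
  by (rule ext, simp add: killed_def step_avg_cmult step_avg_add)+

lemma killed_pow_cmult: "(killed A ^^ k) (\<lambda>z. c * f z) = (\<lambda>z. c * (killed A ^^ k) f z)"
  by (induction k) (simp_all add: killed_cmult)

lemma killed_pow_add: "(killed A ^^ k) (\<lambda>z. f z + g z) = (\<lambda>z. (killed A ^^ k) f z + (killed A ^^ k) g z)"
  by (induction k) (simp_all add: killed_add)

lemma step_avg_srw_p: "step_avg (\<lambda>z. srw_p k (z - x) (0,0)) z = srw_p (Suc k) (z - x) (0,0)"
  unfolding step_avg_shift[of "\<lambda>z. srw_p k z (0,0)"] by (simp add: step_avg_def)

text \<open>Recurrence: \<open>pot\<close> is superharmonic for the killed walk and tends to infinity, so the surviving
  mass outside \<open>{pot < R}\<close> is at most \<open>pot z / R\<close>, while the mass in this finite set vanishes as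
  \<open>k\<close> grows.\<close>

lemma killed_pow_one_le:
  assumes A: "(0,0) \<in> A" and R: "R > 0"
  shows "(killed A ^^ k) (\<lambda>_. 1) z \<le> (\<Sum>x\<in>{x. pot x < R}. srw_p k (z - x) (0,0)) + pot z / R"
proof (induction k arbitrary: z)
  case 0
  have fin: "finite {x. pot x < R}"
    using pot_at_top unfolding filterlim_at_top eventually_cofinite by (simp add: not_le)
  show ?case
  proof (cases "pot z < R")
    case True
    have "(1::real) = srw_p 0 (z - z) (0,0)" by (simp add: prod_eq_iff)
    also have "\<dots> \<le> (\<Sum>x\<in>{x. pot x < R}. srw_p 0 (z - x) (0,0))"
      using fin True by (intro member_le_sum) auto
    finally show ?thesis using divide_nonneg_pos[OF pot_nonneg[of z] R] unfolding funpow_0 by linarith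
  next
    case False
    have "(\<Sum>x\<in>{x. pot x < R}. srw_p 0 (z - x) (0,0)) \<ge> 0" by (intro sum_nonneg srw_p_nonneg)
    moreover have "1 \<le> pot z / R" using False R by simp
    ultimately show ?thesis by simp
  qed
next
  case (Suc k)
  show ?case
  proof (cases "z \<in> A")
    case True
    have "(\<Sum>x\<in>{x. pot x < R}. srw_p (Suc k) (z - x) (0,0)) \<ge> 0" by (intro sum_nonneg srw_p_nonneg)
    thus ?thesis using True pot_nonneg[of z] R by (simp add: killed_def)
  next
    case False
    have "(killed A ^^ Suc k) (\<lambda>_. 1) z = step_avg ((killed A ^^ k) (\<lambda>_. 1)) z"
      using False by (simp add: killed_def)
    also have "\<dots> \<le> step_avg (\<lambda>z. (\<Sum>x\<in>{x. pot x < R}. srw_p k (z - x) (0,0)) + (1 / R) * pot z) z"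
      using Suc by (intro step_avg_mono) simp
    also have "\<dots> = (\<Sum>x\<in>{x. pot x < R}. srw_p (Suc k) (z - x) (0,0)) + pot z / R"
      using False A unfolding step_avg_add step_avg_sum step_avg_srw_p step_avg_cmult step_avg_pot by auto
    finally show ?thesis .
  qed
qed

lemma killed_pow_one_tendsto:
  assumes "(0,0) \<in> A"
  shows "(\<lambda>k. (killed A ^^ k) (\<lambda>_. 1) z) \<longlonglongrightarrow> 0"
proof (rule LIMSEQ_I)
  fix e :: real assume e: "e > 0"
  \<comment> \<open>Makes the escaping mass \<open>pot z / R\<close> smaller than
    \<open>e / 2\<close>; adding 1 keeps \<open>R\<close> positive even if
    \<open>pot z = 0\<close>.\<close>
  define R where "R = 2 * (pot z + 1) / e"
  have R: "R > 0" using e pot_nonneg[of z] by (simp add: R_def)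
  have "pot z / R < e / 2" using e pot_nonneg[of z] by (simp add: R_def field_simps)
  have fin: "finite {x. pot x < R}"
    using pot_at_top unfolding filterlim_at_top eventually_cofinite by (simp add: not_le)
  have "(\<lambda>k. srw_p k (z - x) (0,0)) \<longlonglongrightarrow> 0" for x
    by (rule tendsto_sandwich [of "\<lambda>_. 0" _ _ "\<lambda>k. ret (k div 2)"])
       (auto simp: srw_p_nonneg srw_p_le_ret ret_div2_tendsto)
  hence "(\<lambda>k. \<Sum>x\<in>{x. pot x < R}. srw_p k (z - x) (0,0)) \<longlonglongrightarrow> (\<Sum>x\<in>{x. pot x < R}. 0)"
    by (intro tendsto_sum)
  hence "\<forall>\<^sub>F k in sequentially. (\<Sum>x\<in>{x. pot x < R}. srw_p k (z - x) (0,0)) < e / 2"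
    using e by (intro order_tendstoD) auto
  hence "\<forall>\<^sub>F k in sequentially. norm ((killed A ^^ k) (\<lambda>_. 1) z - 0) < e"
  proof eventually_elim
    case (elim k)
    have "(killed A ^^ k) (\<lambda>_. 0) z \<le> (killed A ^^ k) (\<lambda>_. 1) z" by (intro killed_pow_mono) simp
    moreover have "(killed A ^^ k) (\<lambda>_. 0) z = 0" using killed_pow_cmult[of k A 0 "\<lambda>_. 1"] by simp
    ultimately show ?case
      using killed_pow_one_le[OF assms R, of k z] elim \<open>pot z / R < e / 2\<close>
      unfolding real_norm_def by linarith
  qed
  thus "\<exists>no. \<forall>k\<ge>no. norm ((killed A ^^ k) (\<lambda>_. 1) z - 0) < e" by (simp add: eventually_sequentially)
qed

text \<open>Off \<open>A\<close> harmonicity, and on \<open>A\<close> the boundary values, give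
  \<open>U\<close> as the indicator of \<open>x\<close> plus \<open>killed A U\<close>. Iteration
  produces the partial sums of first-hit probabilities, and the remainder is at most
  \<open>C\<close> times the survival probability, which vanishes by recurrence.\<close>

lemma bounded_harmonic_extension:
  assumes A: "(0,0) \<in> A" and harm: "\<And>z. z \<notin> A \<Longrightarrow> step_avg U z = U z"
    and bd: "\<And>z. \<bar>U z\<bar> \<le> C" and x: "x \<in> A" and U: "\<And>z. z \<in> A \<Longrightarrow> U z = (if z = x then 1 else 0)"
  shows "(\<lambda>k. avoid_p A k z x) sums U z"
proof -
  let ?d = "\<lambda>z. if z = x then 1 else 0 :: real"
  have eq: "U z = (\<Sum>j<Suc k. avoid_p A j z x) + (killed A ^^ Suc k) U z" for k z
  proof -
    have U1: "U = (\<lambda>z. ?d z + killed A U z)"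
      using harm U x by (auto simp: fun_eq_iff killed_def)
    show ?thesis
    proof (induction k)
      case 0
      show ?case using fun_cong[OF U1, of z] by simp
    next
      case (Suc k)
      have "(killed A ^^ Suc k) U z = (killed A ^^ Suc k) (\<lambda>z. ?d z + killed A U z) z"
        using U1 by simp
      also have "\<dots> = avoid_p A (Suc k) z x + (killed A ^^ Suc (Suc k)) U z"
        unfolding killed_pow_add avoid_p_killed by (simp add: funpow_swap1)
      finally show ?case using Suc by simp
    qed
  qed
  have "(\<lambda>k. (killed A ^^ Suc k) U z) \<longlonglongrightarrow> 0"
  proof (rule tendsto_rabs_zero_cancel, rule tendsto_sandwich [of "\<lambda>_. 0"])
    show "\<forall>\<^sub>F k in sequentially. \<bar>(killed A ^^ Suc k) U z\<bar> \<le> C * (killed A ^^ Suc k) (\<lambda>_. 1) z"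
    proof (intro always_eventually allI)
      fix k
      have "(killed A ^^ Suc k) U z \<le> (killed A ^^ Suc k) (\<lambda>_. C * 1) z"
        using bd by (intro killed_pow_mono) (simp add: abs_le_iff)
      moreover have "(killed A ^^ Suc k) (\<lambda>_. - C * 1) z \<le> (killed A ^^ Suc k) U z"
        using bd by (intro killed_pow_mono) (simp add: abs_le_iff minus_le_iff)
      ultimately show "\<bar>(killed A ^^ Suc k) U z\<bar> \<le> C * (killed A ^^ Suc k) (\<lambda>_. 1) z"
        unfolding killed_pow_cmult by linarith
    qed
    show "(\<lambda>k. C * (killed A ^^ Suc k) (\<lambda>_. 1) z) \<longlonglongrightarrow> 0"
      using tendsto_mult[OF tendsto_const LIMSEQ_Suc[OF killed_pow_one_tendsto[OF A, of z]], of C] by simp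
  qed (auto intro: always_eventually)
  hence "(\<lambda>k. U z - (killed A ^^ Suc k) U z) \<longlonglongrightarrow> U z - 0" by (intro tendsto_intros)
  moreover have "U z - (killed A ^^ Suc k) U z = (\<Sum>j<Suc k. avoid_p A j z x)" for k
    using eq[of z k] by linarith
  ultimately have "(\<lambda>k. \<Sum>j<Suc k. avoid_p A j z x) \<longlonglongrightarrow> U z" by simp
  thus ?thesis unfolding sums_def by (rule LIMSEQ_imp_Suc)
qed

lemma bounded_of_tendsto_cofinite:
  fixes f :: "'a \<Rightarrow> real"
  assumes "(f \<longlongrightarrow> c) cofinite"
  shows "\<exists>C. \<forall>x. \<bar>f x\<bar> \<le> C"
proof -
  have "\<forall>\<^sub>F x in cofinite. dist (f x) c < 1" using assms by (rule tendstoD) simp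
  hence fin: "finite {x. \<not> dist (f x) c < 1}" by (simp add: eventually_cofinite)
  let ?C = "\<bar>c\<bar> + 1 + (\<Sum>x\<in>{x. \<not> dist (f x) c < 1}. \<bar>f x\<bar>)"
  have "\<bar>f x\<bar> \<le> ?C" for x
  proof (cases "dist (f x) c < 1")
    case True
    have "0 \<le> (\<Sum>x\<in>{x. \<not> dist (f x) c < 1}. \<bar>f x\<bar>)" by (intro sum_nonneg) auto
    thus ?thesis using True unfolding dist_real_def by linarith
  next
    case False
    hence "\<bar>f x\<bar> \<le> (\<Sum>x\<in>{x. \<not> dist (f x) c < 1}. \<bar>f x\<bar>)"
      using fin by (intro member_le_sum) auto
    thus ?thesis by linarith
  qed
  thus ?thesis by blast
qed

text \<open>The function \<open>U\<close> is harmonic off \<open>A\<close> and has the indicator of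
  \<open>x\<close> as boundary values. Because the weights have total zero, the growth of
  \<open>pot\<close> cancels: \<open>U\<close> is bounded and tends to \<open>c\<close>. It is
  therefore the hitting probability of \<open>x\<close>, and \<open>hit_dist\<close>, which requires
  at least one step, is its step average with the same limit.\<close>

lemma hm_eqI:
  assumes A: "finite A" "(0,0) \<in> A" and x: "x \<in> A"
    and v: "(\<Sum>z\<in>A. v z) = 0"
    and c: "\<And>y. y \<in> A \<Longrightarrow> c - (\<Sum>z\<in>A. pot (y - z) * v z) = (if y = x then 1 else 0)"
  shows "hm A x = c"
proof -
  define U where "U y = c - (\<Sum>z\<in>A. v z * pot (y - z))" for y
  have UA: "U y = (if y = x then 1 else 0)" if "y \<in> A" for y
    using c[OF that] by (simp add: U_def mult.commute)
  have harm: "step_avg U y = U y" if "y \<notin> A" for y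
  proof -
    have "step_avg U y = c - (\<Sum>z\<in>A. v z * step_avg pot (y - z))"
      unfolding U_def [abs_def] step_avg_diff step_avg_sum step_avg_cmult step_avg_shift by simp
    also have "\<dots> = U y"
    proof -
      have "y - z \<noteq> (0,0)" if "z \<in> A" for z
        using that \<open>y \<notin> A\<close> by (metis eq_iff_diff_eq_0 zero_prod_def)
      thus ?thesis unfolding U_def by (simp add: step_avg_pot)
    qed
    finally show ?thesis .
  qed
  have lim: "(U \<longlongrightarrow> c) cofinite"
  proof -
    have "((\<lambda>y. c - (\<Sum>z\<in>A. v z * (pot (y + (- z)) - pot y))) \<longlongrightarrow> c - (\<Sum>z\<in>A. v z * 0)) cofinite"
      by (intro tendsto_intros pot_shift_tendsto)
    moreover have "(\<Sum>z\<in>A. v z * (pot (y + (- z)) - pot y)) = (\<Sum>z\<in>A. v z * pot (y - z))" for y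
      using v by (simp add: right_diff_distrib sum_subtractf sum_distrib_right [symmetric])
    ultimately show ?thesis by (simp add: U_def [abs_def])
  qed
  obtain C where C: "\<And>z. \<bar>U z\<bar> \<le> C" using bounded_of_tendsto_cofinite[OF lim] by blast
  have sums: "(\<lambda>k. avoid_p A k z x) sums U z" for z
    by (rule bounded_harmonic_extension[OF A(2) harm C x UA])
  have "hit_dist A y x = (\<Sum>e\<in>steps. U (y + e)) / 4" for y
  proof -
    have "(\<lambda>k. (\<Sum>e\<in>steps. avoid_p A k (y + e) x) / 4) sums ((\<Sum>e\<in>steps. U (y + e)) / 4)"
      by (intro sums_divide sums_sum sums)
    thus ?thesis using x by (simp add: hit_dist_def sums_iff)
  qed
  moreover have "((\<lambda>y. (\<Sum>e\<in>steps. U (y + e)) / 4) \<longlongrightarrow> (\<Sum>e\<in>steps. c) / 4) cofinite"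
    by (intro tendsto_intros filterlim_compose[OF lim filterlim_shift_cofinite]) simp
  moreover have "(\<Sum>e\<in>steps. c) / 4 = c" by (simp add: sum_steps del: sum_constant)
  ultimately have "((\<lambda>y. hit_dist A y x) \<longlongrightarrow> c) cofinite" by (simp only:)
  \<comment> \<open>Makes \<open>cofinite\<close> a proper filter, so that \<open>Lim\<close> picks
    the unique limit.\<close>
  moreover have "infinite (UNIV :: (int \<times> int) set)" by (simp add: finite_prod)
  ultimately show ?thesis unfolding hm_def by (intro tendsto_Lim) (auto simp: cofinite_bot)
qed

text \<open>Solving a Dirichlet problem with data \<open>pot\<close> and adding a unit mass at the
  origin gives weights \<open>\<nu>\<close> of total 1 whose potential on \<open>A\<close> is a
  constant \<open>V\<close>. Pairing \<open>\<nu>\<close> with the Dirichlet solution for the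
  indicator of \<open>x\<close> shows that \<open>\<nu> x\<close> is the value of that solution at
  infinity, that is, harmonic measure. At the origin, \<open>V\<close> is the capacity.\<close>

lemma hm_equilibrium:
  assumes A: "finite A" "(0,0) \<in> A"
  shows "(\<Sum>x\<in>A. hm A x) = 1" "y \<in> A \<Longrightarrow> (\<Sum>x\<in>A. pot (y - x) * hm A x) = cap A"
proof -
  obtain V u where u: "(\<Sum>x\<in>A. u x) = 0" "\<And>y. y \<in> A \<Longrightarrow> V - (\<Sum>z\<in>A. pot (y - z) * u z) = pot y"
    using pot_dirichlet_solvable[OF A, of pot] by blast
  define \<nu> where "\<nu> z = u z + (if z = (0,0) then 1 else 0)" for z
  have \<nu>1: "(\<Sum>z\<in>A. \<nu> z) = 1" using u A by (simp add: \<nu>_def sum.distrib)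
  have \<nu>V: "(\<Sum>z\<in>A. pot (y - z) * \<nu> z) = V" if "y \<in> A" for y
  proof -
    have "(\<Sum>z\<in>A. pot (y - z) * \<nu> z)
        = (\<Sum>z\<in>A. pot (y - z) * u z) + (\<Sum>z\<in>A. if z = (0,0) then pot (y - z) else 0)"
      unfolding sum.distrib [symmetric] by (intro sum.cong) (auto simp: \<nu>_def algebra_simps)
    also have "\<dots> = (\<Sum>z\<in>A. pot (y - z) * u z) + pot (y - (0,0))" using A by simp
    also have "y - (0,0) = y" by (simp add: prod_eq_iff)
    finally show ?thesis using u(2)[OF that] by simp
  qed
  have hm: "hm A x = \<nu> x" if x: "x \<in> A" for x
  proof -
    obtain c v where cv: "(\<Sum>z\<in>A. v z) = 0"
      "\<And>y. y \<in> A \<Longrightarrow> c - (\<Sum>z\<in>A. pot (y - z) * v z) = (if y = x then 1 else 0)"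
      using pot_dirichlet_solvable[OF A, of "\<lambda>y. if y = x then 1 else 0"] by blast
    have "\<nu> x = (\<Sum>y\<in>A. if y = x then \<nu> y else 0)" using A x by simp
    also have "\<dots> = (\<Sum>y\<in>A. \<nu> y * (if y = x then 1 else 0))" by (intro sum.cong) auto
    also have "\<dots> = (\<Sum>y\<in>A. \<nu> y * (c - (\<Sum>z\<in>A. pot (y - z) * v z)))" using cv by simp
    also have "\<dots> = c * (\<Sum>y\<in>A. \<nu> y) - (\<Sum>y\<in>A. \<Sum>z\<in>A. \<nu> y * (pot (y - z) * v z))"
      by (simp add: right_diff_distrib sum_subtractf sum_distrib_left mult.commute)
    \<comment> \<open>By symmetry of the kernel the double sum is the total of \<open>v\<close>
      against the constant potential of \<open>\<nu>\<close>, hence zero.\<close>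
    also have "(\<Sum>y\<in>A. \<Sum>z\<in>A. \<nu> y * (pot (y - z) * v z)) = (\<Sum>z\<in>A. \<Sum>y\<in>A. \<nu> y * (pot (y - z) * v z))"
      by (rule sum.swap)
    also have "\<dots> = (\<Sum>z\<in>A. v z * (\<Sum>y\<in>A. pot (z - y) * \<nu> y))"
    proof -
      have "pot (y - z) = pot (z - y)" for y z using pot_minus[of "z - y"] by simp
      thus ?thesis by (simp add: sum_distrib_left ac_simps)
    qed
    also have "\<dots> = (\<Sum>z\<in>A. v z * V)" using \<nu>V by simp
    also have "\<dots> = 0" using cv(1) by (simp add: sum_distrib_right [symmetric])
    finally show ?thesis using \<nu>1 hm_eqI[OF A x cv] by simp
  qed
  show "(\<Sum>x\<in>A. hm A x) = 1" using \<nu>1 hm by simp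
  have V: "(\<Sum>x\<in>A. pot (y - x) * hm A x) = V" if "y \<in> A" for y
    using \<nu>V[OF that] hm by simp
  have "(0,0) - x = - x" for x :: "int \<times> int" by (simp add: prod_eq_iff)
  hence "cap A = V" using V[OF A(2)] by (simp add: cap_def pot_minus)
  thus "y \<in> A \<Longrightarrow> (\<Sum>x\<in>A. pot (y - x) * hm A x) = cap A" using V by simp
qed

section \<open>Lattice sums\<close>

text \<open>Mean value theorem for \<open>arctan (t / c)\<close>, whose derivative is
  \<open>c / (c^2 + t^2)\<close>; this is the integral comparison for a decreasing summand.\<close>

lemma arctan_step_bounds:
  fixes c :: real
  assumes c: "c > 0" and t: "t \<ge> 0"
  shows "1 / (c\<^sup>2 + (t + 1)\<^sup>2) \<le> (arctan ((t + 1) / c) - arctan (t / c)) / c"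
    and "(arctan ((t + 1) / c) - arctan (t / c)) / c \<le> 1 / (c\<^sup>2 + t\<^sup>2)"
proof -
  have "\<exists>z. z > t \<and> z < t + 1 \<and> arctan ((t + 1) / c) - arctan (t / c) = (t + 1 - t) * (c / (c\<^sup>2 + z\<^sup>2))"
  proof (rule MVT2)
    fix z
    have d: "((\<lambda>z. arctan (z / c)) has_real_derivative inverse (1 + (z / c)\<^sup>2) * (1 / c)) (at z)"
      using c by (auto intro!: derivative_eq_intros)
    have "inverse (1 + (z / c)\<^sup>2) * (1 / c) = c / (c\<^sup>2 + z\<^sup>2)"
      using c by (simp add: power_divide power2_eq_square field_simps)
    thus "((\<lambda>z. arctan (z / c)) has_real_derivative c / (c\<^sup>2 + z\<^sup>2)) (at z)" using d by simp
  qed simp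
  then obtain z where z: "t < z" "z < t + 1" "arctan ((t + 1) / c) - arctan (t / c) = c / (c\<^sup>2 + z\<^sup>2)"
    by auto
  have "t\<^sup>2 \<le> z\<^sup>2" "z\<^sup>2 \<le> (t + 1)\<^sup>2" using z t by (auto intro: power_mono)
  moreover have "c\<^sup>2 > 0" using c by simp
  ultimately have "1 / (c\<^sup>2 + (t + 1)\<^sup>2) \<le> 1 / (c\<^sup>2 + z\<^sup>2)" "1 / (c\<^sup>2 + z\<^sup>2) \<le> 1 / (c\<^sup>2 + t\<^sup>2)"
    by (intro divide_left_mono mult_pos_pos add_pos_nonneg; simp)+
  thus "1 / (c\<^sup>2 + (t + 1)\<^sup>2) \<le> (arctan ((t + 1) / c) - arctan (t / c)) / c"
    "(arctan ((t + 1) / c) - arctan (t / c)) / c \<le> 1 / (c\<^sup>2 + t\<^sup>2)"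
    unfolding z(3) using c by simp_all
qed

lemma arctan_sum_upper:
  fixes c :: real assumes c: "c > 0"
  shows "(\<Sum>j=1..R. 1 / (c\<^sup>2 + (real j)\<^sup>2)) \<le> arctan (real R / c) / c"
proof (induction R)
  case (Suc R)
  thus ?case using arctan_step_bounds(1)[OF c, of "real R"]
    by (simp add: diff_divide_distrib add.commute)
qed simp

lemma arctan_sum_lower:
  fixes c :: real assumes c: "c > 0"
  shows "arctan (real (Suc R) / c) / c \<le> (\<Sum>j=0..R. 1 / (c\<^sup>2 + (real j)\<^sup>2))"
proof (induction R)
  case 0
  show ?case using arctan_step_bounds(2)[OF c, of 0] by simp
next
  case (Suc R)
  thus ?case using arctan_step_bounds(2)[OF c, of "real (Suc R)"]
    by (simp add: diff_divide_distrib add.commute)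
qed

lemma arctan_ge: "x > 0 \<Longrightarrow> pi / 2 - 1 / x \<le> arctan x"
proof -
  assume x: "x > 0"
  \<comment> \<open>The step bound on the unit interval from 0 with \<open>c = x\<close> amounts to
    \<open>arctan (1 / x) <= 1 / x\<close>.\<close>
  have "arctan (1 / x) / x \<le> 1 / (x * x)"
    using arctan_step_bounds(2)[OF x, of 0] by (simp add: power2_eq_square)
  hence "arctan (1 / x) / x * x \<le> 1 / (x * x) * x" using x by (intro mult_right_mono) auto
  hence "arctan (1 / x) \<le> 1 / x" using x by simp
  moreover have "arctan (1 / x) = pi / 2 - arctan x"
    using arctan_inverse[of x] x by (simp add: inverse_eq_divide)
  ultimately show ?thesis by linarith
qed

lemma sum_inverse_squares_le: "(\<Sum>j=1..R. 1 / (real j)\<^sup>2) \<le> 2"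
proof -
  have "(\<Sum>j=1..R. 1 / (real j)\<^sup>2) \<le> 2 - 1 / real R" if "R \<ge> 1" for R
    using that
  proof (induction R rule: dec_induct)
    case (step m)
    have "1 / (real (Suc m))\<^sup>2 \<le> 1 / (real m * real (Suc m))"
      using step by (intro divide_left_mono) (auto simp: power2_eq_square)
    also have "\<dots> = 1 / real m - 1 / real (Suc m)" using step by (simp add: field_simps)
    finally show ?case using step by simp
  qed simp
  from this[of R] show ?thesis by (cases "R \<ge> 1") (auto intro: order_trans simp: not_le)
qed

definition lattice_row :: "nat \<Rightarrow> int \<Rightarrow> real" where
  "lattice_row n i = (\<Sum>j\<in>freq1 n. 1 / ((of_int i)\<^sup>2 + (of_int j)\<^sup>2))"

lemma lattice_row_minus: "lattice_row n (- i) = lattice_row n i"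
  by (simp add: lattice_row_def)

lemma lattice_row_nonneg: "lattice_row n i \<ge> 0"
  unfolding lattice_row_def by (intro sum_nonneg) auto

lemma lattice_row_upper:
  assumes "i \<ge> 1"
  shows "lattice_row n (int i) \<le> 1 / (real i)\<^sup>2 + pi / real i"
proof -
  have "lattice_row n (int i) \<le> 1 / (real i)\<^sup>2 + 2 * (\<Sum>j=1..n. 1 / ((real i)\<^sup>2 + (real j)\<^sup>2))"
    using sum_freq1_le[of "\<lambda>j. 1 / ((real i)\<^sup>2 + (of_int j)\<^sup>2)" n] by (simp add: lattice_row_def)
  also have "(\<Sum>j=1..n. 1 / ((real i)\<^sup>2 + (real j)\<^sup>2)) \<le> arctan (real n / real i) / real i"
    using assms by (intro arctan_sum_upper) auto
  also have "\<dots> \<le> (pi / 2) / real i"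
    using arctan_ubound[of "real n / real i"] by (intro divide_right_mono) auto
  finally show ?thesis by simp
qed

lemma lattice_row_zero_upper: "lattice_row n 0 \<le> 4"
proof -
  have "lattice_row n 0 \<le> 0 + 2 * (\<Sum>j=1..n. 1 / (real j)\<^sup>2)"
    using sum_freq1_le[of "\<lambda>j. 1 / (of_int j)\<^sup>2" n] by (simp add: lattice_row_def)
  thus ?thesis using sum_inverse_squares_le[of n] by simp
qed

text \<open>The symmetric row is twice the sum from \<open>j = 0\<close> minus the central term
  \<open>1 / i^2\<close>. The loss \<open>2 / (R + 1)\<close> is twice the shortfall of the
  arctangent from \<open>\<pi> / 2\<close>, divided by \<open>i\<close>.\<close>

lemma lattice_row_lower:
  assumes "i \<ge> 1" "n > 0" "R = (n - 1) div 2"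
  shows "pi / real i - 2 / real (Suc R) - 1 / (real i)\<^sup>2 \<le> lattice_row n (int i)"
proof -
  let ?f = "\<lambda>j. 1 / ((real i)\<^sup>2 + (of_int j)\<^sup>2)"
  have "(\<Sum>j\<in>{- int R..int R}. ?f j) \<le> lattice_row n (int i)"
    unfolding lattice_row_def of_int_of_nat_eq using freq1_supset[OF assms(2)] assms(3) by (intro sum_mono2) auto
  hence "1 / (real i)\<^sup>2 + 2 * (\<Sum>j=1..R. 1 / ((real i)\<^sup>2 + (real j)\<^sup>2)) \<le> lattice_row n (int i)"
    using sum_symmetric_interval[of ?f R] by simp
  moreover have "(\<Sum>j=0..R. 1 / ((real i)\<^sup>2 + (real j)\<^sup>2))
      = 1 / (real i)\<^sup>2 + (\<Sum>j=1..R. 1 / ((real i)\<^sup>2 + (real j)\<^sup>2))"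
    by (simp add: sum.atLeast_Suc_atMost)
  moreover have "arctan (real (Suc R) / real i) / real i \<le> (\<Sum>j=0..R. 1 / ((real i)\<^sup>2 + (real j)\<^sup>2))"
    using assms by (intro arctan_sum_lower) auto
  moreover have "(pi / 2 - 1 / (real (Suc R) / real i)) / real i \<le> arctan (real (Suc R) / real i) / real i"
    using assms by (intro divide_right_mono arctan_ge) auto
  moreover have "2 * ((pi / 2 - 1 / (real (Suc R) / real i)) / real i) = pi / real i - 2 / real (Suc R)"
    using assms by (simp add: diff_divide_distrib)
  ultimately show ?thesis by linarith
qed

text \<open>The row sums include the zero frequency, which contributes \<open>1 / 0 = 0\<close>.\<close>

lemma sum_inverse_nsq: "(\<Sum>k\<in>nzf n. 1 / nsq k) = (\<Sum>i\<in>freq1 n. lattice_row n i)"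
proof -
  have "(\<Sum>k\<in>nzf n. 1 / nsq k) = (\<Sum>k\<in>freq n. 1 / nsq k)"
    by (rule sum.mono_neutral_left) (auto simp: nzf_def nsq_def)
  thus ?thesis unfolding freq_def lattice_row_def nsq_def sum.cartesian_product by (simp add: case_prod_beta)
qed

lemma harm_upper: "n \<ge> 1 \<Longrightarrow> harm n \<le> 1 + ln (real n)"
proof (induction n rule: dec_induct)
  case base
  show ?case by (simp add: harm_def)
next
  case (step m)
  have "ln (real m / real (Suc m)) \<le> real m / real (Suc m) - 1" using step by (intro ln_le_minus_one) auto
  also have "\<dots> = - inverse (real (Suc m))" using step by (simp add: field_simps)
  finally have "inverse (real (Suc m)) \<le> ln (real (Suc m)) - ln (real m)"
    using step by (simp add: ln_div)
  thus ?case using step by (simp add: harm_Suc)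
qed

lemma sum_inverse_harm: "(\<Sum>i=1..n. 1 / real i) = harm n"
  by (simp add: harm_def field_simps)

text \<open>Row \<open>i\<close> is \<open>\<pi> / \<bar>i\<bar>\<close> up to a summable error, and
  the rows on both sides of zero give \<open>2 \<pi> ln n\<close>.\<close>

lemma sum_inverse_nsq_upper:
  assumes "n \<ge> 1"
  shows "(\<Sum>k\<in>nzf n. 1 / nsq k) \<le> 2 * pi * ln (real n) + (8 + 2 * pi)"
proof -
  have "(\<Sum>i\<in>freq1 n. lattice_row n i) \<le> lattice_row n 0 + 2 * (\<Sum>i=1..n. lattice_row n (int i))"
    by (rule sum_freq1_le) (simp_all add: lattice_row_minus lattice_row_nonneg)
  also have "\<dots> \<le> 4 + 2 * (\<Sum>i=1..n. 1 / (real i)\<^sup>2 + pi * (1 / real i))"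
    using lattice_row_zero_upper lattice_row_upper by (intro add_mono mult_left_mono sum_mono) auto
  also have "(\<Sum>i=1..n. 1 / (real i)\<^sup>2 + pi * (1 / real i)) = (\<Sum>i=1..n. 1 / (real i)\<^sup>2) + pi * harm n"
    unfolding sum.distrib sum_distrib_left [symmetric] sum_inverse_harm ..
  also have "4 + 2 * \<dots> \<le> 4 + 2 * (2 + pi * (1 + ln (real n)))"
    using sum_inverse_squares_le harm_upper[OF assms] by (intro add_mono mult_left_mono) auto
  finally show ?thesis unfolding sum_inverse_nsq by (simp add: algebra_simps)
qed

lemma sum_inverse_nsq_lower:
  assumes "n \<ge> 1"
  shows "2 * pi * (ln (real n) - ln 2) - 8 \<le> (\<Sum>k\<in>nzf n. 1 / nsq k)"
proof -
  define R where "R = (n - 1) div 2"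
  \<comment> \<open>The full symmetric range of rows reaches only about \<open>n / 2\<close>, which
    costs the \<open>ln 2\<close>.\<close>
  have "n \<le> 2 * (R + 1)" unfolding R_def using assms by presburger
  hence "real n \<le> real (2 * (R + 1))" by (simp only: of_nat_le_iff)
  hence nR: "real n \<le> 2 * (real R + 1)" by simp
  have "ln (real n) \<le> ln (2 * (real R + 1))" using assms nR by simp
  also have "\<dots> = ln 2 + ln (real R + 1)" by (subst ln_mult) auto
  finally have h: "ln (real n) - ln 2 \<le> harm R" using ln_le_harm[of R] by linarith
  have "(\<Sum>i\<in>{- int R..int R}. lattice_row n i) \<le> (\<Sum>i\<in>freq1 n. lattice_row n i)"
    using freq1_supset[of n] assms by (intro sum_mono2) (auto simp: R_def lattice_row_nonneg)
  hence "lattice_row n 0 + 2 * (\<Sum>i=1..R. lattice_row n (int i)) \<le> (\<Sum>i\<in>freq1 n. lattice_row n i)"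
    using sum_symmetric_interval[of "lattice_row n" R] by (simp add: lattice_row_minus)
  hence A: "2 * (\<Sum>i=1..R. lattice_row n (int i)) \<le> (\<Sum>i\<in>freq1 n. lattice_row n i)"
    using lattice_row_nonneg[of n 0] by linarith
  have "(\<Sum>i=1..R. pi * (1 / real i) - 2 / real (Suc R) - 1 / (real i)\<^sup>2) \<le> (\<Sum>i=1..R. lattice_row n (int i))"
  proof (rule sum_mono)
    fix i assume "i \<in> {1..R}"
    hence "pi / real i - 2 / real (Suc R) - 1 / (real i)\<^sup>2 \<le> lattice_row n (int i)"
      using assms by (intro lattice_row_lower) (auto simp: R_def)
    thus "pi * (1 / real i) - 2 / real (Suc R) - 1 / (real i)\<^sup>2 \<le> lattice_row n (int i)"
      unfolding times_divide_eq_right mult_1_right .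
  qed
  moreover have "(\<Sum>i=1..R. pi * (1 / real i) - 2 / real (Suc R) - 1 / (real i)\<^sup>2)
      = pi * harm R - real R * (2 / real (Suc R)) - (\<Sum>i=1..R. 1 / (real i)\<^sup>2)"
    unfolding sum_subtractf sum_distrib_left [symmetric] sum_inverse_harm by simp
  moreover have "real R * (2 / real (Suc R)) \<le> 2" by (simp add: field_simps)
  moreover have "pi * (ln (real n) - ln 2) \<le> pi * harm R" using h by (intro mult_left_mono) auto
  ultimately have "pi * (ln (real n) - ln 2) - 4 \<le> (\<Sum>i=1..R. lattice_row n (int i))"
    using sum_inverse_squares_le[of R] by linarith
  thus ?thesis using A unfolding sum_inverse_nsq by linarith
qed

section \<open>Size of the Green function\<close>

text \<open>Replacing squared sines by squared angles changes each reciprocal by a bounded amount: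
  with \<open>X\<close> the squared angles and \<open>S\<close> the symbol,
  \<open>1/S - 1/X = (X - S) / (S X)\<close>, where \<open>X - S <= X^2 / 3\<close> and
  \<open>X <= 4 S\<close>.\<close>

lemma inverse_one_minus_mu:
  assumes k: "k \<in> nzf n"
  shows "(real n)\<^sup>2 / pi\<^sup>2 * (1 / nsq k) \<le> 1 / (1 - mu n k)"
    and "1 / (1 - mu n k) \<le> (real n)\<^sup>2 / pi\<^sup>2 * (1 / nsq k) + 4 / 3"
proof -
  have n: "n > 0" using k by (cases n) (auto simp: nzf_def freq_def freq1_def)
  have kf: "k \<in> freq n" using k by (simp add: nzf_def)
  let ?a = "pi * of_int (fst k) / real n" and ?b = "pi * of_int (snd k) / real n"
  define X where "X = ?a\<^sup>2 + ?b\<^sup>2"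
  define S where "S = 1 - mu n k"
  have S: "S = (sin ?a)\<^sup>2 + (sin ?b)\<^sup>2" unfolding S_def by (rule one_minus_mu)
  have Sp: "S > 0" unfolding S_def using k by (rule one_minus_mu_pos)
  have XN: "1 / X = (real n)\<^sup>2 / pi\<^sup>2 * (1 / nsq k)"
  proof -
    have "X = pi\<^sup>2 / (real n)\<^sup>2 * nsq k"
      unfolding X_def nsq_def by (simp add: power_divide power_mult_distrib distrib_left)
    thus ?thesis by simp
  qed
  have "\<bar>sin ?a\<bar> \<le> \<bar>?a\<bar>" "\<bar>sin ?b\<bar> \<le> \<bar>?b\<bar>" by (rule abs_sin_x_le_abs_x)+
  hence "(sin ?a)\<^sup>2 \<le> ?a\<^sup>2" "(sin ?b)\<^sup>2 \<le> ?b\<^sup>2" by (simp_all only: abs_le_square_iff)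
  hence SX: "S \<le> X" unfolding S X_def by linarith
  have b: "?a\<^sup>2 / 4 \<le> (sin ?a)\<^sup>2" "?b\<^sup>2 / 4 \<le> (sin ?b)\<^sup>2"
    "?a\<^sup>2 - (sin ?a)\<^sup>2 \<le> ?a ^ 4 / 3" "?b\<^sup>2 - (sin ?b)\<^sup>2 \<le> ?b ^ 4 / 3"
    using sin_squared_bounds freq_angle_le[OF kf n] by blast+
  have X4: "X \<le> 4 * S" using b(1,2) unfolding S X_def by simp
  have "?a ^ 4 + ?b ^ 4 \<le> X\<^sup>2" unfolding X_def
    by (simp add: power2_sum flip: power_mult)
  hence XS: "X - S \<le> X\<^sup>2 / 3" using b unfolding X_def [symmetric] S by (simp add: X_def)
  show "(real n)\<^sup>2 / pi\<^sup>2 * (1 / nsq k) \<le> 1 / (1 - mu n k)"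
    unfolding XN [symmetric] S_def [symmetric] using SX Sp by (intro divide_left_mono) auto
  have Xp: "X > 0" using SX Sp by linarith
  have "1 / S - 1 / X = (X - S) / (S * X)" using Sp Xp by (simp add: field_simps)
  also have "\<dots> \<le> (X\<^sup>2 / 3) / (S * X)" using XS Sp Xp by (intro divide_right_mono) auto
  also have "\<dots> = X / (3 * S)" using Xp Sp by (simp add: power2_eq_square)
  also have "\<dots> \<le> 4 / 3" using X4 Sp by (simp add: field_simps)
  finally show "1 / (1 - mu n k) \<le> (real n)\<^sup>2 / pi\<^sup>2 * (1 / nsq k) + 4 / 3"
    unfolding XN [symmetric] S_def [symmetric] by linarith
qed

text \<open>The factor \<open>2 \<pi>\<close> of the lattice sum divided by \<open>\<pi>^2\<close>
  is the leading constant \<open>2 / \<pi>\<close>. The errors 3 and 4 are generous roundings of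
  bounded terms.\<close>

lemma green_zero_bounds:
  assumes n: "n \<ge> 1"
  shows "2 / pi * ln (real n) - 3 \<le> green n (0,0)" "green n (0,0) \<le> 2 / pi * ln (real n) + 4"
proof -
  let ?L = "\<Sum>k\<in>nzf n. 1 / nsq k"
  have n2: "(real n)\<^sup>2 > 0" using n by simp
  have g: "green n (0,0) = (\<Sum>k\<in>nzf n. 1 / (1 - mu n k)) / (real n)\<^sup>2" by (simp add: green_def)
  have cardn: "real (card (nzf n)) \<le> (real n)\<^sup>2"
    using card_mono[of "freq n" "nzf n"] by (simp add: nzf_def card_freq flip: of_nat_power)
  have "(\<Sum>k\<in>nzf n. (real n)\<^sup>2 / pi\<^sup>2 * (1 / nsq k)) \<le> (\<Sum>k\<in>nzf n. 1 / (1 - mu n k))"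
    by (intro sum_mono inverse_one_minus_mu)
  hence "((real n)\<^sup>2 / pi\<^sup>2 * ?L) / (real n)\<^sup>2 \<le> green n (0,0)"
    unfolding g sum_distrib_left [symmetric] by (rule divide_right_mono) simp
  hence lo: "?L / pi\<^sup>2 \<le> green n (0,0)" using n by simp
  have "(\<Sum>k\<in>nzf n. 1 / (1 - mu n k)) \<le> (\<Sum>k\<in>nzf n. (real n)\<^sup>2 / pi\<^sup>2 * (1 / nsq k) + 4 / 3)"
    by (intro sum_mono inverse_one_minus_mu)
  also have "\<dots> = (real n)\<^sup>2 / pi\<^sup>2 * ?L + real (card (nzf n)) * (4 / 3)"
    by (simp add: sum.distrib sum_distrib_left)
  also have "\<dots> \<le> (real n)\<^sup>2 / pi\<^sup>2 * ?L + (real n)\<^sup>2 * (4 / 3)"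
    using cardn by (intro add_left_mono mult_right_mono) auto
  also have "\<dots> = (?L / pi\<^sup>2 + 4 / 3) * (real n)\<^sup>2" by (simp add: algebra_simps)
  finally have up: "green n (0,0) \<le> ?L / pi\<^sup>2 + 4 / 3" unfolding g using n2 by (simp add: divide_le_eq)
  have pi9: "9 \<le> pi\<^sup>2" using power_mono[of 3 pi 2] pi_gt3 by simp
  have "?L / pi\<^sup>2 \<le> (2 * pi * ln (real n) + (8 + 2 * pi)) / pi\<^sup>2"
    using sum_inverse_nsq_upper[OF n] by (intro divide_right_mono) auto
  also have "\<dots> = 2 / pi * ln (real n) + 8 / pi\<^sup>2 + 2 / pi"
    by (simp add: field_simps power2_eq_square)
  also have "\<dots> \<le> 2 / pi * ln (real n) + 8 / 9 + 2 / 3"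
    using pi9 pi_gt3 by (intro add_mono divide_left_mono order_refl) auto
  finally show "green n (0,0) \<le> 2 / pi * ln (real n) + 4" using up by linarith
  have "ln 2 \<le> (1::real)" using ln_le_minus_one[of "2::real"] by simp
  hence "2 * pi * ln 2 \<le> 2 * pi" by simp
  hence "2 * pi * ln (real n) - (2 * pi + 8) \<le> ?L"
    using sum_inverse_nsq_lower[OF n] unfolding right_diff_distrib by linarith
  hence "(2 * pi * ln (real n) - (2 * pi + 8)) / pi\<^sup>2 \<le> ?L / pi\<^sup>2" by (intro divide_right_mono) auto
  moreover have "(2 * pi * ln (real n) - (2 * pi + 8)) / pi\<^sup>2 = 2 / pi * ln (real n) - (8 / pi\<^sup>2 + 2 / pi)"
    by (simp add: field_simps power2_eq_square)
  moreover have "8 / pi\<^sup>2 + 2 / pi \<le> 8 / 9 + 2 / 3"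
    using pi9 pi_gt3 by (intro add_mono divide_left_mono) auto
  ultimately show "2 / pi * ln (real n) - 3 \<le> green n (0,0)" using lo by linarith
qed

text \<open>With exponent 2 the factored sums converge: each coordinate contributes at most 5, and
  \<open>25 / 4\<close> is rounded up to 7.\<close>

lemma sum_inverse_one_minus_mu_squared:
  assumes n: "n > 0"
  shows "(\<Sum>k\<in>nzf n. 1 / (1 - mu n k)\<^sup>2) / (real n)\<^sup>2 \<le> 7 * (real n)\<^sup>2"
proof -
  let ?q = "\<lambda>i. 1 / (pos1 i)\<^sup>2"
  have p1: "pos1 i \<ge> 1" for i by (simp add: pos1_def)
  have "(\<Sum>i\<in>freq1 n. ?q i) \<le> ?q 0 + 2 * (\<Sum>j=1..n. ?q (int j))"
    by (rule sum_freq1_le) (auto simp: pos1_def)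
  also have "(\<Sum>j=1..n. ?q (int j)) = (\<Sum>j=1..n. 1 / (real j)\<^sup>2)"
    by (intro sum.cong) (auto simp: pos1_def)
  also have "?q 0 + 2 * (\<Sum>j=1..n. 1 / (real j)\<^sup>2) \<le> 5"
    using sum_inverse_squares_le[of n] by (simp add: pos1_def)
  finally have S: "(\<Sum>i\<in>freq1 n. ?q i) \<le> 5" .
  have "(\<Sum>k\<in>nzf n. 1 / (1 - mu n k)\<^sup>2) \<le> (\<Sum>k\<in>nzf n. (real n) ^ 4 / 4 * (?q (fst k) * ?q (snd k)))"
  proof (rule sum_mono)
    fix k assume k: "k \<in> nzf n"
    have "2 * (pos1 (fst k) * pos1 (snd k)) / (real n)\<^sup>2 \<le> 2 * nsq k / (real n)\<^sup>2"
      using k by (intro divide_right_mono mult_left_mono nsq_ge_pos1) (auto simp: nzf_def)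
    also have "\<dots> \<le> 1 - mu n k" using k n by (intro nsq_le_one_minus_mu) (auto simp: nzf_def)
    finally have le: "2 * (pos1 (fst k) * pos1 (snd k)) / (real n)\<^sup>2 \<le> 1 - mu n k" .
    have pp: "0 < 2 * (pos1 (fst k) * pos1 (snd k)) / (real n)\<^sup>2"
      using p1[of "fst k"] p1[of "snd k"] n by (intro divide_pos_pos mult_pos_pos) auto
    hence "1 / (1 - mu n k)\<^sup>2 \<le> 1 / (2 * (pos1 (fst k) * pos1 (snd k)) / (real n)\<^sup>2)\<^sup>2"
      using le by (intro divide_left_mono power_mono mult_pos_pos zero_less_power) auto
    thus "1 / (1 - mu n k)\<^sup>2 \<le> (real n) ^ 4 / 4 * (?q (fst k) * ?q (snd k))"
      by (simp add: power_divide power_mult_distrib flip: power_mult)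
  qed
  also have "\<dots> \<le> (\<Sum>k\<in>freq n. (real n) ^ 4 / 4 * (?q (fst k) * ?q (snd k)))"
    by (intro sum_mono2) (auto simp: nzf_def)
  also have "\<dots> = (real n) ^ 4 / 4 * ((\<Sum>i\<in>freq1 n. ?q i) * (\<Sum>i\<in>freq1 n. ?q i))"
    unfolding freq_def sum_product sum.cartesian_product
    by (simp only: sum_distrib_left case_prod_beta)
  also have "\<dots> \<le> (real n) ^ 4 / 4 * (5 * 5)"
    using S by (intro mult_left_mono mult_mono sum_nonneg) auto
  also have "\<dots> \<le> 7 * (real n)\<^sup>2 * (real n)\<^sup>2" by (simp flip: power_add)
  finally show ?thesis using n by (simp add: divide_le_eq)
qed

section \<open>Functions on the torus\<close>

text \<open>Functions on the torus are encoded as periodic functions on the plane, so that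
  \<open>step_avg\<close> and translations apply without reduction modulo \<open>n\<close>.\<close>

definition periodic :: "nat \<Rightarrow> (int \<times> int \<Rightarrow> real) \<Rightarrow> bool" where
  "periodic n f \<longleftrightarrow> (\<forall>x. f (proj n x) = f x)"

lemma periodicD: "periodic n f \<Longrightarrow> f (proj n x) = f x"
  by (simp only: periodic_def)

lemma proj_in_torus: "n > 0 \<Longrightarrow> proj n x \<in> torus n"
  by (simp add: proj_def torus_def)

lemma proj_torus: "x \<in> torus n \<Longrightarrow> proj n x = x"
  by (auto simp: proj_def torus_def)

lemma proj_add_left: "proj n (proj n x + y) = proj n (x + y)"
  by (simp add: proj_def mod_add_left_eq)

lemma proj_eq_iff: "proj n x = proj n y \<longleftrightarrow> proj n (x - y) = (0,0)"
  by (auto simp: proj_def mod_eq_dvd_iff dvd_eq_mod_eq_0)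

lemma periodic_comp_add: "periodic n f \<Longrightarrow> periodic n (\<lambda>x. f (x + y))"
  unfolding periodic_def by (metis proj_add_left)

lemma periodic_step_avg: "periodic n f \<Longrightarrow> periodic n (step_avg f)"
  using periodic_comp_add unfolding periodic_def step_avg_def by (auto intro!: sum.cong)

lemma sum_torus_shift:
  assumes n: "n > 0" and f: "periodic n f"
  shows "(\<Sum>x\<in>torus n. f (x + y)) = (\<Sum>x\<in>torus n. f x)"
proof (rule sum.reindex_bij_witness[of _ "\<lambda>x. proj n (x + (- y))" "\<lambda>x. proj n (x + y)"])
  fix x assume x: "x \<in> torus n"
  show "proj n (proj n (x + y) + - y) = x" "proj n (proj n (x + - y) + y) = x"
    unfolding proj_add_left using x by (simp_all add: proj_torus add.assoc)
  show "proj n (x + y) \<in> torus n" "proj n (x + - y) \<in> torus n" using n by (simp_all add: proj_in_torus)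
  show "f (proj n (x + y)) = f (x + y)" by (rule periodicD[OF f])
qed

lemma sum_torus_step_avg:
  assumes "n > 0" "periodic n f"
  shows "(\<Sum>x\<in>torus n. step_avg f x) = (\<Sum>x\<in>torus n. f x)"
  unfolding step_avg_eq sum_divide_distrib [symmetric] sum.distrib
  by (simp add: sum_torus_shift[OF assms])

text \<open>Translating the summation variable moves a step from one function to the other with
  opposite sign, and the set of steps is closed under negation.\<close>

lemma sum_torus_step_avg_sym:
  assumes n: "n > 0" and f: "periodic n f" and g: "periodic n g"
  shows "(\<Sum>x\<in>torus n. f x * step_avg g x) = (\<Sum>x\<in>torus n. step_avg f x * g x)"
proof -
  have *: "(\<Sum>x\<in>torus n. f x * g (x + e)) = (\<Sum>x\<in>torus n. f (x + - e) * g x)" for e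
  proof -
    have "periodic n (\<lambda>x. f (x + - e) * g x)"
      using periodic_comp_add[OF f, of "- e"] g by (simp add: periodic_def)
    from sum_torus_shift[OF n this, of e] show ?thesis by (simp add: add.assoc)
  qed
  have "(\<Sum>x\<in>torus n. f x * step_avg g x) = (\<Sum>e\<in>steps. \<Sum>x\<in>torus n. f x * g (x + e)) / 4"
    unfolding step_avg_def sum_distrib_left times_divide_eq_right sum_divide_distrib [symmetric]
    by (subst sum.swap) simp
  also have "\<dots> = (\<Sum>e\<in>steps. \<Sum>x\<in>torus n. f (x + - e) * g x) / 4" unfolding * ..
  also have "\<dots> = (\<Sum>e\<in>steps. \<Sum>x\<in>torus n. f (x + e) * g x) / 4"
    unfolding sum_steps uminus_Pair by simp
  also have "\<dots> = (\<Sum>x\<in>torus n. step_avg f x * g x)"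
    unfolding step_avg_def times_divide_eq_left sum_distrib_right sum_divide_distrib [symmetric]
    by (subst sum.swap) simp
  finally show ?thesis .
qed

lemma cos_ang_proj: "n > 0 \<Longrightarrow> cos (ang n k (proj n x)) = cos (ang n k x)"
proof -
  assume n: "n > 0"
  define q where "q = fst k * (fst x div int n) + snd k * (snd x div int n)"
  have "real_of_int (fst x) = of_int (fst x mod int n) + real n * of_int (fst x div int n)"
    "real_of_int (snd x) = of_int (snd x mod int n) + real n * of_int (snd x div int n)"
    by (metis mod_mult_div_eq of_int_add of_int_mult of_int_of_nat_eq)+
  hence "ang n k x = ang n k (proj n x) + 2 * pi * of_int q"
    using n unfolding ang_def proj_def q_def by (simp add: field_simps)
  thus ?thesis by (simp add: cos_add)
qed

lemma periodic_green: "n > 0 \<Longrightarrow> periodic n (green n)"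
  by (simp add: periodic_def green_def cos_ang_proj)

lemma periodic_green_diff: "n > 0 \<Longrightarrow> periodic n (green_diff n)"
  using periodic_green[of n] by (simp add: periodic_def green_diff_def)

lemma periodic_reflect: 
  assumes "periodic n f"
  shows "periodic n (\<lambda>y. f (x - y))"
  unfolding periodic_def
proof
  fix y
  have "proj n (x - proj n y) = proj n (x - y)"
    by (simp add: proj_def mod_diff_right_eq)
  thus "f (x - proj n y) = f (x - y)" using assms by (metis periodicD)
qed

lemma sum_torus_delta:
  assumes n: "n > 0" and f: "periodic n f"
  shows "(\<Sum>y\<in>torus n. f y * (if proj n (x - y) = (0,0) then c else 0)) = c * f x"
proof -
  have "(\<Sum>y\<in>torus n. f y * (if proj n (x - y) = (0,0) then c else 0))
      = (\<Sum>y\<in>torus n. if y = proj n x then c * f y else 0)"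
    using proj_torus by (intro sum.cong) (auto simp: proj_eq_iff [symmetric])
  also have "\<dots> = c * f (proj n x)" using proj_in_torus[OF n, of x] by simp
  finally show ?thesis by (simp add: periodicD[OF f])
qed

lemma step_avg_reflect: "step_avg (\<lambda>y. f (x - y)) y = step_avg f (x - y)"
proof -
  have "x - (y + (a, b)) = x - y + (- a, - b)" for a b by (simp add: prod_eq_iff)
  note * = this[of 1 0] this[of "-1" 0] this[of 0 1] this[of 0 "-1"]
  show ?thesis unfolding step_avg_eq * by simp
qed

section \<open>Green representation and spectral gap\<close>

text \<open>Summation by parts puts \<open>I - step_avg\<close> on the Green function, where it
  produces the point mass minus the mean.\<close>

lemma green_representation:
  assumes n: "n > 0" and f: "periodic n f"
  shows "f x - (\<Sum>y\<in>torus n. f y) / (real n)\<^sup>2 = (\<Sum>y\<in>torus n. green n (x - y) * (f y - step_avg f y))"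
proof -
  have p: "periodic n (\<lambda>y. green n (x - y))" by (intro periodic_reflect periodic_green n)
  have "(\<Sum>y\<in>torus n. green n (x - y) * (f y - step_avg f y))
      = (\<Sum>y\<in>torus n. (green n (x - y) - step_avg (green n) (x - y)) * f y)"
    using sum_torus_step_avg_sym[OF n p f]
    by (simp add: right_diff_distrib left_diff_distrib sum_subtractf step_avg_reflect)
  also have "\<dots> = (\<Sum>y\<in>torus n. f y * (if proj n (x - y) = (0,0) then 1 else 0) - f y / (real n)\<^sup>2)"
    unfolding green_step[OF n] by (intro sum.cong) (auto simp: algebra_simps)
  also have "\<dots> = f x - (\<Sum>y\<in>torus n. f y) / (real n)\<^sup>2"
    using sum_torus_delta[OF n f, of x 1] by (simp add: sum_subtractf sum_divide_distrib)
  finally show ?thesis ..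
qed

lemma sum_torus_green: "n > 0 \<Longrightarrow> (\<Sum>x\<in>torus n. green n x) = 0"
proof -
  assume n: "n > 0"
  have "(\<Sum>x\<in>torus n. green n x) = (\<Sum>k\<in>nzf n. (\<Sum>x\<in>torus n. cos (ang n k x)) / (1 - mu n k)) / (real n)\<^sup>2"
    unfolding green_def sum_divide_distrib [symmetric] by (subst sum.swap) (simp add: sum_divide_distrib)
  also have "\<dots> = 0" using proj_nzf by (simp add: sum_cos_torus[OF n])
  finally show ?thesis .
qed

text \<open>The function \<open>G\<close> is the Green operator applied to \<open>green\<close>, and
  it has mean zero. Its value at the origin, computed through the representation formula, is the sum
  of squares; computed from its own series, it is the lattice sum with exponent 2.\<close>

lemma sum_torus_green_squared:
  assumes n: "n > 0"
  shows "(\<Sum>y\<in>torus n. (green n (x - y))\<^sup>2) \<le> 7 * (real n)\<^sup>2"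
proof -
  define G where "G x = (\<Sum>k\<in>nzf n. 1 / ((1 - mu n k)\<^sup>2 * (real n)\<^sup>2) * cos (ang n k x))" for x
  have pG: "periodic n G" by (simp add: periodic_def G_def cos_ang_proj[OF n])
  have "G x - step_avg G x = green n x" for x
  proof -
    have "step_avg G x = (\<Sum>k\<in>nzf n. 1 / ((1 - mu n k)\<^sup>2 * (real n)\<^sup>2) * (mu n k * cos (ang n k x)))"
      unfolding G_def [abs_def] step_avg_sum step_avg_cmult step_avg_cos ..
    hence "G x - step_avg G x
        = (\<Sum>k\<in>nzf n. 1 / ((1 - mu n k)\<^sup>2 * (real n)\<^sup>2) * ((1 - mu n k) * cos (ang n k x)))"
      unfolding G_def by (simp only: sum_subtractf [symmetric] left_diff_distrib right_diff_distrib mult_1_left)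
    also have "\<dots> = (\<Sum>k\<in>nzf n. cos (ang n k x) / (1 - mu n k) / (real n)\<^sup>2)"
    proof (rule sum.cong [OF refl])
      fix k assume "k \<in> nzf n"
      hence "1 - mu n k > 0" by (rule one_minus_mu_pos)
      thus "1 / ((1 - mu n k)\<^sup>2 * (real n)\<^sup>2) * ((1 - mu n k) * cos (ang n k x))
          = cos (ang n k x) / (1 - mu n k) / (real n)\<^sup>2"
        by (simp add: power2_eq_square)
    qed
    finally show ?thesis by (simp add: green_def sum_divide_distrib)
  qed
  moreover have "(\<Sum>x\<in>torus n. G x) = 0"
  proof -
    have "(\<Sum>x\<in>torus n. G x)
        = (\<Sum>k\<in>nzf n. 1 / ((1 - mu n k)\<^sup>2 * (real n)\<^sup>2) * (\<Sum>x\<in>torus n. cos (ang n k x)))"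
      unfolding G_def sum_distrib_left by (rule sum.swap)
    also have "\<dots> = 0" using proj_nzf by (simp add: sum_cos_torus[OF n])
    finally show ?thesis .
  qed
  ultimately have "G (0,0) = (\<Sum>y\<in>torus n. green n ((0,0) - y) * green n y)"
    using green_representation[OF n pG, of "(0,0)"] by simp
  also have "\<dots> = (\<Sum>y\<in>torus n. (green n y)\<^sup>2)"
  proof -
    have "(0,0) - y = - y" for y :: "int \<times> int" by (simp add: prod_eq_iff)
    thus ?thesis by (simp add: green_minus power2_eq_square)
  qed
  also have "\<dots> = (\<Sum>y\<in>torus n. (green n (y + - x))\<^sup>2)"
    using periodic_green[OF n] by (intro sum_torus_shift[symmetric] n) (simp add: periodic_def)
  also have "\<dots> = (\<Sum>y\<in>torus n. (green n (x - y))\<^sup>2)"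
    using green_minus[of n "_ - x"] by (intro sum.cong) (simp_all add: green_minus [of n "x - _", symmetric])
  finally have "(\<Sum>y\<in>torus n. (green n (x - y))\<^sup>2) = G (0,0)" ..
  also have "\<dots> = (\<Sum>k\<in>nzf n. 1 / (1 - mu n k)\<^sup>2) / (real n)\<^sup>2"
    by (simp add: G_def sum_divide_distrib)
  finally show ?thesis using sum_inverse_one_minus_mu_squared[OF n] by simp
qed

text \<open>Parseval, with \<open>q k\<close> the squared Fourier coefficient of \<open>f\<close>:
  the energy weights it by \<open>1 - mu\<close>, which is at least \<open>2 / n^2\<close> at
  nonzero frequencies, and removing the zero frequency removes the squared mean.\<close>

lemma spectral_gap:
  assumes n: "n > 0" and f: "periodic n f"
  shows "2 / (real n)\<^sup>2 * ((\<Sum>x\<in>torus n. (f x)\<^sup>2) - (\<Sum>x\<in>torus n. f x)\<^sup>2 / (real n)\<^sup>2)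
    \<le> (\<Sum>x\<in>torus n. f x * (f x - step_avg f x))"
proof -
  define q where "q k = (\<Sum>x\<in>torus n. \<Sum>y\<in>torus n. f x * f y * cos (ang n k (x - y)))" for k
  have q0: "q k \<ge> 0" for k unfolding q_def quadratic_form_cos by simp
  have qz: "q (0,0) = (\<Sum>x\<in>torus n. f x)\<^sup>2" unfolding q_def quadratic_form_cos by simp
  have swap: "(\<Sum>k\<in>freq n. w k * q k)
      = (\<Sum>x\<in>torus n. f x * (\<Sum>y\<in>torus n. f y * (\<Sum>k\<in>freq n. w k * cos (ang n k (x - y)))))" for w
  proof -
    have "(\<Sum>k\<in>freq n. w k * q k)
        = (\<Sum>k\<in>freq n. \<Sum>x\<in>torus n. \<Sum>y\<in>torus n. f x * (f y * (w k * cos (ang n k (x - y)))))"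
      by (simp add: q_def sum_distrib_left mult_ac)
    also have "\<dots> = (\<Sum>x\<in>torus n. \<Sum>k\<in>freq n. \<Sum>y\<in>torus n. f x * (f y * (w k * cos (ang n k (x - y)))))"
      by (rule sum.swap)
    also have "\<dots> = (\<Sum>x\<in>torus n. \<Sum>y\<in>torus n. \<Sum>k\<in>freq n. f x * (f y * (w k * cos (ang n k (x - y)))))"
      by (intro sum.cong refl sum.swap)
    finally show ?thesis by (simp add: sum_distrib_left)
  qed
  have s1: "(\<Sum>k\<in>freq n. q k) = (real n)\<^sup>2 * (\<Sum>x\<in>torus n. (f x)\<^sup>2)"
  proof -
    have "(\<Sum>k\<in>freq n. q k) = (\<Sum>x\<in>torus n. f x * ((real n)\<^sup>2 * f x))"
      using swap[of "\<lambda>_. 1"] by (simp add: sum_cos_freq[OF n] sum_torus_delta[OF n f])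
    thus ?thesis by (simp add: sum_distrib_left power2_eq_square mult_ac)
  qed
  have s2: "(\<Sum>k\<in>freq n. mu n k * q k) = (real n)\<^sup>2 * (\<Sum>x\<in>torus n. f x * step_avg f x)"
  proof -
    have "(\<Sum>y\<in>torus n. f y * (\<Sum>k\<in>freq n. mu n k * cos (ang n k (x - y)))) = (real n)\<^sup>2 * step_avg f x" for x
    proof -
      have "(\<Sum>k\<in>freq n. mu n k * cos (ang n k (x - y)))
          = step_avg (\<lambda>x. if proj n (x - y) = (0,0) then (real n)\<^sup>2 else 0) x" for y
        unfolding step_avg_cos [symmetric] step_avg_sum [symmetric] sum_cos_freq[OF n]
        using step_avg_shift[of "\<lambda>x. if proj n x = (0,0) then (real n)\<^sup>2 else 0" y x] by simp
      hence "(\<Sum>y\<in>torus n. f y * (\<Sum>k\<in>freq n. mu n k * cos (ang n k (x - y))))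
          = step_avg (\<lambda>x. \<Sum>y\<in>torus n. f y * (if proj n (x - y) = (0,0) then (real n)\<^sup>2 else 0)) x"
        by (simp only: step_avg_sum step_avg_cmult)
      also have "\<dots> = (real n)\<^sup>2 * step_avg f x"
        by (simp only: sum_torus_delta[OF n f] step_avg_cmult)
      finally show ?thesis .
    qed
    thus ?thesis using swap[of "mu n"] by (simp add: sum_distrib_left mult_ac)
  qed
  have "2 / (real n)\<^sup>2 * (\<Sum>k\<in>nzf n. q k) \<le> (\<Sum>k\<in>nzf n. (1 - mu n k) * q k)"
    unfolding sum_distrib_left
  proof (rule sum_mono)
    fix k assume k: "k \<in> nzf n"
    have "2 / (real n)\<^sup>2 \<le> 2 * nsq k / (real n)\<^sup>2"
      using nsq_ge_1[of k] k by (intro divide_right_mono) (auto simp: nzf_def)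
    also have "\<dots> \<le> 1 - mu n k" using k n by (intro nsq_le_one_minus_mu) (auto simp: nzf_def)
    finally show "2 / (real n)\<^sup>2 * q k \<le> (1 - mu n k) * q k" using q0 by (intro mult_right_mono)
  qed
  moreover have "(\<Sum>k\<in>nzf n. q k) = (real n)\<^sup>2 * (\<Sum>x\<in>torus n. (f x)\<^sup>2) - (\<Sum>x\<in>torus n. f x)\<^sup>2"
    using s1 sum_freq_split[OF n, of q] qz by simp
  moreover have "(\<Sum>k\<in>nzf n. (1 - mu n k) * q k) = (real n)\<^sup>2 * (\<Sum>x\<in>torus n. f x * (f x - step_avg f x))"
    using s1 s2 sum_freq_split[OF n, of "\<lambda>k. (1 - mu n k) * q k"]
    by (simp add: left_diff_distrib right_diff_distrib sum_subtractf power2_eq_square)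
  ultimately have "2 / (real n)\<^sup>2 * ((real n)\<^sup>2 * (\<Sum>x\<in>torus n. (f x)\<^sup>2) - (\<Sum>x\<in>torus n. f x)\<^sup>2)
      \<le> (real n)\<^sup>2 * (\<Sum>x\<in>torus n. f x * (f x - step_avg f x))" by simp
  moreover have "(real n)\<^sup>2 * (\<Sum>x\<in>torus n. (f x)\<^sup>2) - (\<Sum>x\<in>torus n. f x)\<^sup>2
      = (real n)\<^sup>2 * ((\<Sum>x\<in>torus n. (f x)\<^sup>2) - (\<Sum>x\<in>torus n. f x)\<^sup>2 / (real n)\<^sup>2)"
    using n by (simp add: right_diff_distrib)
  ultimately have "(real n)\<^sup>2 * (2 / (real n)\<^sup>2 * ((\<Sum>x\<in>torus n. (f x)\<^sup>2) - (\<Sum>x\<in>torus n. f x)\<^sup>2 / (real n)\<^sup>2))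
      \<le> (real n)\<^sup>2 * (\<Sum>x\<in>torus n. f x * (f x - step_avg f x))" by (simp add: mult.left_commute)
  thus ?thesis using n by (simp only: mult_le_cancel_left_pos zero_less_power of_nat_0_less_iff)
qed

section \<open>Perron theory for symmetric kernels\<close>

text \<open>Bolzano-Weierstrass, refined one coordinate at a time.\<close>

lemma bounded_functions_convergent_subseq:
  fixes F :: "nat \<Rightarrow> 'a \<Rightarrow> real"
  assumes "finite S" "\<And>j x. x \<in> S \<Longrightarrow> \<bar>F j x\<bar> \<le> C"
  shows "\<exists>r \<phi>. strict_mono (r :: nat \<Rightarrow> nat) \<and> (\<forall>x\<in>S. (\<lambda>j. F (r j) x) \<longlonglongrightarrow> \<phi> x)"
  using assms
proof (induction S rule: finite_induct)
  case empty
  show ?case by (rule exI[of _ id]) (simp add: strict_mono_def)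
next
  case (insert p S)
  then obtain r \<phi> where r: "strict_mono (r :: nat \<Rightarrow> nat)" "\<And>x. x \<in> S \<Longrightarrow> (\<lambda>j. F (r j) x) \<longlonglongrightarrow> \<phi> x"
    by blast
  have "bounded (range (\<lambda>j. F (r j) p))"
    using insert.prems by (auto simp: bounded_iff)
  then obtain l s where s: "strict_mono (s :: nat \<Rightarrow> nat)" "((\<lambda>j. F (r j) p) \<circ> s) \<longlonglongrightarrow> l"
    using bounded_imp_convergent_subsequence by blast
  have "(\<lambda>j. F ((r \<circ> s) j) x) \<longlonglongrightarrow> (\<phi>(p := l)) x" if "x \<in> insert p S" for x
  proof (cases "x = p")
    case True
    thus ?thesis using s(2) by (simp add: o_def)
  next
    case False
    hence "((\<lambda>j. F (r j) x) \<circ> s) \<longlonglongrightarrow> \<phi> x" using r(2)[of x] that s(1)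
      by (intro LIMSEQ_subseq_LIMSEQ) auto
    thus ?thesis using False by (simp add: o_def)
  qed
  thus ?case using strict_mono_o[OF r(1) s(1)] by blast
qed

text \<open>First-order condition at a minimum; it turns maximality of the Rayleigh quotient into
  the eigenvalue equation.\<close>

lemma quadratic_nonneg_imp_linear_zero:
  fixes b c :: real
  assumes "\<And>t. 0 \<le> 2 * t * b + t\<^sup>2 * c"
  shows "b = 0"
proof (rule ccontr)
  assume b: "b \<noteq> 0"
  define C where "C = \<bar>c\<bar> + 1"
  have C: "C > 0" "c < C" by (auto simp: C_def)
  have "2 * (- b / C) * b + (- b / C)\<^sup>2 * c = (b\<^sup>2 / C\<^sup>2) * (c - 2 * C)"
    using C by (simp add: power2_eq_square field_simps)
  also have "\<dots> < 0" using b C by (intro mult_pos_neg) auto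
  finally show False using assms[of "- b / C"] by linarith
qed

locale symmetric_kernel =
  fixes S :: "'a set" and q :: "'a \<Rightarrow> 'a \<Rightarrow> real"
  assumes fin: "finite S" and ne: "S \<noteq> {}"
    and sym: "x \<in> S \<Longrightarrow> y \<in> S \<Longrightarrow> q x y = q y x"
    and nonneg: "x \<in> S \<Longrightarrow> y \<in> S \<Longrightarrow> 0 \<le> q x y"
begin

definition Q :: "('a \<Rightarrow> real) \<Rightarrow> 'a \<Rightarrow> real" where
  "Q f x = (\<Sum>y\<in>S. q x y * f y)"

definition ip :: "('a \<Rightarrow> real) \<Rightarrow> ('a \<Rightarrow> real) \<Rightarrow> real" where
  "ip f g = (\<Sum>x\<in>S. f x * g x)"

lemma ip_commute: "ip f g = ip g f"
  by (simp add: ip_def mult.commute)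

lemma ip_add_left: "ip (\<lambda>x. f x + g x) h = ip f h + ip g h"
  and ip_add_right: "ip h (\<lambda>x. f x + g x) = ip h f + ip h g"
  and ip_cmult_left: "ip (\<lambda>x. c * f x) h = c * ip f h"
  and ip_cmult_right: "ip h (\<lambda>x. c * f x) = c * ip h f"
  by (simp_all add: ip_def distrib_left distrib_right sum.distrib sum_distrib_left mult_ac)

lemma ip_cong: "(\<And>x. x \<in> S \<Longrightarrow> f x = f' x) \<Longrightarrow> (\<And>x. x \<in> S \<Longrightarrow> g x = g' x) \<Longrightarrow> ip f g = ip f' g'"
  by (simp add: ip_def)

lemma ip_self_nonneg: "ip f f \<ge> 0"
  unfolding ip_def by (intro sum_nonneg) auto

lemma ip_Cauchy_Schwarz: "(ip f g)\<^sup>2 \<le> ip f f * ip g g"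
  unfolding ip_def using Cauchy_Schwarz_ineq_sum[of f g S] by (simp add: power2_eq_square)

lemma Q_add: "Q (\<lambda>x. f x + g x) x = Q f x + Q g x"
  and Q_cmult: "Q (\<lambda>x. c * f x) x = c * Q f x"
  by (simp_all add: Q_def distrib_left sum.distrib sum_distrib_left mult_ac)

lemma Q_cong: "(\<And>x. x \<in> S \<Longrightarrow> f x = g x) \<Longrightarrow> Q f = Q g"
  unfolding Q_def by (intro ext sum.cong) auto

lemma ip_Q_sym: "ip f (Q g) = ip (Q f) g"
proof -
  have "ip f (Q g) = (\<Sum>x\<in>S. \<Sum>y\<in>S. q x y * f x * g y)"
    by (simp add: ip_def Q_def sum_distrib_left mult_ac)
  also have "\<dots> = (\<Sum>x\<in>S. \<Sum>y\<in>S. q y x * f x * g y)"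
    using sym by (intro sum.cong) auto
  also have "\<dots> = (\<Sum>y\<in>S. \<Sum>x\<in>S. q y x * f x * g y)" by (rule sum.swap)
  also have "\<dots> = ip (Q f) g"
    by (simp add: ip_def Q_def sum_distrib_left sum_distrib_right mult_ac)
  finally show ?thesis .
qed

lemma abs_ip_Q_le: "\<bar>ip f (Q g)\<bar> \<le> ip (\<lambda>x. \<bar>f x\<bar>) (Q (\<lambda>x. \<bar>g x\<bar>))"
proof -
  have "\<bar>f x * Q g x\<bar> \<le> \<bar>f x\<bar> * Q (\<lambda>x. \<bar>g x\<bar>) x" if "x \<in> S" for x
  proof -
    have "\<bar>Q g x\<bar> \<le> (\<Sum>y\<in>S. \<bar>q x y * g y\<bar>)" unfolding Q_def by (rule sum_abs)
    also have "\<dots> = Q (\<lambda>x. \<bar>g x\<bar>) x"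
      unfolding Q_def using nonneg that by (intro sum.cong) (auto simp: abs_mult)
    finally show ?thesis by (simp add: abs_mult mult_left_mono)
  qed
  thus ?thesis unfolding ip_def by (intro order_trans[OF sum_abs] sum_mono) auto
qed

lemma form_add_scaled:
  "ip (\<lambda>x. f x + t * g x) (Q (\<lambda>x. f x + t * g x)) = ip f (Q f) + 2 * t * ip g (Q f) + t\<^sup>2 * ip g (Q g)"
proof -
  have "ip f (Q g) = ip g (Q f)" by (metis ip_Q_sym ip_commute)
  thus ?thesis
    by (simp add: Q_add [abs_def] Q_cmult [abs_def] ip_add_left ip_add_right ip_cmult_left ip_cmult_right
        power2_eq_square algebra_simps)
qed

lemma ip_add_scaled:
  "ip (\<lambda>x. f x + t * g x) (\<lambda>x. f x + t * g x) = ip f f + 2 * t * ip g f + t\<^sup>2 * ip g g"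
  by (simp add: ip_add_left ip_add_right ip_cmult_left ip_cmult_right ip_commute[of f g]
        power2_eq_square algebra_simps)

lemma abs_le_1_of_unit: "ip f f = 1 \<Longrightarrow> x \<in> S \<Longrightarrow> \<bar>f x\<bar> \<le> 1"
proof -
  assume "ip f f = 1" and x: "x \<in> S"
  hence "(f x)\<^sup>2 \<le> 1"
    using member_le_sum[OF x, of "\<lambda>x. f x * f x"] fin by (simp add: ip_def power2_eq_square)
  thus ?thesis by (simp add: abs_square_le_1)
qed

lemma form_bounded: "ip f f = 1 \<Longrightarrow> ip f (Q f) \<le> (\<Sum>x\<in>S. \<Sum>y\<in>S. q x y)"
proof -
  assume f: "ip f f = 1"
  have "f x * (q x y * f y) \<le> q x y" if "x \<in> S" "y \<in> S" for x y
  proof -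
    have "\<bar>f x\<bar> * \<bar>f y\<bar> \<le> 1 * 1" using abs_le_1_of_unit[OF f] that by (intro mult_mono) auto
    hence "f x * f y \<le> 1" using abs_ge_self[of "f x * f y"] by (simp add: abs_mult)
    hence "q x y * (f x * f y) \<le> q x y * 1" using nonneg[OF that] by (intro mult_left_mono)
    thus ?thesis by (simp add: mult_ac)
  qed
  thus ?thesis unfolding ip_def Q_def sum_distrib_left by (intro sum_mono) auto
qed

text \<open>Compactness of the unit sphere: a maximising sequence has a pointwise convergent
  subsequence, and both forms are finite sums and hence continuous. Scaling extends the bound from
  unit vectors to all functions.\<close>

lemma rayleigh_maximizer:
  "\<exists>\<phi>. ip \<phi> \<phi> = 1 \<and> (\<forall>f. ip f (Q f) \<le> ip \<phi> (Q \<phi>) * ip f f)"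
proof -
  define V where "V = (\<lambda>f. ip f (Q f)) ` {f. ip f f = 1}"
  obtain p where p: "p \<in> S" using ne by blast
  have "ip (\<lambda>x. if x = p then 1 else 0) (\<lambda>x. if x = p then 1 else 0) = (\<Sum>x\<in>S. if x = p then 1 else 0)"
    unfolding ip_def by (intro sum.cong) auto
  hence Vne: "V \<noteq> {}" using p fin unfolding V_def by auto
  have Vbdd: "bdd_above V" using form_bounded unfolding V_def by (auto intro!: bdd_aboveI)
  define l where "l = Sup V"
  have "\<exists>f. ip f f = 1 \<and> ip f (Q f) > l - 1 / real (Suc j)" for j
  proof -
    have "l - 1 / real (Suc j) < Sup V" by (simp add: l_def)
    then obtain v where "v \<in> V" "v > l - 1 / real (Suc j)" using less_cSup_iff[OF Vne Vbdd] by blast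
    thus ?thesis by (auto simp: V_def)
  qed
  then obtain F where F: "\<And>j. ip (F j) (F j) = 1" "\<And>j. ip (F j) (Q (F j)) > l - 1 / real (Suc j)"
    by metis
  have "\<And>j x. x \<in> S \<Longrightarrow> \<bar>F j x\<bar> \<le> 1" using abs_le_1_of_unit F(1) by blast
  then obtain r \<phi> where r: "strict_mono (r :: nat \<Rightarrow> nat)" "\<And>x. x \<in> S \<Longrightarrow> (\<lambda>j. F (r j) x) \<longlonglongrightarrow> \<phi> x"
    using bounded_functions_convergent_subseq[OF fin, of F 1] by blast
  have "(\<lambda>j. ip (F (r j)) (F (r j))) \<longlonglongrightarrow> ip \<phi> \<phi>"
    unfolding ip_def by (intro tendsto_sum tendsto_mult r)
  hence unit: "ip \<phi> \<phi> = 1" using F(1) LIMSEQ_unique[OF _ tendsto_const] by fastforce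
  have lim: "(\<lambda>j. ip (F (r j)) (Q (F (r j)))) \<longlonglongrightarrow> ip \<phi> (Q \<phi>)"
    unfolding ip_def Q_def by (intro tendsto_sum tendsto_mult r tendsto_const)
  have "(\<lambda>j. l - 1 / real (Suc (r j))) \<longlonglongrightarrow> l - 0"
    by (intro tendsto_diff tendsto_const LIMSEQ_subseq_LIMSEQ[OF LIMSEQ_Suc[OF lim_1_over_n] r(1), unfolded o_def])
  hence "l \<le> ip \<phi> (Q \<phi>)"
    using LIMSEQ_le[OF _ lim, of "\<lambda>j. l - 1 / real (Suc (r j))" l] F(2) less_imp_le by (metis (no_types, lifting) diff_zero)
  moreover have "ip f (Q f) \<le> l * ip f f" for f
  proof (cases "ip f f = 0")
    case True
    hence "\<And>x. x \<in> S \<Longrightarrow> f x = 0"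
      unfolding ip_def using fin by (subst (asm) sum_nonneg_eq_0_iff) auto
    thus ?thesis using True by (simp add: ip_def)
  next
    case False
    hence pos: "ip f f > 0" using ip_self_nonneg[of f] by simp
    define s where "s = 1 / sqrt (ip f f)"
    have s2: "s * s = 1 / ip f f" using pos by (simp add: s_def)
    have "ip (\<lambda>x. s * f x) (\<lambda>x. s * f x) = 1"
      using pos by (simp add: ip_cmult_left ip_cmult_right mult.assoc [symmetric] s2)
    hence "ip (\<lambda>x. s * f x) (Q (\<lambda>x. s * f x)) \<le> l"
      unfolding l_def by (intro cSup_upper Vbdd) (auto simp: V_def)
    hence "ip f (Q f) / ip f f \<le> l"
      by (simp add: Q_cmult [abs_def] ip_cmult_left ip_cmult_right mult.assoc [symmetric] s2)
    thus ?thesis using pos by (simp add: divide_le_eq)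
  qed
  ultimately have "ip f (Q f) \<le> ip \<phi> (Q \<phi>) * ip f f" for f
    using ip_self_nonneg[of f] by (meson mult_right_mono order_trans)
  thus ?thesis using unit by blast
qed

text \<open>Entries are nonnegative, so the absolute value of a maximiser has at least the same form
  value and is again a maximiser.\<close>

lemma perron:
  obtains l \<phi> where "l \<ge> 0" "\<And>x. \<phi> x \<ge> 0" "ip \<phi> \<phi> = 1" "\<And>x. x \<in> S \<Longrightarrow> Q \<phi> x = l * \<phi> x"
    "\<And>f. ip f (Q f) \<le> l * ip f f"
proof -
  obtain \<phi>0 where \<phi>0: "ip \<phi>0 \<phi>0 = 1" "\<And>f. ip f (Q f) \<le> ip \<phi>0 (Q \<phi>0) * ip f f"
    using rayleigh_maximizer by blast
  define \<phi> where "\<phi> x = \<bar>\<phi>0 x\<bar>" for x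
  define l where "l = ip \<phi>0 (Q \<phi>0)"
  have unit: "ip \<phi> \<phi> = 1" using \<phi>0(1) by (simp add: ip_def \<phi>_def)
  have "l \<le> ip \<phi> (Q \<phi>)" using abs_ip_Q_le[of \<phi>0 \<phi>0] unfolding l_def \<phi>_def by linarith
  moreover have "ip \<phi> (Q \<phi>) \<le> l" using \<phi>0(2)[of \<phi>] unit by (simp add: l_def)
  ultimately have l: "ip \<phi> (Q \<phi>) = l" by simp
  have "l \<ge> 0" using l nonneg unfolding ip_def Q_def \<phi>_def
    by (metis (no_types, lifting) abs_ge_zero mult_nonneg_nonneg sum_nonneg)
  moreover have "Q \<phi> x = l * \<phi> x" if x: "x \<in> S" for x
  proof -
    let ?g = "\<lambda>y. if y = x then 1 else 0 :: real"
    \<comment> \<open>Maximality tested at \<open>\<phi>\<close> perturbed in the single coordinate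
      \<open>x\<close>.\<close>
    have "0 \<le> 2 * t * (l * ip ?g \<phi> - ip ?g (Q \<phi>)) + t\<^sup>2 * (l * ip ?g ?g - ip ?g (Q ?g))" for t
      using \<phi>0(2)[of "\<lambda>y. \<phi> y + t * ?g y"] l unit
      unfolding form_add_scaled ip_add_scaled l_def [symmetric] by (simp add: algebra_simps)
    hence "l * ip ?g \<phi> - ip ?g (Q \<phi>) = 0" by (rule quadratic_nonneg_imp_linear_zero)
    moreover have "ip ?g h = h x" for h
    proof -
      have "ip ?g h = (\<Sum>y\<in>S. if y = x then h y else 0)" unfolding ip_def by (intro sum.cong) auto
      thus ?thesis using x fin by simp
    qed
    ultimately show ?thesis by simp
  qed
  ultimately show ?thesis using that[of l \<phi>] unit \<phi>0(2) by (auto simp: \<phi>_def l_def)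
qed

lemma funpow_Q_linear:
  "(Q ^^ m) (\<lambda>x. f x + c * g x) = (\<lambda>x. (Q ^^ m) f x + c * (Q ^^ m) g x)"
  by (induction m) (simp_all add: Q_add [abs_def] Q_cmult [abs_def])

text \<open>Only the part of the constant function orthogonal to \<open>\<phi>\<close> causes an error. The spectrum may contain
  \<open>-l\<close> (the torus is bipartite for even \<open>n\<close>), but nonnegativity of the kernel confines it to
  \<open>[-l, l]\<close>.\<close>

lemma perron_power_bound:
  assumes l: "l \<ge> 0" and unit: "ip \<phi> \<phi> = 1"
    and ev: "\<And>x. x \<in> S \<Longrightarrow> Q \<phi> x = l * \<phi> x" and top: "\<And>f. ip f (Q f) \<le> l * ip f f"
  shows "\<bar>(\<Sum>x\<in>S. (Q ^^ m) (\<lambda>_. 1) x) - (\<Sum>x\<in>S. \<phi> x)\<^sup>2 * l ^ m\<bar>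
      \<le> (real (card S) - (\<Sum>x\<in>S. \<phi> x)\<^sup>2) * l ^ m"
proof -
  have abs_form: "\<bar>ip h (Q h)\<bar> \<le> l * ip h h" for h
    using abs_ip_Q_le[of h h] top[of "\<lambda>x. \<bar>h x\<bar>"] by (simp add: ip_def)
  \<comment> \<open>Polarisation: the absolute form bound is applied to the sum and to the
    difference.\<close>
  have bil: "2 * ip f (Q g) \<le> l * (ip f f + ip g g)" for f g
  proof -
    have "ip (\<lambda>x. g x + 1 * f x) (Q (\<lambda>x. g x + 1 * f x)) - ip (\<lambda>x. g x + (-1) * f x) (Q (\<lambda>x. g x + (-1) * f x))
        = 4 * ip f (Q g)"
      unfolding form_add_scaled by simp
    hence "4 * ip f (Q g) \<le> l * ip (\<lambda>x. g x + 1 * f x) (\<lambda>x. g x + 1 * f x)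
        + l * ip (\<lambda>x. g x + (-1) * f x) (\<lambda>x. g x + (-1) * f x)"
      using abs_form[of "\<lambda>x. g x + 1 * f x"] abs_form[of "\<lambda>x. g x + (-1) * f x"] by linarith
    also have "\<dots> = 2 * (l * (ip f f + ip g g))" unfolding ip_add_scaled by (simp add: algebra_simps)
    finally show ?thesis by linarith
  qed
  \<comment> \<open>The operator norm is read off from the form bound without diagonalisation: the
    bilinear bound is applied to \<open>Q u\<close> and \<open>t * u\<close>, with the choice
    \<open>t = l\<close>.\<close>
  have contr: "ip (Q u) (Q u) \<le> l\<^sup>2 * ip u u" for u
  proof -
    have t: "2 * (t * ip (Q u) (Q u)) \<le> l * (ip (Q u) (Q u) + t\<^sup>2 * ip u u)" for t
      using bil[of "Q u" "\<lambda>x. t * u x"]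
      by (simp add: Q_cmult [abs_def] ip_cmult_left ip_cmult_right power2_eq_square mult.assoc)
    show ?thesis
    proof (cases "l = 0")
      case True
      thus ?thesis using t[of 1] by simp
    next
      case False
      hence "l > 0" using l by simp
      have "l * (2 * ip (Q u) (Q u)) \<le> l * (ip (Q u) (Q u) + l\<^sup>2 * ip u u)"
        using t[of l] by (simp add: mult.left_commute)
      hence "2 * ip (Q u) (Q u) \<le> ip (Q u) (Q u) + l\<^sup>2 * ip u u"
        using \<open>l > 0\<close> by (simp only: mult_le_cancel_left_pos)
      thus ?thesis by linarith
    qed
  qed
  have pow_contr: "ip ((Q ^^ m) u) ((Q ^^ m) u) \<le> (l\<^sup>2) ^ m * ip u u" for u m
  proof (induction m)
    case (Suc m)
    have "ip ((Q ^^ Suc m) u) ((Q ^^ Suc m) u) \<le> l\<^sup>2 * ip ((Q ^^ m) u) ((Q ^^ m) u)"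
      using contr[of "(Q ^^ m) u"] by simp
    also have "\<dots> \<le> l\<^sup>2 * ((l\<^sup>2) ^ m * ip u u)" using Suc by (intro mult_left_mono) auto
    finally show ?case by (simp add: mult.assoc)
  qed simp
  have evm: "(Q ^^ m) \<phi> x = l ^ m * \<phi> x" if "x \<in> S" for x m
    using that
  proof (induction m arbitrary: x)
    case (Suc m)
    have "(Q ^^ Suc m) \<phi> x = Q (\<lambda>x. l ^ m * \<phi> x) x"
      using Q_cong[of "(Q ^^ m) \<phi>" "\<lambda>x. l ^ m * \<phi> x"] Suc.IH by simp
    thus ?case using ev[OF Suc.prems] by (simp add: Q_cmult)
  qed simp
  define c where "c = (\<Sum>x\<in>S. \<phi> x)"
  define u where "u x = 1 + (- c) * \<phi> x" for x
  have c1: "ip \<phi> (\<lambda>_. 1) = c" by (simp add: ip_def c_def)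
  have "ip (\<lambda>_. 1) (\<lambda>_. 1) = real (card S)" by (simp add: ip_def)
  hence uu: "ip u u = real (card S) - c\<^sup>2"
    unfolding u_def [abs_def] ip_add_scaled c1 unit by (simp add: power2_eq_square)
  have \<phi>u: "ip \<phi> u = 0"
    unfolding u_def [abs_def] ip_add_right ip_cmult_right c1 unit by simp
  have \<phi>Qu: "ip \<phi> ((Q ^^ m) u) = 0" for m
  proof (induction m)
    case (Suc m)
    have "ip \<phi> ((Q ^^ Suc m) u) = ip (Q \<phi>) ((Q ^^ m) u)" using ip_Q_sym[of \<phi> "(Q ^^ m) u"] by simp
    also have "\<dots> = ip (\<lambda>x. l * \<phi> x) ((Q ^^ m) u)" using ev by (intro ip_cong) auto
    finally show ?case using Suc by (simp add: ip_cmult_left)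
  qed (simp add: \<phi>u)
  have one: "(\<lambda>_. 1) = (\<lambda>x. u x + c * \<phi> x)" by (simp add: u_def)
  have "(\<Sum>x\<in>S. (Q ^^ m) (\<lambda>_. 1) x) = ip (\<lambda>_. 1) ((Q ^^ m) u) + c * ip (\<lambda>_. 1) ((Q ^^ m) \<phi>)"
    unfolding one funpow_Q_linear ip_add_right [symmetric] ip_cmult_right [symmetric]
    unfolding one [symmetric] by (simp add: ip_def)
  moreover have "ip (\<lambda>_. 1) ((Q ^^ m) \<phi>) = l ^ m * c"
  proof -
    have "ip (\<lambda>_. 1) ((Q ^^ m) \<phi>) = ip (\<lambda>_. 1) (\<lambda>x. l ^ m * \<phi> x)" using evm by (intro ip_cong) auto
    thus ?thesis using c1 by (simp add: ip_cmult_right ip_commute)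
  qed
  moreover have "ip (\<lambda>_. 1) ((Q ^^ m) u) = ip u ((Q ^^ m) u)"
    using \<phi>Qu[of m] by (subst one) (simp add: ip_add_left ip_cmult_left)
  ultimately have eq: "(\<Sum>x\<in>S. (Q ^^ m) (\<lambda>_. 1) x) - c\<^sup>2 * l ^ m = ip u ((Q ^^ m) u)"
    by (simp add: power2_eq_square)
  have "(ip u ((Q ^^ m) u))\<^sup>2 \<le> ip u u * ((l\<^sup>2) ^ m * ip u u)"
    using ip_Cauchy_Schwarz[of u "(Q ^^ m) u"] mult_left_mono[OF pow_contr[of m u] ip_self_nonneg[of u]]
    by linarith
  also have "\<dots> = (ip u u * l ^ m)\<^sup>2" by (simp add: power_mult_distrib power2_eq_square power_mult flip: power_mult)
  finally have "\<bar>ip u ((Q ^^ m) u)\<bar> \<le> \<bar>ip u u * l ^ m\<bar>" by (simp only: abs_le_square_iff)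
  also have "\<dots> = ip u u * l ^ m" using ip_self_nonneg[of u] l by simp
  finally show ?thesis unfolding eq [symmetric] uu c_def .
qed

end

section \<open>The principal eigenvalue of the walk killed on a small set\<close>

text \<open>Steps are counted with multiplicity, so the kernel is correct even on tiny tori where
  different steps lead to the same point.\<close>

definition torus_kernel :: "nat \<Rightarrow> int \<times> int \<Rightarrow> int \<times> int \<Rightarrow> real" where
  "torus_kernel n x y = (\<Sum>e\<in>steps. if proj n (x + e) = y then 1 else 0) / 4"

lemma torus_kernel_sym:
  assumes "x \<in> torus n" "y \<in> torus n"
  shows "torus_kernel n x y = torus_kernel n y x"
proof -
  have imp: "proj n (x + e) = y \<Longrightarrow> proj n (y + - e) = x" if "x \<in> torus n" for x y e
    using proj_add_left[of n "x + e" "- e"] proj_torus[OF that] by (simp add: add.assoc)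
  have eq: "proj n (x + e) = y \<longleftrightarrow> proj n (y + - e) = x" for e
    using imp[OF assms(1), of e y] imp[OF assms(2), of "- e" x] by auto
  show ?thesis unfolding torus_kernel_def eq sum_steps uminus_Pair by simp
qed

lemma sum_torus_kernel:
  assumes "S \<subseteq> torus n"
  shows "(\<Sum>y\<in>S. torus_kernel n x y * f y) = step_avg (\<lambda>z. if proj n z \<in> S then f (proj n z) else 0) x"
proof -
  have fin: "finite S" using assms by (rule finite_subset) simp
  have "(\<Sum>y\<in>S. torus_kernel n x y * f y)
      = (\<Sum>y\<in>S. \<Sum>e\<in>steps. if proj n (x + e) = y then f y else 0) / 4"
    unfolding torus_kernel_def sum_divide_distrib sum_distrib_right by (intro sum.cong) auto
  also have "\<dots> = (\<Sum>e\<in>steps. \<Sum>y\<in>S. if proj n (x + e) = y then f y else 0) / 4"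
    by (subst sum.swap) simp
  finally show ?thesis unfolding step_avg_def using fin by simp
qed

text \<open>Perron theory is applied to the kernel restricted to the nonempty complement of
  \<open>B\<close>, and the result is extended by zero on \<open>B\<close> and periodically to the
  plane. Survival probabilities are the powers of the restricted kernel applied to the constant
  1.\<close>

lemma torus_principal_eigenfunction:
  assumes n: "n > 0" and B: "B \<subset> torus n"
  obtains l \<phi> where "l \<ge> 0" "periodic n \<phi>" "\<And>x. \<phi> x \<ge> 0" "(\<Sum>x\<in>torus n. (\<phi> x)\<^sup>2) = 1"
    "\<And>x. proj n x \<in> B \<Longrightarrow> \<phi> x = 0" "\<And>x. proj n x \<notin> B \<Longrightarrow> step_avg \<phi> x = l * \<phi> x"
    "\<And>f. periodic n f \<Longrightarrow> (\<And>x. proj n x \<in> B \<Longrightarrow> f x = 0) \<Longrightarrow>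
        (\<Sum>x\<in>torus n. f x * step_avg f x) \<le> l * (\<Sum>x\<in>torus n. (f x)\<^sup>2)"
    "\<And>t. \<bar>(real n)\<^sup>2 * uncovered_prob n B t - (\<Sum>x\<in>torus n. \<phi> x)\<^sup>2 * l ^ nat \<lfloor>t\<rfloor>\<bar>
        \<le> ((real n)\<^sup>2 - (\<Sum>x\<in>torus n. \<phi> x)\<^sup>2) * l ^ nat \<lfloor>t\<rfloor>"
proof -
  define S where "S = torus n - B"
  have S: "S \<subseteq> torus n" "S \<noteq> {}" "finite S" using B by (auto simp: S_def)
  interpret symmetric_kernel S "torus_kernel n"
  proof
    show "torus_kernel n x y = torus_kernel n y x" if "x \<in> S" "y \<in> S" for x y
      using that S by (intro torus_kernel_sym) auto
    show "0 \<le> torus_kernel n x y" for x y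
      unfolding torus_kernel_def by (intro divide_nonneg_pos sum_nonneg) auto
  qed (use S in auto)
  define ext where "ext f z = (if proj n z \<in> S then f (proj n z) else 0)" for f :: "int \<times> int \<Rightarrow> real" and z
  have Q_ext: "Q f = step_avg (ext f)" for f
    unfolding Q_def [abs_def] sum_torus_kernel[OF S(1)] ext_def [abs_def] ..
  have inS: "proj n x \<in> S \<longleftrightarrow> proj n x \<notin> B" for x using proj_in_torus[OF n] by (auto simp: S_def)
  have sum_S: "(\<Sum>x\<in>torus n. g x) = (\<Sum>x\<in>S. g x)" if "\<And>x. x \<in> torus n \<Longrightarrow> x \<in> B \<Longrightarrow> g x = 0"
    for g :: "int \<times> int \<Rightarrow> real"
    using S that by (intro sum.mono_neutral_right) (auto simp: S_def)
  obtain l \<phi> where l: "l \<ge> 0" and \<phi>: "\<And>x. \<phi> x \<ge> 0" "ip \<phi> \<phi> = 1" "\<And>x. x \<in> S \<Longrightarrow> Q \<phi> x = l * \<phi> x"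
    and top: "\<And>f. ip f (Q f) \<le> l * ip f f"
    using perron by metis
  have ext_S: "ext f x = f x" if "x \<in> S" for f x
  proof -
    have "proj n x = x" using that S(1) by (intro proj_torus) blast
    thus ?thesis using that by (simp only: ext_def if_True)
  qed
  have ext_B: "ext f x = 0" if "proj n x \<in> B" for f x using that inS by (simp add: ext_def)
  have ext_B': "ext f x = 0" if "x \<in> torus n" "x \<in> B" for f x 
    using that by (intro ext_B) (simp only: proj_torus)
  have proj_idem: "proj n (proj n x) = proj n x" for x using proj_in_torus[OF n] proj_torus by blast
  have ext_per: "periodic n (ext f)" for f unfolding periodic_def ext_def proj_idem by simp
  have sum_ext: "(\<Sum>x\<in>torus n. ext \<phi> x) = (\<Sum>x\<in>S. \<phi> x)"
    using ext_B' by (subst sum_S) (simp_all add: ext_S)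
  have avoid: "torus_avoid n B m x = ext ((Q ^^ m) (\<lambda>_. 1)) x" if "x \<in> torus n" for m x
    using that
  proof (induction m arbitrary: x)
    case 0
    show ?case unfolding ext_def proj_torus[OF 0] using 0 by (simp add: S_def)
  next
    case (Suc m)
    show ?case
    proof (cases "x \<in> B")
      case True
      thus ?thesis using ext_B' Suc.prems by simp
    next
      case False
      have "torus_avoid n B (Suc m) x = step_avg (\<lambda>z. ext ((Q ^^ m) (\<lambda>_. 1)) (proj n z)) x"
        using False Suc.IH proj_in_torus[OF n] by (simp add: step_avg_def)
      also have "\<dots> = Q ((Q ^^ m) (\<lambda>_. 1)) x"
        unfolding Q_ext periodicD[OF ext_per] ..
      finally show ?thesis using ext_S[of x] False Suc.prems by (simp add: S_def)
    qed
  qed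
  show ?thesis
  proof (rule that[of l "ext \<phi>"])
    show "l \<ge> 0" by (rule l)
    show "periodic n (ext \<phi>)" by (rule ext_per)
    show "ext \<phi> x \<ge> 0" for x using \<phi>(1) by (simp add: ext_def)
    show "(\<Sum>x\<in>torus n. (ext \<phi> x)\<^sup>2) = 1"
    proof -
      have "(\<Sum>x\<in>torus n. (ext \<phi> x)\<^sup>2) = (\<Sum>x\<in>S. (\<phi> x)\<^sup>2)"
        using ext_B' by (subst sum_S) (simp_all add: ext_S)
      thus ?thesis using \<phi>(2) by (simp add: ip_def power2_eq_square)
    qed
    show "ext \<phi> x = 0" if "proj n x \<in> B" for x using that by (rule ext_B)
    show "step_avg (ext \<phi>) x = l * ext \<phi> x" if "proj n x \<notin> B" for x
    proof -
      have "step_avg (ext \<phi>) x = step_avg (ext \<phi>) (proj n x)"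
        using periodicD[OF periodic_step_avg[OF ext_per]] by simp
      also have "\<dots> = l * \<phi> (proj n x)" using \<phi>(3)[of "proj n x"] that inS unfolding Q_ext by blast
      finally show ?thesis using that inS by (simp add: ext_def)
    qed
    show "(\<Sum>x\<in>torus n. f x * step_avg f x) \<le> l * (\<Sum>x\<in>torus n. (f x)\<^sup>2)"
      if f: "periodic n f" "\<And>x. proj n x \<in> B \<Longrightarrow> f x = 0" for f
    proof -
      have "ext f = f" using f inS by (auto simp: ext_def fun_eq_iff periodic_def)
      hence "ip f (Q f) = (\<Sum>x\<in>S. f x * step_avg f x)" by (simp add: ip_def Q_ext)
      also have "\<dots> = (\<Sum>x\<in>torus n. f x * step_avg f x)"
        by (rule sum_S [symmetric]) (metis f(2) mult_zero_left proj_torus)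
      finally have "ip f (Q f) = (\<Sum>x\<in>torus n. f x * step_avg f x)" .
      moreover have "ip f f = (\<Sum>x\<in>torus n. (f x)\<^sup>2)"
        unfolding ip_def power2_eq_square by (rule sum_S [symmetric]) (metis f(2) mult_zero_left proj_torus)
      ultimately show ?thesis using top[of f] by simp
    qed
    show "\<bar>(real n)\<^sup>2 * uncovered_prob n B t - (\<Sum>x\<in>torus n. ext \<phi> x)\<^sup>2 * l ^ nat \<lfloor>t\<rfloor>\<bar>
        \<le> ((real n)\<^sup>2 - (\<Sum>x\<in>torus n. ext \<phi> x)\<^sup>2) * l ^ nat \<lfloor>t\<rfloor>" for t
    proof -
      let ?m = "nat \<lfloor>t\<rfloor>"
      have "(real n)\<^sup>2 * uncovered_prob n B t = (\<Sum>x\<in>torus n. ext ((Q ^^ ?m) (\<lambda>_. 1)) x)"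
        using n avoid unfolding uncovered_prob_def by simp
      also have "\<dots> = (\<Sum>x\<in>S. (Q ^^ ?m) (\<lambda>_. 1) x)"
        using ext_B' by (subst sum_S) (simp_all add: ext_S)
      finally have eq: "(real n)\<^sup>2 * uncovered_prob n B t = (\<Sum>x\<in>S. (Q ^^ ?m) (\<lambda>_. 1) x)" .
      have "real (card S) \<le> (real n)\<^sup>2"
        using card_mono[OF finite_torus S(1)] by (simp add: card_torus flip: of_nat_power)
      \<comment> \<open>Enlarging the number of surviving points to \<open>n^2\<close> puts the
        bound in terms of the full torus.\<close>
      hence "(real (card S) - (\<Sum>x\<in>S. \<phi> x)\<^sup>2) * l ^ ?m \<le> ((real n)\<^sup>2 - (\<Sum>x\<in>S. \<phi> x)\<^sup>2) * l ^ ?m"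
        using l by (intro mult_right_mono) auto
      thus ?thesis using perron_power_bound[OF l \<phi>(2) \<phi>(3) top, of ?m] unfolding eq sum_ext by linarith
    qed
  qed
qed

section \<open>Dirichlet forms and the test function\<close>

lemma torus_Cauchy_Schwarz: "(\<Sum>x\<in>torus n. f x)\<^sup>2 \<le> (real n)\<^sup>2 * (\<Sum>x\<in>torus n. (f x)\<^sup>2)"
  using Cauchy_Schwarz_ineq_sum[of "\<lambda>_. 1" f "torus n"] by (simp add: card_torus)

lemma dirichlet_form_nonneg:
  assumes n: "n > 0" and f: "periodic n f"
  shows "0 \<le> (\<Sum>x\<in>torus n. f x * (f x - step_avg f x))"
proof -
  have "(\<Sum>x\<in>torus n. f x)\<^sup>2 / (real n)\<^sup>2 \<le> (\<Sum>x\<in>torus n. (f x)\<^sup>2)"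
    using torus_Cauchy_Schwarz[of f n] n by (simp add: divide_le_eq mult.commute)
  hence "0 \<le> 2 / (real n)\<^sup>2 * ((\<Sum>x\<in>torus n. (f x)\<^sup>2) - (\<Sum>x\<in>torus n. f x)\<^sup>2 / (real n)\<^sup>2)"
    by simp
  thus ?thesis using spectral_gap[OF n f] by linarith
qed

text \<open>Parallelogram identity for the nonnegative energy form.\<close>

lemma dirichlet_form_add_le:
  assumes n: "n > 0" and f: "periodic n f" and g: "periodic n g"
  shows "(\<Sum>x\<in>torus n. (f x + g x) * (f x + g x - step_avg (\<lambda>x. f x + g x) x))
    \<le> 2 * (\<Sum>x\<in>torus n. f x * (f x - step_avg f x)) + 2 * (\<Sum>x\<in>torus n. g x * (g x - step_avg g x))"
proof -
  have "periodic n (\<lambda>x. f x - g x)" using f g by (simp add: periodic_def)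
  hence "0 \<le> (\<Sum>x\<in>torus n. (f x - g x) * (f x - g x - step_avg (\<lambda>x. f x - g x) x))"
    by (rule dirichlet_form_nonneg[OF n])
  moreover have "(\<Sum>x\<in>torus n. (f x + g x) * (f x + g x - step_avg (\<lambda>x. f x + g x) x))
      + (\<Sum>x\<in>torus n. (f x - g x) * (f x - g x - step_avg (\<lambda>x. f x - g x) x))
      = 2 * (\<Sum>x\<in>torus n. f x * (f x - step_avg f x)) + 2 * (\<Sum>x\<in>torus n. g x * (g x - step_avg g x))"
    unfolding step_avg_add step_avg_diff sum.distrib [symmetric] sum_distrib_left
    by (intro sum.cong) (auto simp: algebra_simps)
  ultimately show ?thesis by linarith
qed

lemma dirichlet_form_le:
  assumes n: "n > 0" and f: "periodic n f"
  shows "(\<Sum>x\<in>torus n. f x * (f x - step_avg f x)) \<le> 2 * (\<Sum>x\<in>torus n. (f x)\<^sup>2)"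
proof -
  have a: "- (2 * (f x * step_avg f x)) \<le> (f x)\<^sup>2 + step_avg (\<lambda>x. (f x)\<^sup>2) x" for x
  proof -
    have b: "- (2 * (f x * f (x + e))) \<le> (f x)\<^sup>2 + (f (x + e))\<^sup>2" for e
      using zero_le_power2[of "f x + f (x + e)"] by (simp add: power2_sum)
    show ?thesis
      using b[of "(1,0)"] b[of "(-1,0)"] b[of "(0,1)"] b[of "(0,-1)"]
      unfolding step_avg_eq by (simp add: field_simps)
  qed
  have "(\<Sum>x\<in>torus n. - (2 * (f x * step_avg f x))) \<le> (\<Sum>x\<in>torus n. (f x)\<^sup>2 + step_avg (\<lambda>x. (f x)\<^sup>2) x)"
    by (intro sum_mono a)
  moreover have "periodic n (\<lambda>x. (f x)\<^sup>2)" using f by (simp add: periodic_def)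
  ultimately have "- (2 * (\<Sum>x\<in>torus n. f x * step_avg f x)) \<le> 2 * (\<Sum>x\<in>torus n. (f x)\<^sup>2)"
    using sum_torus_step_avg[OF n, of "\<lambda>x. (f x)\<^sup>2"]
    by (simp add: sum.distrib sum_negf sum_distrib_left)
  thus ?thesis by (simp add: right_diff_distrib sum_subtractf power2_eq_square)
qed

lemma green_diff_nonneg: "green_diff n x \<ge> 0"
  unfolding green_diff_alt
proof (intro divide_nonneg_nonneg sum_nonneg)
  fix k assume "k \<in> nzf n"
  thus "0 \<le> 1 - mu n k" using one_minus_mu_pos[of k n] by simp
qed auto

lemma sum_torus_green_diff: "n > 0 \<Longrightarrow> (\<Sum>x\<in>torus n. green_diff n x) = (real n)\<^sup>2 * green n (0,0)"
  by (simp add: green_diff_def sum_subtractf sum_torus_green card_torus)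

text \<open>Here \<open>I - step_avg\<close> turns \<open>green_diff\<close> into the constant
  \<open>1 / n^2\<close> minus a point mass at the origin. The function vanishes at the origin, so
  its energy is its mean.\<close>

lemma dirichlet_form_green_diff:
  assumes n: "n > 0"
  shows "(\<Sum>x\<in>torus n. green_diff n x * (green_diff n x - step_avg (green_diff n) x)) = green n (0,0)"
proof -
  have "green_diff n x - step_avg (green_diff n) x = 1 / (real n)\<^sup>2 - (if proj n ((0,0) - x) = (0,0) then 1 else 0)" for x
  proof -
    have "green_diff n x - step_avg (green_diff n) x = - (green n x - step_avg (green n) x)"
      unfolding green_diff_def [abs_def] step_avg_diff by simp
    moreover have "proj n ((0,0) - x) = (0,0) \<longleftrightarrow> proj n x = (0,0)"
      unfolding proj_def prod.inject dvd_eq_mod_eq_0 [symmetric] by simp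
    ultimately show ?thesis unfolding green_step[OF n] by simp
  qed
  hence "(\<Sum>x\<in>torus n. green_diff n x * (green_diff n x - step_avg (green_diff n) x))
      = (\<Sum>x\<in>torus n. green_diff n x) / (real n)\<^sup>2
        - (\<Sum>x\<in>torus n. green_diff n x * (if proj n ((0,0) - x) = (0,0) then 1 else 0))"
    by (simp only: right_diff_distrib sum_subtractf) (simp add: sum_divide_distrib)
  also have "\<dots> = green n (0,0)"
    unfolding sum_torus_delta[OF n periodic_green_diff[OF n]] using n by (simp add: sum_torus_green_diff)
  finally show ?thesis .
qed

text \<open>The test function is \<open>green_diff n\<close>, set to zero on \<open>B\<close>.\<close>

lemma eigenvalue_test_bound:
  assumes n: "n > 0" and B: "B \<subseteq> torus n"
    and top: "\<And>f. periodic n f \<Longrightarrow> (\<And>x. proj n x \<in> B \<Longrightarrow> f x = 0) \<Longrightarrow>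
        (\<Sum>x\<in>torus n. f x * step_avg f x) \<le> l * (\<Sum>x\<in>torus n. (f x)\<^sup>2)"
    and l: "l \<le> 1" and K: "\<And>x. x \<in> B \<Longrightarrow> green_diff n x \<le> K"
    and big: "real (card B) * K / (real n)\<^sup>2 \<le> green n (0,0)"
  shows "(real n)\<^sup>2 * (1 - l) * (green n (0,0) - real (card B) * K / (real n)\<^sup>2)\<^sup>2
    \<le> 2 * green n (0,0) + 4 * real (card B) * K\<^sup>2"
proof -
  define F where "F = green_diff n"
  define h where "h x = (if proj n x \<in> B then - F x else 0)" for x
  define f where "f x = F x + h x" for x
  have proj_idem: "proj n (proj n x) = proj n x" for x using proj_in_torus[OF n] proj_torus by blast
  have pF: "periodic n F" unfolding F_def by (rule periodic_green_diff[OF n])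
  have ph: "periodic n h" unfolding periodic_def h_def proj_idem periodicD[OF pF] by simp
  have pf: "periodic n f" using pF ph by (simp add: periodic_def f_def)
  have sumB: "(\<Sum>x\<in>torus n. if proj n x \<in> B then g x else 0) = (\<Sum>x\<in>B. g x)" for g :: "int \<times> int \<Rightarrow> real"
  proof -
    have "(\<Sum>x\<in>torus n. if proj n x \<in> B then g x else 0) = (\<Sum>x\<in>torus n. if x \<in> B then g x else 0)"
      by (intro sum.cong) (auto simp: proj_torus)
    also have "\<dots> = (\<Sum>x\<in>torus n \<inter> B. g x)" by (simp add: sum.inter_restrict)
    finally show ?thesis using B by (simp add: Int_absorb1)
  qed
  have h2: "(\<Sum>x\<in>torus n. (h x)\<^sup>2) \<le> real (card B) * K\<^sup>2"
  proof -
    have "(\<Sum>x\<in>torus n. (h x)\<^sup>2) = (\<Sum>x\<in>torus n. if proj n x \<in> B then (F x)\<^sup>2 else 0)"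
      by (intro sum.cong) (auto simp: h_def)
    also have "\<dots> = (\<Sum>x\<in>B. (F x)\<^sup>2)" by (rule sumB)
    also have "\<dots> \<le> (\<Sum>x\<in>B. K\<^sup>2)"
      using K by (intro sum_mono power_mono) (auto simp: F_def green_diff_nonneg)
    finally show ?thesis by simp
  qed
  have sum_f: "(real n)\<^sup>2 * (green n (0,0) - real (card B) * K / (real n)\<^sup>2) \<le> (\<Sum>x\<in>torus n. f x)"
  proof -
    have "(\<Sum>x\<in>torus n. h x) = - (\<Sum>x\<in>B. F x)"
      using sumB[of "\<lambda>x. - F x"] by (simp add: h_def sum_negf)
    moreover have "(\<Sum>x\<in>B. F x) \<le> real (card B) * K" using sum_bounded_above[of B F K] K by (simp add: F_def)
    moreover have "(\<Sum>x\<in>torus n. F x) = (real n)\<^sup>2 * green n (0,0)" unfolding F_def by (rule sum_torus_green_diff[OF n])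
    ultimately show ?thesis using n by (simp add: f_def sum.distrib right_diff_distrib)
  qed
  \<comment> \<open>The mean of \<open>f\<close> is still about \<open>green n (0,0)\<close>, and
    Cauchy-Schwarz converts this into a lower bound for its square norm.\<close>
  have "((real n)\<^sup>2 * (green n (0,0) - real (card B) * K / (real n)\<^sup>2))\<^sup>2 \<le> (\<Sum>x\<in>torus n. f x)\<^sup>2"
    using sum_f big by (intro power_mono) auto
  also have "\<dots> \<le> (real n)\<^sup>2 * (\<Sum>x\<in>torus n. (f x)\<^sup>2)" by (rule torus_Cauchy_Schwarz)
  also have "((real n)\<^sup>2 * (green n (0,0) - real (card B) * K / (real n)\<^sup>2))\<^sup>2
      = (real n)\<^sup>2 * ((real n)\<^sup>2 * (green n (0,0) - real (card B) * K / (real n)\<^sup>2)\<^sup>2)"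
    unfolding power_mult_distrib power2_eq_square[of "(real n)\<^sup>2"] by (simp only: mult.assoc)
  finally have "(real n)\<^sup>2 * ((real n)\<^sup>2 * (green n (0,0) - real (card B) * K / (real n)\<^sup>2)\<^sup>2) \<le> (real n)\<^sup>2 * (\<Sum>x\<in>torus n. (f x)\<^sup>2)" .
  hence f2: "(real n)\<^sup>2 * (green n (0,0) - real (card B) * K / (real n)\<^sup>2)\<^sup>2 \<le> (\<Sum>x\<in>torus n. (f x)\<^sup>2)"
    using n by (simp only: mult_le_cancel_left_pos zero_less_power of_nat_0_less_iff)
  have "(\<Sum>x\<in>torus n. f x * step_avg f x) \<le> l * (\<Sum>x\<in>torus n. (f x)\<^sup>2)"
    by (rule top[OF pf]) (simp add: f_def h_def)
  hence "(1 - l) * (\<Sum>x\<in>torus n. (f x)\<^sup>2) \<le> (\<Sum>x\<in>torus n. f x * (f x - step_avg f x))"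
    by (simp add: algebra_simps sum_subtractf power2_eq_square)
  \<comment> \<open>The correction \<open>h\<close> on \<open>B\<close> is separated at the price of
    a factor 2; its energy is bounded because it lives on few points.\<close>
  also have "\<dots> \<le> 2 * (\<Sum>x\<in>torus n. F x * (F x - step_avg F x)) + 2 * (\<Sum>x\<in>torus n. h x * (h x - step_avg h x))"
    unfolding f_def [abs_def] by (rule dirichlet_form_add_le[OF n pF ph])
  also have "\<dots> \<le> 2 * green n (0,0) + 2 * (2 * (real (card B) * K\<^sup>2))"
    using dirichlet_form_green_diff[OF n] dirichlet_form_le[OF n ph] h2 unfolding F_def by linarith
  finally have "(1 - l) * (\<Sum>x\<in>torus n. (f x)\<^sup>2) \<le> 2 * green n (0,0) + 4 * real (card B) * K\<^sup>2" by simp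
  moreover have "(1 - l) * ((real n)\<^sup>2 * (green n (0,0) - real (card B) * K / (real n)\<^sup>2)\<^sup>2)
      \<le> (1 - l) * (\<Sum>x\<in>torus n. (f x)\<^sup>2)"
    using f2 l by (intro mult_left_mono) auto
  ultimately show ?thesis by (simp add: mult_ac)
qed

text \<open>Here \<open>\<epsilon>\<close> is \<open>n^2\<close> times one minus the principal
  eigenvalue, and \<open>\<delta>\<close> is the variance of the eigenfunction \<open>\<psi>\<close>
  normalised to mean one. All bounds on uncovered probabilities hold for every \<open>t\<close> with
  the same \<open>\<epsilon>\<close> and \<open>\<delta>\<close>.\<close>

lemma torus_eigenvalue_estimates:
  assumes n: "n > 0" and A: "finite A" "(0,0) \<in> A" "card A < n\<^sup>2"
  defines "K \<equiv> \<Sum>z\<in>A. green_diff n z"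
  assumes big: "real (card A) * K / (real n)\<^sup>2 \<le> green n (0,0)"
  obtains \<epsilon> \<delta> where "0 \<le> \<epsilon>" "\<epsilon> \<le> (real n)\<^sup>2" "0 \<le> \<delta>"
    "\<And>t. uncovered_prob n (proj n ` A) t \<le> (1 - \<epsilon> / (real n)\<^sup>2) ^ nat \<lfloor>t\<rfloor>"
    "\<And>t. (2 / (1 + \<delta>) - 1) * (1 - \<epsilon> / (real n)\<^sup>2) ^ nat \<lfloor>t\<rfloor> \<le> uncovered_prob n (proj n ` A) t"
    "2 * \<delta> \<le> \<epsilon> * (1 + \<delta>)"
    "\<epsilon> * (green n (0,0) - real (card A) * K / (real n)\<^sup>2)\<^sup>2 \<le> 2 * green n (0,0) + 4 * real (card A) * K\<^sup>2"
    "\<bar>1 - \<epsilon> * (green n (0,0) - cap A)\<bar> \<le> \<epsilon> *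
      ((\<Sum>z\<in>A. \<bar>(\<Sum>x\<in>A. hm A x * green_diff n (x - z)) - cap A\<bar>) + (\<Sum>x\<in>A. \<bar>hm A x\<bar>) * sqrt (7 * \<delta>))"
proof -
  define N where "N = (real n)\<^sup>2"
  have N: "N > 0" using n by (simp add: N_def)
  define B where "B = proj n ` A"
  have B: "B \<subseteq> torus n" using proj_in_torus[OF n] by (auto simp: B_def)
  have cB: "card B \<le> card A" unfolding B_def using A(1) by (rule card_image_le)
  have "B \<noteq> torus n" using cB A(3) card_torus[of n] by auto
  hence Bs: "B \<subset> torus n" using B by blast
  have pA: "proj n x \<in> B" if "x \<in> A" for x using that by (simp add: B_def)
  obtain l \<phi> where l: "l \<ge> 0" and per: "periodic n \<phi>" and nn: "\<And>x. \<phi> x \<ge> 0"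
    and unit: "(\<Sum>x\<in>torus n. (\<phi> x)\<^sup>2) = 1"
    and zero: "\<And>x. proj n x \<in> B \<Longrightarrow> \<phi> x = 0"
    and ev: "\<And>x. proj n x \<notin> B \<Longrightarrow> step_avg \<phi> x = l * \<phi> x"
    and top: "\<And>f. periodic n f \<Longrightarrow> (\<And>x. proj n x \<in> B \<Longrightarrow> f x = 0) \<Longrightarrow>
        (\<Sum>x\<in>torus n. f x * step_avg f x) \<le> l * (\<Sum>x\<in>torus n. (f x)\<^sup>2)"
    and unc: "\<And>t. \<bar>N * uncovered_prob n B t - (\<Sum>x\<in>torus n. \<phi> x)\<^sup>2 * l ^ nat \<lfloor>t\<rfloor>\<bar>
        \<le> (N - (\<Sum>x\<in>torus n. \<phi> x)\<^sup>2) * l ^ nat \<lfloor>t\<rfloor>"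
    using torus_principal_eigenfunction[OF n Bs] unfolding N_def by blast
  define M where "M = (\<Sum>x\<in>torus n. \<phi> x)"
  have M: "M > 0"
  proof -
    have "M \<ge> 0" unfolding M_def by (intro sum_nonneg nn)
    moreover have "M \<noteq> 0"
    proof
      assume "M = 0"
      hence "\<And>x. x \<in> torus n \<Longrightarrow> \<phi> x = 0" unfolding M_def using nn by (simp add: sum_nonneg_eq_0_iff)
      thus False using unit by simp
    qed
    ultimately show ?thesis by simp
  qed
  define \<psi> where "\<psi> x = N / M * \<phi> x" for x
  have per\<psi>: "periodic n \<psi>" using per by (simp add: periodic_def \<psi>_def)
  have nn\<psi>: "\<psi> x \<ge> 0" for x using nn[of x] M N by (simp add: \<psi>_def)
  have zero\<psi>: "\<psi> x = 0" if "proj n x \<in> B" for x using zero[OF that] by (simp add: \<psi>_def)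
  have avg\<psi>: "step_avg \<psi> x = N / M * step_avg \<phi> x" for x
    unfolding \<psi>_def [abs_def] by (rule step_avg_cmult)
  have ev\<psi>: "step_avg \<psi> x = l * \<psi> x" if "proj n x \<notin> B" for x
    unfolding avg\<psi> ev[OF that] by (simp add: \<psi>_def)
  have sum\<psi>: "(\<Sum>x\<in>torus n. \<psi> x) = N"
    using M unfolding \<psi>_def sum_distrib_left [symmetric] M_def [symmetric] by simp
  have card_N: "real (card (torus n)) = N" by (simp add: card_torus N_def)
  define \<delta> where "\<delta> = (\<Sum>x\<in>torus n. (\<psi> x - 1)\<^sup>2) / N"
  have \<delta>: "\<delta> \<ge> 0" unfolding \<delta>_def using N by (intro divide_nonneg_pos sum_nonneg) auto
  have N\<delta>: "(\<Sum>x\<in>torus n. (\<psi> x - 1)\<^sup>2) = N * \<delta>" using N by (simp add: \<delta>_def)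
  have sum\<psi>2: "(\<Sum>x\<in>torus n. (\<psi> x)\<^sup>2) = N * (1 + \<delta>)"
  proof -
    have "(\<Sum>x\<in>torus n. (\<psi> x)\<^sup>2) = (\<Sum>x\<in>torus n. (\<psi> x - 1)\<^sup>2 + 2 * \<psi> x - 1)"
      by (intro sum.cong) (auto simp: power2_diff)
    also have "\<dots> = N * \<delta> + 2 * N - N"
      unfolding sum.distrib sum_subtractf sum_distrib_left [symmetric] N\<delta> sum\<psi> by (simp add: card_N)
    finally show ?thesis by (simp add: algebra_simps)
  qed
  \<comment> \<open>The squared overlap of the unit eigenfunction with the constant 1. Main term
    minus error in the Perron bound then gives the factor
    \<open>2 / (1 + \<delta>) - 1\<close>.\<close>
  have M2: "M\<^sup>2 = N / (1 + \<delta>)"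
  proof -
    have "(\<Sum>x\<in>torus n. (\<psi> x)\<^sup>2) = (N / M)\<^sup>2 * 1"
      unfolding \<psi>_def power_mult_distrib sum_distrib_left [symmetric] unit ..
    hence "(N / M)\<^sup>2 = N * (1 + \<delta>)" using sum\<psi>2 by simp
    hence "N\<^sup>2 = N * (1 + \<delta>) * M\<^sup>2" using M by (simp add: power_divide field_simps)
    hence "N = (1 + \<delta>) * M\<^sup>2" using N by (simp add: power2_eq_square)
    thus ?thesis using \<delta> by (simp add: field_simps)
  qed
  have form\<psi>: "(\<Sum>x\<in>torus n. \<psi> x * (\<psi> x - step_avg \<psi> x)) = (1 - l) * (N * (1 + \<delta>))"
  proof -
    have "(\<Sum>x\<in>torus n. \<psi> x * (\<psi> x - step_avg \<psi> x)) = (\<Sum>x\<in>torus n. (1 - l) * (\<psi> x)\<^sup>2)"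
    proof (rule sum.cong [OF refl])
      fix x
      show "\<psi> x * (\<psi> x - step_avg \<psi> x) = (1 - l) * (\<psi> x)\<^sup>2"
        using zero\<psi>[of x] ev\<psi>[of x] by (cases "proj n x \<in> B") (auto simp: power2_eq_square algebra_simps)
    qed
    thus ?thesis unfolding sum_distrib_left [symmetric] sum\<psi>2 .
  qed
  have l1: "l \<le> 1"
  proof -
    have "0 \<le> (1 - l) * (N * (1 + \<delta>))" using dirichlet_form_nonneg[OF n per\<psi>] form\<psi> by simp
    moreover have "0 < N * (1 + \<delta>)" using N \<delta> by simp
    ultimately show ?thesis by (simp add: zero_le_mult_iff)
  qed
  define \<epsilon> where "\<epsilon> = N * (1 - l)"
  have \<epsilon>: "0 \<le> \<epsilon>" "\<epsilon> \<le> N" using l l1 N by (auto simp: \<epsilon>_def mult_left_le)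
  have l_\<epsilon>: "l = 1 - \<epsilon> / N" using N by (simp add: \<epsilon>_def)
  show ?thesis
  proof (rule that[of \<epsilon> \<delta>], unfold N_def [symmetric] B_def [symmetric] l_\<epsilon> [symmetric])
    show "0 \<le> \<epsilon>" "\<epsilon> \<le> N" "0 \<le> \<delta>" using \<epsilon> \<delta> by auto
    fix t :: real
    let ?m = "nat \<lfloor>t\<rfloor>"
    have b: "\<bar>N * uncovered_prob n B t - M\<^sup>2 * l ^ ?m\<bar> \<le> (N - M\<^sup>2) * l ^ ?m"
      using unc[of t] by (simp add: M_def)
    have "(N - M\<^sup>2) * l ^ ?m = N * l ^ ?m - M\<^sup>2 * l ^ ?m"
      "N * ((2 / (1 + \<delta>) - 1) * l ^ ?m) = 2 * (M\<^sup>2 * l ^ ?m) - N * l ^ ?m"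
      unfolding M2 by (simp_all add: algebra_simps)
    with b have "N * uncovered_prob n B t \<le> N * l ^ ?m"
      "N * ((2 / (1 + \<delta>) - 1) * l ^ ?m) \<le> N * uncovered_prob n B t"
      by linarith+
    thus "uncovered_prob n B t \<le> l ^ ?m" "(2 / (1 + \<delta>) - 1) * l ^ ?m \<le> uncovered_prob n B t"
      using N by (simp_all only: mult_le_cancel_left_pos)
  next
    \<comment> \<open>Spectral gap for \<open>\<psi>\<close>: its variance is paid for by its
      energy, which the eigenvalue equation expresses through \<open>\<epsilon>\<close>.\<close>
    have "2 / N * (N * (1 + \<delta>) - N\<^sup>2 / N) \<le> (1 - l) * (N * (1 + \<delta>))"
      using spectral_gap[OF n per\<psi>] unfolding form\<psi> sum\<psi> sum\<psi>2 N_def [symmetric] .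
    moreover have "2 / N * (N * (1 + \<delta>) - N\<^sup>2 / N) = 2 * \<delta>" using N by (simp add: power2_eq_square field_simps)
    ultimately show "2 * \<delta> \<le> \<epsilon> * (1 + \<delta>)" by (simp add: \<epsilon>_def mult_ac)
  next
    have K0: "K \<ge> 0" unfolding K_def by (intro sum_nonneg green_diff_nonneg)
    have KB: "green_diff n x \<le> K" if "x \<in> B" for x
    proof -
      from that obtain z where z: "z \<in> A" "x = proj n z" by (auto simp: B_def)
      have "green_diff n x = green_diff n z" using periodicD[OF periodic_green_diff[OF n]] z by simp
      also have "\<dots> \<le> K" unfolding K_def using z A(1) by (intro member_le_sum green_diff_nonneg)
      finally show ?thesis .
    qed
    have BA: "real (card B) * K / N \<le> real (card A) * K / N"
      using cB K0 N by (intro divide_right_mono mult_right_mono) auto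
    hence big': "real (card B) * K / N \<le> green n (0,0)" using big unfolding N_def by linarith
    \<comment> \<open>The bracket stays nonnegative by \<open>big\<close>, so squaring preserves the
      comparison between the sizes of \<open>A\<close> and \<open>B\<close>.\<close>
    have "\<epsilon> * (green n (0,0) - real (card A) * K / N)\<^sup>2 \<le> \<epsilon> * (green n (0,0) - real (card B) * K / N)\<^sup>2"
      using big BA \<epsilon> unfolding N_def by (intro mult_left_mono power_mono) auto
    also have "\<dots> \<le> 2 * green n (0,0) + 4 * real (card B) * K\<^sup>2"
      using eigenvalue_test_bound[OF n B top l1 KB] big' unfolding \<epsilon>_def N_def by blast
    also have "\<dots> \<le> 2 * green n (0,0) + 4 * real (card A) * K\<^sup>2"
      using cB by (intro add_left_mono mult_right_mono) auto
    finally show "\<epsilon> * (green n (0,0) - real (card A) * K / N)\<^sup>2 \<le> 2 * green n (0,0) + 4 * real (card A) * K\<^sup>2" .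
  next
    \<comment> \<open>The flux of \<open>\<psi>\<close> into \<open>B\<close>, that is, the defect
      of the eigenvalue equation there. Its total mass is \<open>\<epsilon>\<close>, so
      \<open>\<rho>\<close> is \<open>\<epsilon>\<close> times the unknown probability vector
      \<open>\<nu>\<close>.\<close>
    define \<rho> where "\<rho> x = (if proj n x \<in> B then step_avg \<psi> x else 0)" for x
    have \<rho>nn: "\<rho> x \<ge> 0" for x
    proof -
      have "0 \<le> step_avg \<psi> x" unfolding step_avg_def by (intro divide_nonneg_pos sum_nonneg nn\<psi>) simp
      thus ?thesis by (simp add: \<rho>_def)
    qed
    have lap: "\<psi> y - step_avg \<psi> y = (1 - l) * \<psi> y - \<rho> y" for y
      using zero\<psi>[of y] ev\<psi>[of y] by (cases "proj n y \<in> B") (auto simp: \<rho>_def algebra_simps)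
    have sum\<rho>: "(\<Sum>y\<in>torus n. \<rho> y) = \<epsilon>"
    proof -
      have "0 = (\<Sum>y\<in>torus n. \<psi> y - step_avg \<psi> y)"
        using sum_torus_step_avg[OF n per\<psi>] by (simp add: sum_subtractf)
      also have "\<dots> = (1 - l) * N - (\<Sum>y\<in>torus n. \<rho> y)"
        unfolding lap sum_subtractf sum_distrib_left [symmetric] sum\<psi> ..
      finally show ?thesis by (simp add: \<epsilon>_def mult.commute)
    qed
    define R where "R x = (\<Sum>y\<in>torus n. green n (x - y) * (\<psi> y - 1))" for x
    \<comment> \<open>Cauchy-Schwarz against the square sum of the Green function. Both factors are
      of order \<open>N\<close> up to \<open>\<delta>\<close>, and the prefactor
      \<open>1 - l\<close> later turns \<open>N\<close> into \<open>\<epsilon>\<close>.\<close>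
    have R: "\<bar>R x\<bar> \<le> N * sqrt (7 * \<delta>)" for x
    proof -
      have "(R x)\<^sup>2 \<le> (\<Sum>y\<in>torus n. (green n (x - y))\<^sup>2) * (\<Sum>y\<in>torus n. (\<psi> y - 1)\<^sup>2)"
        unfolding R_def by (rule Cauchy_Schwarz_ineq_sum)
      also have "\<dots> \<le> (7 * N) * (N * \<delta>)"
        unfolding N\<delta> N_def using sum_torus_green_squared[OF n, of x] \<delta> by (intro mult_right_mono) auto
      also have "\<dots> = (N * sqrt (7 * \<delta>))\<^sup>2" using \<delta> by (simp add: power_mult_distrib power2_eq_square)
      finally have "\<bar>R x\<bar> \<le> \<bar>N * sqrt (7 * \<delta>)\<bar>" by (simp only: abs_le_square_iff)
      thus ?thesis using N \<delta> by simp
    qed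
    have sum_green: "(\<Sum>y\<in>torus n. green n (x - y)) = 0" for x
    proof -
      have "(\<Sum>y\<in>torus n. green n (x - y)) = (\<Sum>y\<in>torus n. green n (y + - x))"
        by (intro sum.cong) (simp_all add: green_minus [of n "x - _", symmetric])
      also have "\<dots> = 0" unfolding sum_torus_shift[OF n periodic_green[OF n]] by (rule sum_torus_green[OF n])
      finally show ?thesis .
    qed
    have eq: "1 = green n (0,0) * \<epsilon> - (\<Sum>y\<in>torus n. green_diff n (x - y) * \<rho> y) - (1 - l) * R x"
      if x: "x \<in> A" for x
    proof -
      \<comment> \<open>At a point of \<open>A\<close> the value of \<open>\<psi>\<close> is 0 and
        its mean is 1. Afterwards \<open>\<psi>\<close> may be replaced by
        \<open>\<psi> - 1\<close>, since the Green function sums to zero.\<close>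
      have "- 1 = (\<Sum>y\<in>torus n. green n (x - y) * (\<psi> y - step_avg \<psi> y))"
        using green_representation[OF n per\<psi>, of x] zero\<psi>[OF pA[OF x]] sum\<psi> N by (simp add: N_def)
      also have "\<dots> = (\<Sum>y\<in>torus n. (1 - l) * (green n (x - y) * (\<psi> y - 1)) + (1 - l) * green n (x - y)
          - (green n (0,0) * \<rho> y - green_diff n (x - y) * \<rho> y))"
        unfolding lap by (intro sum.cong) (auto simp: green_diff_def algebra_simps)
      also have "\<dots> = (1 - l) * R x - (green n (0,0) * \<epsilon> - (\<Sum>y\<in>torus n. green_diff n (x - y) * \<rho> y))"
        unfolding sum.distrib sum_subtractf sum_distrib_left [symmetric] R_def sum_green sum\<rho> by simp
      finally show ?thesis by linarith
    qed
    let ?w = "hm A"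
    define \<eta> where "\<eta> = (\<Sum>z\<in>A. \<bar>(\<Sum>x\<in>A. ?w x * green_diff n (x - z)) - cap A\<bar>)"
    define W where "W = (\<Sum>x\<in>A. \<bar>?w x\<bar>)"
    have w1: "(\<Sum>x\<in>A. ?w x) = 1" using A by (intro hm_equilibrium(1))
    \<comment> \<open>Averaging over \<open>A\<close> with harmonic weights moves the kernel onto
      \<open>hm A\<close>, whose potential is nearly \<open>cap A\<close> at every point of the
      support of \<open>\<rho>\<close>.\<close>
    define T where "T = (\<Sum>y\<in>torus n. \<rho> y * (\<Sum>x\<in>A. ?w x * green_diff n (x - y)))"
    have "(\<Sum>x\<in>A. ?w x * 1)
        = (\<Sum>x\<in>A. ?w x * (green n (0,0) * \<epsilon> - (\<Sum>y\<in>torus n. green_diff n (x - y) * \<rho> y) - (1 - l) * R x))"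
      by (intro sum.cong refl arg_cong2[where f = "(*)"] eq)
    also have "\<dots> = green n (0,0) * \<epsilon> * (\<Sum>x\<in>A. ?w x)
        - (\<Sum>x\<in>A. \<Sum>y\<in>torus n. \<rho> y * (?w x * green_diff n (x - y))) - (1 - l) * (\<Sum>x\<in>A. ?w x * R x)"
      by (simp add: right_diff_distrib sum_subtractf sum_distrib_left sum_distrib_right mult_ac)
    also have "(\<Sum>x\<in>A. \<Sum>y\<in>torus n. \<rho> y * (?w x * green_diff n (x - y))) = T"
      unfolding T_def sum_distrib_left by (rule sum.swap)
    finally have main: "1 = green n (0,0) * \<epsilon> - T - (1 - l) * (\<Sum>x\<in>A. ?w x * R x)"
      using w1 by simp
    have T: "\<bar>T - \<epsilon> * cap A\<bar> \<le> \<epsilon> * \<eta>"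
    proof -
      have "T - \<epsilon> * cap A = (\<Sum>y\<in>torus n. \<rho> y * ((\<Sum>x\<in>A. ?w x * green_diff n (x - y)) - cap A))"
        unfolding T_def sum\<rho> [symmetric] by (simp add: right_diff_distrib sum_subtractf sum_distrib_right)
      also have "\<bar>\<dots>\<bar> \<le> (\<Sum>y\<in>torus n. \<bar>\<rho> y * ((\<Sum>x\<in>A. ?w x * green_diff n (x - y)) - cap A)\<bar>)"
        by (rule sum_abs)
      also have "\<dots> \<le> (\<Sum>y\<in>torus n. \<rho> y * \<eta>)"
      proof (rule sum_mono)
        fix y assume y: "y \<in> torus n"
        show "\<bar>\<rho> y * ((\<Sum>x\<in>A. ?w x * green_diff n (x - y)) - cap A)\<bar> \<le> \<rho> y * \<eta>"
        proof (cases "proj n y \<in> B")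
          case False
          thus ?thesis by (simp add: \<rho>_def)
        next
          case True
          \<comment> \<open>A torus representative is traded for the point of \<open>A\<close> it
            comes from; in the fixed position \<open>z\<close> the kernel converges to
            \<open>pot\<close>.\<close>
          then obtain z where z: "z \<in> A" "y = proj n z" using proj_torus[OF y] by (auto simp: B_def)
          have "green_diff n (x - y) = green_diff n (x - z)" for x
            using periodicD[OF periodic_reflect[OF periodic_green_diff[OF n]], of x z] z by simp
          hence "\<bar>(\<Sum>x\<in>A. ?w x * green_diff n (x - y)) - cap A\<bar> \<le> \<eta>"
            unfolding \<eta>_def using z A(1) by (simp, intro member_le_sum) auto
          thus ?thesis using \<rho>nn[of y] by (simp add: abs_mult mult_left_mono)
        qed
      qed
      also have "\<dots> = \<epsilon> * \<eta>" unfolding sum_distrib_right [symmetric] sum\<rho> ..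
      finally show ?thesis .
    qed
    have "\<bar>\<Sum>x\<in>A. ?w x * R x\<bar> \<le> (\<Sum>x\<in>A. \<bar>?w x * R x\<bar>)" by (rule sum_abs)
    also have "\<dots> \<le> (\<Sum>x\<in>A. \<bar>?w x\<bar> * (N * sqrt (7 * \<delta>)))"
      unfolding abs_mult by (intro sum_mono mult_left_mono R) auto
    also have "\<dots> = W * (N * sqrt (7 * \<delta>))" unfolding W_def sum_distrib_right ..
    finally have "(1 - l) * \<bar>\<Sum>x\<in>A. ?w x * R x\<bar> \<le> (1 - l) * (W * (N * sqrt (7 * \<delta>)))"
      using l1 by (intro mult_left_mono) auto
    also have "\<dots> = \<epsilon> * (W * sqrt (7 * \<delta>))" by (simp add: \<epsilon>_def mult_ac)
    finally have Rw: "\<bar>(1 - l) * (\<Sum>x\<in>A. ?w x * R x)\<bar> \<le> \<epsilon> * (W * sqrt (7 * \<delta>))"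
      using l1 by (simp add: abs_mult)
    have "1 - \<epsilon> * (green n (0,0) - cap A) = - (T - \<epsilon> * cap A) - (1 - l) * (\<Sum>x\<in>A. ?w x * R x)"
      using main by (simp add: algebra_simps)
    hence "\<bar>1 - \<epsilon> * (green n (0,0) - cap A)\<bar> \<le> \<epsilon> * \<eta> + \<epsilon> * (W * sqrt (7 * \<delta>))"
      using T Rw by linarith
    thus "\<bar>1 - \<epsilon> * (green n (0,0) - cap A)\<bar> \<le> \<epsilon> *
      ((\<Sum>z\<in>A. \<bar>(\<Sum>x\<in>A. hm A x * green_diff n (x - z)) - cap A\<bar>) + (\<Sum>x\<in>A. \<bar>hm A x\<bar>) * sqrt (7 * \<delta>))"
      unfolding \<eta>_def W_def by (simp add: distrib_left)
  qed
qed

lemma green_zero_at_top: "filterlim (\<lambda>n. green n (0,0)) at_top sequentially"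
proof (rule filterlim_at_top_mono)
  show "filterlim (\<lambda>n. 2 / pi * ln (real n) - 3) at_top sequentially" by real_asymp
  show "\<forall>\<^sub>F n in sequentially. 2 / pi * ln (real n) - 3 \<le> green n (0,0)"
    using eventually_ge_at_top[of 1] by eventually_elim (rule green_zero_bounds)
qed

lemma green_zero_ln: "(\<lambda>n. green n (0,0) / ln (real n)) \<longlonglongrightarrow> 2 / pi"
proof (rule tendsto_sandwich)
  show "(\<lambda>n. (2 / pi * ln (real n) - 3) / ln (real n)) \<longlonglongrightarrow> 2 / pi" by real_asymp
  show "(\<lambda>n. (2 / pi * ln (real n) + 4) / ln (real n)) \<longlonglongrightarrow> 2 / pi" by real_asymp
  show "\<forall>\<^sub>F n in sequentially. (2 / pi * ln (real n) - 3) / ln (real n) \<le> green n (0,0) / ln (real n)"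
    "\<forall>\<^sub>F n in sequentially. green n (0,0) / ln (real n) \<le> (2 / pi * ln (real n) + 4) / ln (real n)"
    using eventually_ge_at_top[of 1]
    by (eventually_elim, intro divide_right_mono green_zero_bounds; simp)+
qed

section \<open>The limit\<close>

text \<open>Along \<open>n\<close>, first \<open>\<epsilon>\<close> tends to 0, then
  \<open>\<delta>\<close>, and then the Green function identity divided by \<open>\<epsilon>\<close>
  becomes exact to o(1).\<close>

lemma uncovered_asymptotics:
  assumes A: "finite A" "(0,0) \<in> A"
  obtains \<epsilon> where "\<forall>\<^sub>F n in sequentially. 0 < \<epsilon> n \<and> \<epsilon> n \<le> 1"
    "(\<lambda>n. 1 / \<epsilon> n - green n (0,0)) \<longlonglongrightarrow> - cap A"
    "\<And>s. (\<lambda>n. uncovered_prob n (proj n ` A) (s n) / (1 - \<epsilon> n / (real n)\<^sup>2) ^ nat \<lfloor>s n\<rfloor>) \<longlonglongrightarrow> 1"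
proof -
  define K where "K n = (\<Sum>z\<in>A. green_diff n z)" for n
  define a where "a = real (card A)"
  define g where "g n = green n (0,0)" for n
  define \<eta> where "\<eta> n = (\<Sum>z\<in>A. \<bar>(\<Sum>x\<in>A. hm A x * green_diff n (x - z)) - cap A\<bar>)" for n
  define W where "W = (\<Sum>x\<in>A. \<bar>hm A x\<bar>)"
  \<comment> \<open>Bundles the estimates for one torus, so that a single choice yields the
    sequences \<open>\<epsilon>\<close> and \<open>\<delta>\<close>.\<close>
  define ok where "ok n e d \<longleftrightarrow> 0 \<le> e \<and> e \<le> (real n)\<^sup>2 \<and> 0 \<le> d \<and>
    (\<forall>t. uncovered_prob n (proj n ` A) t \<le> (1 - e / (real n)\<^sup>2) ^ nat \<lfloor>t\<rfloor> \<and>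
      (2 / (1 + d) - 1) * (1 - e / (real n)\<^sup>2) ^ nat \<lfloor>t\<rfloor> \<le> uncovered_prob n (proj n ` A) t) \<and>
    2 * d \<le> e * (1 + d) \<and>
    e * (g n - a * K n / (real n)\<^sup>2)\<^sup>2 \<le> 2 * g n + 4 * a * (K n)\<^sup>2 \<and>
    \<bar>1 - e * (g n - cap A)\<bar> \<le> e * (\<eta> n + W * sqrt (7 * d))" for n e d
  have g_top: "filterlim g at_top sequentially" unfolding g_def by (rule green_zero_at_top)
  have K: "K \<longlonglongrightarrow> (\<Sum>z\<in>A. pot z)" unfolding K_def by (intro tendsto_sum green_diff_tendsto)
  have inv_sq: "(\<lambda>n. 1 / (real n)\<^sup>2) \<longlonglongrightarrow> 0" by real_asymp
  have KN: "(\<lambda>n. a * K n / (real n)\<^sup>2) \<longlonglongrightarrow> 0"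
    using tendsto_mult[OF tendsto_mult[OF tendsto_const K] inv_sq, of a] by simp
  have \<eta>: "\<eta> \<longlonglongrightarrow> 0"
  proof -
    have "\<eta> \<longlonglongrightarrow> (\<Sum>z\<in>A. \<bar>(\<Sum>x\<in>A. hm A x * pot (x - z)) - cap A\<bar>)"
      unfolding \<eta>_def by (intro tendsto_intros green_diff_tendsto)
    moreover have "(\<Sum>x\<in>A. hm A x * pot (x - z)) = cap A" if "z \<in> A" for z
    proof -
      have "pot (x - z) = pot (z - x)" for x using pot_minus[of "z - x"] by simp
      thus ?thesis using hm_equilibrium(2)[OF A that] by (simp add: mult.commute)
    qed
    ultimately show ?thesis by simp
  qed
  have "\<forall>\<^sub>F n in sequentially. n > card A \<and> a * K n / (real n)\<^sup>2 < 1 \<and> 1 \<le> g n"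
    using g_top[unfolded filterlim_at_top, rule_format, of 1]
    by (intro eventually_conj eventually_gt_at_top order_tendstoD(2)[OF KN]) auto
  hence "\<forall>\<^sub>F n in sequentially. \<exists>e d. ok n e d"
  proof eventually_elim
    case (elim n)
    have n: "n > 0" using elim by simp
    have "card A < n\<^sup>2" using elim n by (simp add: power2_eq_square) (metis less_le_trans le_square)
    moreover have "real (card A) * (\<Sum>z\<in>A. green_diff n z) / (real n)\<^sup>2 \<le> green n (0,0)"
      using elim unfolding a_def K_def g_def by linarith
    ultimately show ?case
      by (rule torus_eigenvalue_estimates[OF n A])
         (unfold ok_def g_def a_def K_def \<eta>_def W_def, blast)
  qed
  then obtain n0 where "\<And>n. n \<ge> n0 \<Longrightarrow> \<exists>e d. ok n e d" by (auto simp: eventually_sequentially)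
  then obtain \<epsilon> \<delta> where ok0: "\<And>n. n \<ge> n0 \<Longrightarrow> ok n (\<epsilon> n) (\<delta> n)" by metis
  have ok: "\<forall>\<^sub>F n in sequentially. ok n (\<epsilon> n) (\<delta> n)"
    using ok0 by (auto simp: eventually_sequentially)
  have big: "\<forall>\<^sub>F n in sequentially. a * K n / (real n)\<^sup>2 < 1 \<and> 2 \<le> g n \<and> K n < (\<Sum>z\<in>A. pot z) + 1 \<and> 0 \<le> K n"
    using g_top[unfolded filterlim_at_top, rule_format, of 2]
    by (intro eventually_conj order_tendstoD(2)[OF KN] order_tendstoD(2)[OF K])
       (auto simp: K_def intro!: always_eventually sum_nonneg green_diff_nonneg)
  define c where "c = 4 * a * ((\<Sum>z\<in>A. pot z) + 1)\<^sup>2"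
  have \<epsilon>0: "\<epsilon> \<longlonglongrightarrow> 0"
  proof (rule tendsto_sandwich)
    show "\<forall>\<^sub>F n in sequentially. 0 \<le> \<epsilon> n" using ok by eventually_elim (simp add: ok_def)
    \<comment> \<open>The test function bound has \<open>g\<close> in the numerator and
      \<open>g^2\<close> in the denominator, and \<open>g\<close> diverges.\<close>
    show "\<forall>\<^sub>F n in sequentially. \<epsilon> n \<le> (2 * g n + c) / (g n - 1)\<^sup>2"
      using ok big
    proof eventually_elim
      case (elim n)
      have "\<epsilon> n * (g n - 1)\<^sup>2 \<le> \<epsilon> n * (g n - a * K n / (real n)\<^sup>2)\<^sup>2"
        using elim by (intro mult_left_mono power_mono) (auto simp: ok_def)
      also have "\<dots> \<le> 2 * g n + 4 * a * (K n)\<^sup>2" using elim by (simp add: ok_def)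
      also have "\<dots> \<le> 2 * g n + c"
        unfolding c_def a_def using elim by (intro add_left_mono mult_left_mono power_mono) auto
      finally show ?case using elim by (simp add: le_divide_eq)
    qed
    have "((\<lambda>x::real. (2 * x + c) / (x - 1)\<^sup>2) \<longlongrightarrow> 0) at_top" by real_asymp
    thus "(\<lambda>n. (2 * g n + c) / (g n - 1)\<^sup>2) \<longlonglongrightarrow> 0" by (rule filterlim_compose) (rule g_top)
  qed simp
  have \<epsilon>1: "\<forall>\<^sub>F n in sequentially. \<epsilon> n < 1" using order_tendstoD(2)[OF \<epsilon>0] by simp
  have \<delta>0: "\<delta> \<longlonglongrightarrow> 0"
  proof (rule tendsto_sandwich [OF _ _ tendsto_const \<epsilon>0])
    show "\<forall>\<^sub>F n in sequentially. 0 \<le> \<delta> n" using ok by eventually_elim (simp add: ok_def)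
    \<comment> \<open>For \<open>\<epsilon> < 1\<close>, the bound
      \<open>2 \<delta> <= \<epsilon> + \<epsilon> \<delta>\<close> lets one copy of
      \<open>\<delta>\<close> be absorbed.\<close>
    show "\<forall>\<^sub>F n in sequentially. \<delta> n \<le> \<epsilon> n"
      using ok \<epsilon>1
    proof eventually_elim
      case (elim n)
      have "\<epsilon> n * \<delta> n \<le> 1 * \<delta> n" using elim by (intro mult_right_mono) (auto simp: ok_def)
      moreover have "2 * \<delta> n \<le> \<epsilon> n + \<epsilon> n * \<delta> n" using elim by (simp add: ok_def distrib_left)
      ultimately show ?case by linarith
    qed
  qed
  have pos: "\<forall>\<^sub>F n in sequentially. 0 < \<epsilon> n \<and> \<epsilon> n \<le> 1"
    using ok \<epsilon>1
  proof eventually_elim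
    case (elim n)
    \<comment> \<open>At \<open>\<epsilon> = 0\<close> the last estimate in \<open>ok\<close> would
      read \<open>1 <= 0\<close>.\<close>
    have "\<epsilon> n \<noteq> 0" using elim by (auto simp: ok_def)
    thus ?case using elim by (auto simp: ok_def)
  qed
  have lim: "(\<lambda>n. 1 / \<epsilon> n - green n (0,0)) \<longlonglongrightarrow> - cap A"
  proof -
    have "(\<lambda>n. 1 / \<epsilon> n - (g n - cap A)) \<longlonglongrightarrow> 0"
    proof (rule tendsto_rabs_zero_cancel, rule tendsto_sandwich [of "\<lambda>_. 0"])
      show "(\<lambda>n. \<eta> n + W * sqrt (7 * \<delta> n)) \<longlonglongrightarrow> 0"
        using tendsto_add[OF \<eta> tendsto_mult[OF tendsto_const tendsto_real_sqrt[OF tendsto_mult[OF tendsto_const \<delta>0]]], of W 7]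
        by simp
      show "\<forall>\<^sub>F n in sequentially. \<bar>1 / \<epsilon> n - (g n - cap A)\<bar> \<le> \<eta> n + W * sqrt (7 * \<delta> n)"
        using ok pos
      proof eventually_elim
        case (elim n)
        have "1 / \<epsilon> n - (g n - cap A) = (1 - \<epsilon> n * (g n - cap A)) / \<epsilon> n"
          using elim by (simp add: diff_divide_distrib)
        hence "\<bar>1 / \<epsilon> n - (g n - cap A)\<bar> = \<bar>1 - \<epsilon> n * (g n - cap A)\<bar> / \<epsilon> n"
          using elim by simp
        also have "\<dots> \<le> (\<epsilon> n * (\<eta> n + W * sqrt (7 * \<delta> n))) / \<epsilon> n"
          using elim by (intro divide_right_mono) (auto simp: ok_def)
        finally show ?case using elim by simp
      qed
    qed auto
    hence "(\<lambda>n. (1 / \<epsilon> n - (g n - cap A)) - cap A) \<longlonglongrightarrow> 0 - cap A" by (intro tendsto_intros)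
    thus ?thesis by (simp add: g_def)
  qed
  \<comment> \<open>The two-sided bounds are uniform in time, so the times \<open>s\<close> may
    depend on \<open>n\<close> arbitrarily.\<close>
  have unc: "(\<lambda>n. uncovered_prob n (proj n ` A) (s n) / (1 - \<epsilon> n / (real n)\<^sup>2) ^ nat \<lfloor>s n\<rfloor>) \<longlonglongrightarrow> 1" for s
  proof (rule tendsto_sandwich)
    let ?p = "\<lambda>n. (1 - \<epsilon> n / (real n)\<^sup>2) ^ nat \<lfloor>s n\<rfloor>"
    have ppos: "0 < 1 - e / (real n)\<^sup>2" if "e < 1" "n \<ge> 1" "0 \<le> e" for e and n :: nat
    proof -
      have "1 \<le> (real n)\<^sup>2" using that(2) by (intro one_le_power) simp
      hence "e < (real n)\<^sup>2" using that(1) by linarith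
      thus ?thesis using that by (simp add: divide_less_eq)
    qed
    show "\<forall>\<^sub>F n in sequentially. 2 / (1 + \<delta> n) - 1 \<le> uncovered_prob n (proj n ` A) (s n) / ?p n"
      using ok \<epsilon>1 eventually_ge_at_top[of 1]
    proof eventually_elim
      case (elim n)
      have "0 < ?p n" using elim ppos by (simp add: ok_def)
      thus ?case using elim by (simp add: ok_def le_divide_eq)
    qed
    show "\<forall>\<^sub>F n in sequentially. uncovered_prob n (proj n ` A) (s n) / ?p n \<le> 1"
      using ok \<epsilon>1 eventually_ge_at_top[of 1]
    proof eventually_elim
      case (elim n)
      have "0 < ?p n" using elim ppos by (simp add: ok_def)
      thus ?case using elim by (simp add: ok_def divide_le_eq)
    qed
    have "(\<lambda>n. 2 / (1 + \<delta> n) - 1) \<longlonglongrightarrow> 2 / (1 + 0) - 1"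
      by (intro tendsto_intros \<delta>0) simp
    thus "(\<lambda>n. 2 / (1 + \<delta> n) - 1) \<longlonglongrightarrow> 1" by simp
  qed simp
  show ?thesis by (rule that[OF pos lim unc])
qed

section \<open>The time scale\<close>

lemma abs_ln_one_minus_add_le:
  fixes x :: real
  assumes "0 \<le> x" "x \<le> 1 / 2"
  shows "\<bar>ln (1 - x) + x\<bar> \<le> 2 * x\<^sup>2"
  using abs_ln_one_plus_x_minus_x_bound[of "- x"] assms by simp

text \<open>The bounded discrepancy from \<open>green n (0,0)\<close> is negligible after division
  by \<open>ln n\<close>, so only the leading constant \<open>2 / \<pi>\<close> survives,
  inverted.\<close>

lemma eps_ln_tendsto:
  fixes \<epsilon> :: "nat \<Rightarrow> real"
  assumes "\<forall>\<^sub>F n in sequentially. 0 < \<epsilon> n \<and> \<epsilon> n \<le> 1"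
    and "(\<lambda>n. 1 / \<epsilon> n - green n (0,0)) \<longlonglongrightarrow> c"
  shows "(\<lambda>n. \<epsilon> n * ln (real n)) \<longlonglongrightarrow> pi / 2"
proof -
  have "(\<lambda>n. 1 / ln (real n)) \<longlonglongrightarrow> 0" by real_asymp
  hence "(\<lambda>n. (1 / \<epsilon> n - green n (0,0)) * (1 / ln (real n)) + green n (0,0) / ln (real n)) \<longlonglongrightarrow> c * 0 + 2 / pi"
    by (intro tendsto_intros assms(2) green_zero_ln)
  hence "(\<lambda>n. 1 / (\<epsilon> n * ln (real n))) \<longlonglongrightarrow> 2 / pi"
    by (simp add: diff_divide_distrib)
  hence "(\<lambda>n. inverse (1 / (\<epsilon> n * ln (real n)))) \<longlonglongrightarrow> inverse (2 / pi)"
    by (rule tendsto_inverse) simp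
  thus ?thesis by simp
qed

text \<open>The linearisation error of the logarithm is quadratic in
  \<open>\<epsilon> / n^2\<close>; with \<open>\<epsilon> <= 1\<close>, multiplication by the time
  leaves order \<open>ln^2 n / n^2\<close>.\<close>

lemma times_ln_one_minus_tendsto:
  fixes \<epsilon> :: "nat \<Rightarrow> real"
  assumes "\<forall>\<^sub>F n in sequentially. 0 < \<epsilon> n \<and> \<epsilon> n \<le> 1" and \<alpha>: "\<alpha> > 0"
  shows "(\<lambda>n. real (nat \<lfloor>t_alpha \<alpha> n\<rfloor>) * (ln (1 - \<epsilon> n / (real n)\<^sup>2) + \<epsilon> n / (real n)\<^sup>2)) \<longlonglongrightarrow> 0"
proof (rule tendsto_rabs_zero_cancel, rule tendsto_sandwich [of "\<lambda>_. 0"])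
  show "(\<lambda>n. 4 * \<alpha> / pi * (real n)\<^sup>2 * (ln (real n))\<^sup>2 * (2 * (1 / (real n)\<^sup>2)\<^sup>2)) \<longlonglongrightarrow> 0"
    by real_asymp
  show "\<forall>\<^sub>F n in sequentially. \<bar>real (nat \<lfloor>t_alpha \<alpha> n\<rfloor>) * (ln (1 - \<epsilon> n / (real n)\<^sup>2) + \<epsilon> n / (real n)\<^sup>2)\<bar>
      \<le> 4 * \<alpha> / pi * (real n)\<^sup>2 * (ln (real n))\<^sup>2 * (2 * (1 / (real n)\<^sup>2)\<^sup>2)"
    using assms(1) eventually_ge_at_top[of 2]
  proof eventually_elim
    case (elim n)
    have n4: "4 \<le> (real n)\<^sup>2" using power_mono[of 2 "real n" 2] elim by simp
    have x: "0 \<le> \<epsilon> n / (real n)\<^sup>2" "\<epsilon> n / (real n)\<^sup>2 \<le> 1 / (real n)\<^sup>2"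
      using elim by (auto intro: divide_right_mono)
    have "1 / (real n)\<^sup>2 \<le> 1 / 2" using n4 by (simp add: divide_le_eq)
    hence "\<epsilon> n / (real n)\<^sup>2 \<le> 1 / 2" using x by linarith
    hence "\<bar>ln (1 - \<epsilon> n / (real n)\<^sup>2) + \<epsilon> n / (real n)\<^sup>2\<bar> \<le> 2 * (\<epsilon> n / (real n)\<^sup>2)\<^sup>2"
      by (intro abs_ln_one_minus_add_le x)
    also have "\<dots> \<le> 2 * (1 / (real n)\<^sup>2)\<^sup>2" using x by (intro mult_left_mono power_mono) auto
    finally have b: "\<bar>ln (1 - \<epsilon> n / (real n)\<^sup>2) + \<epsilon> n / (real n)\<^sup>2\<bar> \<le> 2 * (1 / (real n)\<^sup>2)\<^sup>2" .
    have t0: "0 \<le> t_alpha \<alpha> n" using \<alpha> by (simp add: t_alpha_def)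
    hence "real (nat \<lfloor>t_alpha \<alpha> n\<rfloor>) \<le> t_alpha \<alpha> n" by simp
    hence "real (nat \<lfloor>t_alpha \<alpha> n\<rfloor>) * \<bar>ln (1 - \<epsilon> n / (real n)\<^sup>2) + \<epsilon> n / (real n)\<^sup>2\<bar>
        \<le> t_alpha \<alpha> n * (2 * (1 / (real n)\<^sup>2)\<^sup>2)"
      using b t0 by (intro mult_mono) auto
    thus ?case by (simp add: abs_mult t_alpha_def)
  qed
qed auto

lemma nat_floor_t_alpha_ratio:
  assumes \<alpha>: "\<alpha> > 0"
  shows "(\<lambda>n. real (nat \<lfloor>t_alpha \<alpha> n\<rfloor>) / ((real n)\<^sup>2 * (ln (real n))\<^sup>2)) \<longlonglongrightarrow> 4 * \<alpha> / pi"
proof (rule tendsto_sandwich)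
  show "(\<lambda>n. (4 * \<alpha> / pi * (real n)\<^sup>2 * (ln (real n))\<^sup>2 - 1) / ((real n)\<^sup>2 * (ln (real n))\<^sup>2)) \<longlonglongrightarrow> 4 * \<alpha> / pi"
    by real_asymp
  show "(\<lambda>n. (4 * \<alpha> / pi * (real n)\<^sup>2 * (ln (real n))\<^sup>2) / ((real n)\<^sup>2 * (ln (real n))\<^sup>2)) \<longlonglongrightarrow> 4 * \<alpha> / pi"
    by real_asymp
  have t0: "0 \<le> t_alpha \<alpha> n" for n using \<alpha> by (simp add: t_alpha_def)
  have "real (nat \<lfloor>t_alpha \<alpha> n\<rfloor>) \<le> t_alpha \<alpha> n" "t_alpha \<alpha> n - 1 \<le> real (nat \<lfloor>t_alpha \<alpha> n\<rfloor>)" for n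
    using t0[of n] by (simp, linarith)
  thus "\<forall>\<^sub>F n in sequentially. (4 * \<alpha> / pi * (real n)\<^sup>2 * (ln (real n))\<^sup>2 - 1) / ((real n)\<^sup>2 * (ln (real n))\<^sup>2)
      \<le> real (nat \<lfloor>t_alpha \<alpha> n\<rfloor>) / ((real n)\<^sup>2 * (ln (real n))\<^sup>2)"
    "\<forall>\<^sub>F n in sequentially. real (nat \<lfloor>t_alpha \<alpha> n\<rfloor>) / ((real n)\<^sup>2 * (ln (real n))\<^sup>2)
      \<le> (4 * \<alpha> / pi * (real n)\<^sup>2 * (ln (real n))\<^sup>2) / ((real n)\<^sup>2 * (ln (real n))\<^sup>2)"
    by (intro always_eventually allI divide_right_mono; simp add: t_alpha_def)+
qed

theorem theorem2p6:
  fixes \<alpha> :: real and A :: "(int \<times> int) set"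
  assumes "\<alpha> > 0" and "finite A" and "(0,0) \<in> A"
  shows "(\<lambda>n. cond_uncovered n A (t_alpha \<alpha> n)) \<longlonglongrightarrow> exp (- pi * \<alpha> * cap A)"
proof -
  define s where "s = t_alpha \<alpha>"
  define m where "m n = nat \<lfloor>s n\<rfloor>" for n
  obtain \<epsilon> where \<epsilon>: "\<forall>\<^sub>F n in sequentially. 0 < \<epsilon> n \<and> \<epsilon> n \<le> 1"
    "(\<lambda>n. 1 / \<epsilon> n - green n (0,0)) \<longlonglongrightarrow> - cap A"
    "\<And>s. (\<lambda>n. uncovered_prob n (proj n ` A) (s n) / (1 - \<epsilon> n / (real n)\<^sup>2) ^ nat \<lfloor>s n\<rfloor>) \<longlonglongrightarrow> 1"
    using uncovered_asymptotics[OF assms(2,3)] by blast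
  obtain \<omega> where \<omega>: "\<forall>\<^sub>F n in sequentially. 0 < \<omega> n \<and> \<omega> n \<le> 1"
    "(\<lambda>n. 1 / \<omega> n - green n (0,0)) \<longlonglongrightarrow> - cap {(0,0)}"
    "\<And>s. (\<lambda>n. uncovered_prob n (proj n ` {(0,0)}) (s n) / (1 - \<omega> n / (real n)\<^sup>2) ^ nat \<lfloor>s n\<rfloor>) \<longlonglongrightarrow> 1"
    using uncovered_asymptotics[of "{(0,0)}"] by blast
  have cap0: "cap {(0,0)} = 0" by (simp add: cap_def)
  have proj0: "proj n (0,0) = (0,0)" for n by (simp add: proj_def)
  let ?p = "\<lambda>n. (1 - \<epsilon> n / (real n)\<^sup>2) ^ m n" and ?q = "\<lambda>n. (1 - \<omega> n / (real n)\<^sup>2) ^ m n"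
  \<comment> \<open>A difference of rates is rewritten through reciprocals, \<open>\<omega> -
    \<epsilon> = \<epsilon> \<omega> (1/\<epsilon> - 1/\<omega>)\<close>, so that
    \<open>green n (0,0)\<close> cancels. The constants combine to
    \<open>(4\<alpha>/\<pi>) (\<pi>/2)^2 = \<pi>\<alpha>\<close>.\<close>
  have "(\<lambda>n. real (m n) / ((real n)\<^sup>2 * (ln (real n))\<^sup>2) * (\<epsilon> n * ln (real n)) * (\<omega> n * ln (real n))
      * ((1 / \<epsilon> n - green n (0,0)) - (1 / \<omega> n - green n (0,0))))
    \<longlonglongrightarrow> 4 * \<alpha> / pi * (pi / 2) * (pi / 2) * (- cap A - - cap {(0,0)})"
    unfolding m_def s_def
    by (intro tendsto_mult tendsto_diff nat_floor_t_alpha_ratio assms(1) eps_ln_tendsto[OF \<epsilon>(1,2)]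
        eps_ln_tendsto[OF \<omega>(1,2)] \<epsilon>(2) \<omega>(2))
  hence lim1: "(\<lambda>n. real (m n) / ((real n)\<^sup>2 * (ln (real n))\<^sup>2) * (\<epsilon> n * ln (real n)) * (\<omega> n * ln (real n))
      * ((1 / \<epsilon> n - green n (0,0)) - (1 / \<omega> n - green n (0,0)))) \<longlonglongrightarrow> - pi * \<alpha> * cap A"
    by (simp add: cap0 field_simps)
  have "\<forall>\<^sub>F n in sequentially. real (m n) / ((real n)\<^sup>2 * (ln (real n))\<^sup>2) * (\<epsilon> n * ln (real n)) * (\<omega> n * ln (real n))
      * ((1 / \<epsilon> n - green n (0,0)) - (1 / \<omega> n - green n (0,0)))
    = real (m n) * (\<omega> n / (real n)\<^sup>2) - real (m n) * (\<epsilon> n / (real n)\<^sup>2)"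
    using \<epsilon>(1) \<omega>(1) eventually_ge_at_top[of 2]
  proof eventually_elim
    case (elim n)
    have "ln (real n) > 0" using elim by simp
    thus ?case using elim by (simp add: field_simps power2_eq_square)
  qed
  hence "(\<lambda>n. real (m n) * (\<omega> n / (real n)\<^sup>2) - real (m n) * (\<epsilon> n / (real n)\<^sup>2)) \<longlonglongrightarrow> - pi * \<alpha> * cap A"
    using lim1 by (rule Lim_transform_eventually[rotated])
  moreover have "(\<lambda>n. real (m n) * (ln (1 - \<epsilon> n / (real n)\<^sup>2) + \<epsilon> n / (real n)\<^sup>2)) \<longlonglongrightarrow> 0"
    "(\<lambda>n. real (m n) * (ln (1 - \<omega> n / (real n)\<^sup>2) + \<omega> n / (real n)\<^sup>2)) \<longlonglongrightarrow> 0"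
    unfolding m_def s_def by (intro times_ln_one_minus_tendsto \<epsilon> \<omega> assms(1))+
  ultimately have "(\<lambda>n. (real (m n) * (\<omega> n / (real n)\<^sup>2) - real (m n) * (\<epsilon> n / (real n)\<^sup>2))
      + real (m n) * (ln (1 - \<epsilon> n / (real n)\<^sup>2) + \<epsilon> n / (real n)\<^sup>2)
      - real (m n) * (ln (1 - \<omega> n / (real n)\<^sup>2) + \<omega> n / (real n)\<^sup>2)) \<longlonglongrightarrow> - pi * \<alpha> * cap A + 0 - 0"
    by (intro tendsto_add tendsto_diff)
  hence "(\<lambda>n. real (m n) * ln (1 - \<epsilon> n / (real n)\<^sup>2) - real (m n) * ln (1 - \<omega> n / (real n)\<^sup>2))
      \<longlonglongrightarrow> - pi * \<alpha> * cap A"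
    by (simp add: distrib_left)
  hence lim2: "(\<lambda>n. exp (real (m n) * ln (1 - \<epsilon> n / (real n)\<^sup>2) - real (m n) * ln (1 - \<omega> n / (real n)\<^sup>2)))
      \<longlonglongrightarrow> exp (- pi * \<alpha> * cap A)"
    by (rule tendsto_exp)
  \<comment> \<open>Both normalised uncovered probabilities tend to 1, which leaves the ratio of the
    two powers, written as an exponential.\<close>
  have "(\<lambda>n. uncovered_prob n (proj n ` A) (s n) / ?p n / (uncovered_prob n (proj n ` {(0,0)}) (s n) / ?q n)
      * exp (real (m n) * ln (1 - \<epsilon> n / (real n)\<^sup>2) - real (m n) * ln (1 - \<omega> n / (real n)\<^sup>2)))
      \<longlonglongrightarrow> 1 / 1 * exp (- pi * \<alpha> * cap A)"
    by (intro tendsto_mult tendsto_divide lim2) (use \<epsilon>(3)[of s] \<omega>(3)[of s] in \<open>simp_all add: m_def\<close>)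
  moreover have "\<forall>\<^sub>F n in sequentially.
      uncovered_prob n (proj n ` A) (s n) / ?p n / (uncovered_prob n (proj n ` {(0,0)}) (s n) / ?q n)
      * exp (real (m n) * ln (1 - \<epsilon> n / (real n)\<^sup>2) - real (m n) * ln (1 - \<omega> n / (real n)\<^sup>2))
      = cond_uncovered n A (s n)"
    using \<epsilon>(1) \<omega>(1) eventually_ge_at_top[of 2]
  proof eventually_elim
    case (elim n)
    have "4 \<le> (real n)\<^sup>2" using power_mono[of 2 "real n" 2] elim by simp
    hence pos: "0 < 1 - \<epsilon> n / (real n)\<^sup>2" "0 < 1 - \<omega> n / (real n)\<^sup>2"
      using elim by (simp_all add: divide_less_eq)
    have "exp (real (m n) * ln x) = x ^ m n" if "x > 0" for x
      using that by (simp add: exp_of_nat_mult)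
    hence "exp (real (m n) * ln (1 - \<epsilon> n / (real n)\<^sup>2) - real (m n) * ln (1 - \<omega> n / (real n)\<^sup>2)) = ?p n / ?q n"
      using pos by (simp add: exp_diff)
    moreover have "?p n \<noteq> 0" "?q n \<noteq> 0" using zero_less_power[OF pos(1), of "m n"] zero_less_power[OF pos(2), of "m n"]
      by linarith+
    moreover have "(0,0) \<in> proj n ` A" using assms(3) proj0[of n] by (metis image_eqI)
    hence "proj n ` A \<union> {(0,0)} = proj n ` A" by blast
    ultimately show ?case unfolding cond_uncovered_def by (simp add: proj0)
  qed
  ultimately have "(\<lambda>n. cond_uncovered n A (s n)) \<longlonglongrightarrow> 1 / 1 * exp (- pi * \<alpha> * cap A)"
    by (rule Lim_transform_eventually)
  thus ?thesis by (simp add: s_def)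
qed

end
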